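(* Let $F_{36}:=(6,\{02,03,05,12,13,15\})$. Then $\lambda_{F_{36}}=\frac{25}{6}\alpha_0^2-\frac{25}{6}\alpha_0+\frac56$, where $\alpha_0=0.1677\ldots$ is a root of the polynomial $\alpha^4-2\alpha^3+\frac73\alpha^2-\frac43\alpha+\frac16$. Furthermore, the $F_{36}$-problem is perfectly $B$-stable with $B:=(4,\{01,23\})$. Also, the unique (up to automorphisms of $B$) maximiser of $p(F_{36},B(\boldsymbol x))$ over $\boldsymbol x\in\mathbb S_4$ is $\boldsymbol x=\left(\frac12\alpha_0,\frac12\alpha_0,\frac12-\frac12\alpha_0,\frac12-\frac12\alpha_0\right)$.
   Context: All graphs are finite and simple. $(m,E)$ denotes the graph or pattern with vertex set $\{0,\dots,m-1\}$ and edge set $E$; $ij$ abbreviates $\{i,j\}$ ($ii$ is a loop). For graphs $F,G$ with $\kappa\le n$ vertices, $p(F,G)$ is the number of $\kappa$-subsets of $V(G)$ inducing a subgraph isomorphic to $F$, divided by $\binom n\kappa$; $p(F,n)$ is the maximum of $p(F,G)$ over $n$-vertex graphs $G$; $\lambda_F=\lim_{n\to\infty}p(F,n)$ (the limit exists). A pattern is a graph in which loops are allowed; its automorphisms are the bijections of the vertex set preserving edges, non-edges, loops and non-loops. For a pattern $B$ on $\{0,\dots,m-1\}$ and disjoint (possibly empty) sets $V_0,\dots,V_{m-1}$, the blowup $B(V_0,\dots,V_{m-1})$ is the simple graph on $\bigcup V_i$ in which distinct $x\in V_i$, $y\in V_j$ are adjacent iff $\{i,j\}\in E(B)$ (so $V_i$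 is a clique if $i$ has a loop and independent otherwise); $B()$ is the family of all blowups. $\mathbb S_m=\{\boldsymbol x\in\mathbb R^m:x_i\ge0,\sum x_i=1\}$, and $p(F,B(\boldsymbol x))$ is the limit as $n\to\infty$ of $p(F,B(V_0,\dots,V_{m-1}))$ with $|V_i|=(x_i+o(1))n$. $\delta_{\mathrm{edit}}(G,B())$ is the minimum number of vertex pairs whose adjacency must be changed to turn $G$ into a graph isomorphic to a blowup of $B$ (of the same order). The $F$-problem is perfectly $B$-stable if there is $C>0$ such that every graph $G$ with $n\ge C$ vertices satisfies $\delta_{\mathrm{edit}}(G,B())\le C\,(p(F,n)-p(F,G))\,n^2$. *)

theory Defs
  imports Complex_Main "HOL-Library.Disjoint_Sets" "HOL-Computational_Algebra.Polynomial"
begin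

text \<open>
  Graphs and patterns are pairs of a vertex set and a set of edges; an edge is a set
  \<open>{i, j}\<close> of vertices, and a loop at \<open>i\<close> is the singleton \<open>{i, i} = {i}\<close>.
\<close>

type_synonym 'a pattern = "'a set \<times> 'a set set"

abbreviation verts :: "'a pattern \<Rightarrow> 'a set" where "verts \<equiv> fst"
abbreviation edges :: "'a pattern \<Rightarrow> 'a set set" where "edges \<equiv> snd"

definition simple_graph :: "'a pattern \<Rightarrow> bool" where
  "simple_graph G \<longleftrightarrow> finite (verts G) \<and> (\<forall>e\<in>edges G. e \<subseteq> verts G \<and> card e = 2)"

text \<open>The case \<open>x = y\<close> makes isomorphisms respect loops and non-loops.\<close>

definition isomorphism :: "('a \<Rightarrow> 'b) \<Rightarrow> 'a pattern \<Rightarrow> 'b pattern \<Rightarrow> bool" where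
  "isomorphism f G H \<longleftrightarrow> bij_betw f (verts G) (verts H) \<and>
     (\<forall>x\<in>verts G. \<forall>y\<in>verts G. {x, y} \<in> edges G \<longleftrightarrow> {f x, f y} \<in> edges H)"

definition isomorphic :: "'a pattern \<Rightarrow> 'b pattern \<Rightarrow> bool" where
  "isomorphic G H \<longleftrightarrow> (\<exists>f. isomorphism f G H)"

definition automorphism :: "('a \<Rightarrow> 'a) \<Rightarrow> 'a pattern \<Rightarrow> bool" where
  "automorphism f B \<longleftrightarrow> isomorphism f B B"

definition induced :: "'a pattern \<Rightarrow> 'a set \<Rightarrow> 'a pattern" where
  "induced G S = (S, {e \<in> edges G. e \<subseteq> S})"

text \<open>The quantity \<open>p(F, G)\<close>.\<close>

definition density :: "'a pattern \<Rightarrow> 'b pattern \<Rightarrow> real" where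
  "density F G =
     real (card {S. S \<subseteq> verts G \<and> card S = card (verts F) \<and> isomorphic F (induced G S)})
       / real (card (verts G) choose card (verts F))"

text \<open>
  The quantity \<open>p(F, n)\<close>. Every finite graph has an isomorphic copy with vertices in \<open>nat\<close>,
  so it suffices to range over those; the set of attained densities is finite.
\<close>

definition max_density :: "'a pattern \<Rightarrow> nat \<Rightarrow> real" where
  "max_density F n = Max {density F G | G :: nat pattern. simple_graph G \<and> card (verts G) = n}"

text \<open>The quantity \<open>\<lambda>\<^sub>F\<close>.\<close>

definition inducibility :: "'a pattern \<Rightarrow> real" where
  "inducibility F = lim (\<lambda>n. max_density F n)"

definition blowup :: "'i pattern \<Rightarrow> ('i \<Rightarrow> 'a set) \<Rightarrow> 'a pattern" where
  "blowup B V = ((\<Union>i\<in>verts B. V i),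
     {{x, y} | x y. x \<noteq> y \<and>
        (\<exists>i\<in>verts B. \<exists>j\<in>verts B. x \<in> V i \<and> y \<in> V j \<and> {i, j} \<in> edges B)})"

definition parts_of :: "'i pattern \<Rightarrow> ('i \<Rightarrow> 'a set) \<Rightarrow> bool" where
  "parts_of B V \<longleftrightarrow> disjoint_family_on V (verts B) \<and> (\<forall>i\<in>verts B. finite (V i))"

definition blowups :: "'i pattern \<Rightarrow> 'a pattern set" where
  "blowups B = {blowup B V | V. parts_of B V}"

definition edit_distance :: "'a pattern \<Rightarrow> 'i pattern \<Rightarrow> nat" where
  "edit_distance G B = (LEAST k. \<exists>H :: 'a pattern.
     simple_graph H \<and> verts H = verts G \<and> (\<exists>K \<in> (blowups B :: 'a pattern set). isomorphic H K) \<and>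
     k = card ((edges G - edges H) \<union> (edges H - edges G)))"

definition perfectly_stable :: "'a pattern \<Rightarrow> 'i pattern \<Rightarrow> bool" where
  "perfectly_stable F B \<longleftrightarrow> (\<exists>C::real. C > 0 \<and>
     (\<forall>G :: nat pattern. simple_graph G \<and> real (card (verts G)) \<ge> C \<longrightarrow>
        real (edit_distance G B)
          \<le> C * (max_density F (card (verts G)) - density F G) * (real (card (verts G)))\<^sup>2))"

text \<open>Points of \<open>\<real>\<^sup>m\<close> are real lists of length \<open>m\<close>.\<close>

definition simplex :: "nat \<Rightarrow> real list set" where
  "simplex m = {x. length x = m \<and> (\<forall>i<m. x ! i \<ge> 0) \<and> sum_list x = 1}"

text \<open>
  The quantity \<open>p(F, B(x))\<close>, for a pattern \<open>B\<close> with vertex set \<open>{..<m}\<close>: the common limit of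
  \<open>p(F, B(V\<^sub>0, \<dots>, V\<^sub>m\<^sub>-\<^sub>1))\<close> along all sequences of parts with \<open>|V\<^sub>i| = (x\<^sub>i + o(1)) n\<close>.
\<close>

definition blowup_density :: "'a pattern \<Rightarrow> nat pattern \<Rightarrow> real list \<Rightarrow> real" where
  "blowup_density F B x = (THE L. \<forall>V :: nat \<Rightarrow> nat \<Rightarrow> nat set.
     (\<forall>n. parts_of B (V n)) \<and>
     (\<forall>i\<in>verts B. (\<lambda>n. real (card (V n i)) / real n) \<longlonglongrightarrow> x ! i) \<longrightarrow>
     (\<lambda>n. density F (blowup B (V n))) \<longlonglongrightarrow> L)"

definition blowup_maximiser :: "'a pattern \<Rightarrow> nat pattern \<Rightarrow> real list \<Rightarrow> bool" where
  "blowup_maximiser F B x \<longleftrightarrow> x \<in> simplex (card (verts B)) \<and>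
     (\<forall>y \<in> simplex (card (verts B)). blowup_density F B y \<le> blowup_density F B x)"

definition unique_maximiser_up_to_automorphism ::
    "'a pattern \<Rightarrow> nat pattern \<Rightarrow> real list \<Rightarrow> bool" where
  "unique_maximiser_up_to_automorphism F B x \<longleftrightarrow> blowup_maximiser F B x \<and>
     (\<forall>y. blowup_maximiser F B y \<longrightarrow>
        (\<exists>f. automorphism f B \<and> (\<forall>i\<in>verts B. y ! i = x ! f i)))"

definition F36 :: "nat pattern" where
  "F36 = ({..<6}, {{0,2}, {0,3}, {0,5}, {1,2}, {1,3}, {1,5}})"

definition B36 :: "nat pattern" where
  "B36 = ({..<4}, {{0,1}, {2,3}})"

end

theory Submission
  imports Defs "HOL-Analysis.Analysis"
begin

text \<open>
  \<open>F36\<close> is a complete bipartite graph with sides of size two and three together with an isolated vertex,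
  and the blowups of \<open>B36\<close> are the disjoint unions of two complete bipartite graphs. Copies are counted
  as ordered tuples (\<open>emb\<close>), each copy giving twelve of them, and \<open>emb_density\<close> is the probability that six
  independent random vertices form such a tuple. If both components are balanced and the larger one has
  relative size \<open>q\<close>, this probability tends to \<open>Lam q / 16\<close> with \<open>Lam q = q\<^sup>5 (1 - q) + q (1 - q)\<^sup>5\<close>, which is
  largest for \<open>q = 1 - alpha\<close>. So everything rests on three claims: no graph does better, nearly optimal
  graphs are nearly such blowups, and a graph that cannot be improved cheaply is exactly one.

  \<^bold>\<open>The density bound.\<close> Every copy has edges between its two sides; \<open>edge_density x y\<close> counts the copies
  in which \<open>x y\<close> is such an edge. The vertices on the sides are then neighbours of exactly one of \<open>x\<close> and \<open>y\<close>,
  and the isolated vertex is adjacent to neither. Since the normalised sum of \<open>1 / (dg x + dg y)\<close> over the edges inside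
  a set \<open>Q\<close> is at most \<open>mu Q / 2\<close> (\<open>sum_inverse_degrees\<close>), it suffices to control
  \<open>Psi x y = 4 * edge_density x y * (dg x + dg y)\<close>. Take an edge that maximises it. The neighbourhood of this
  edge is the large component, and the set \<open>D x y\<close> of vertices that see little of it is the small one. Edges
  outside \<open>D x y\<close> are bounded by the maximality, while the neighbourhood of an edge inside \<open>D x y\<close> is not
  much larger than \<open>D x y\<close> itself (\<open>inside_D_growth\<close>). What remains is an inequality between a few real
  numbers (\<open>master_inequality\<close>); together this is \<open>emb_density_le\<close>.

  \<^bold>\<open>Stability.\<close> Each step has a description of its equality case, and compactness (\<open>compact_slack\<close>) turns
  it into a description of near equality. A nearly extremal graph therefore has a large component around the
  maximal edge and a small one around some edge inside \<open>D x y\<close>, that is, a map to the four parts with few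
  pairs whose adjacency is wrong (\<open>stability\<close>).

  \<^bold>\<open>Exactness.\<close> Suppose that changing a few pairs cannot increase the number of copies by more than a small
  multiple of the number of changed pairs (\<open>optimal\<close>). Then every vertex lies in about as many copies as
  the average one, because it could be replaced by a clone of any other vertex. The number of copies at a
  vertex is essentially a polynomial in its degrees to the four parts that is maximal only at clones of the vertices of
  some part (\<open>vertex_poly_le\<close>), so after reassigning a few vertices every vertex is in few wrong pairs.
  Finally, no copy of \<open>F36\<close> contains exactly one wrong pair (\<open>emb6_not_one_wrong\<close>), so correcting a
  wrong pair would destroy few copies and create many: there is none (\<open>optimal_structure\<close>).

  \<^bold>\<open>Perfect stability.\<close> On a fixed vertex set maximise the density of copies plus a small multiple of the
  edit distance. The edit distance changes by at most one when an edge changes, so the maximiser is optimal in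
  the above sense and thus a blowup, with edit distance zero. Comparing it with an arbitrary graph gives the
  required inequality. The densities of blowups are polynomials in the part sizes, and maximising them over
  the simplex is elementary.
\<close>

section \<open>Averages over a vertex set\<close>

locale vertices =
  fixes W :: "'a set"
  assumes fin: "finite W" and ne: "W \<noteq> {}"
begin

definition av :: "('a \<Rightarrow> real) \<Rightarrow> real" where
  "av f = (\<Sum>x\<in>W. f x) / real (card W)"

lemma card_pos: "real (card W) > 0"
  using fin ne by (simp add: card_gt_0_iff)

lemma av_const [simp]: "av (\<lambda>x. c) = c"
  using card_pos by (simp add: av_def)

lemma av_add: "av (\<lambda>x. f x + g x) = av f + av g"
  by (simp add: av_def sum.distrib add_divide_distrib)

lemma av_diff: "av (\<lambda>x. f x - g x) = av f - av g"
  by (simp add: av_def sum_subtractf diff_divide_distrib)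

lemma av_cmult [simp]: "av (\<lambda>x. c * f x) = c * av f"
  by (simp add: av_def sum_distrib_left)

lemma av_multc [simp]: "av (\<lambda>x. f x * c) = av f * c"
  by (simp add: av_def sum_distrib_right)

lemma av_divide [simp]: "av (\<lambda>x. f x / c) = av f / c"
  by (simp add: av_def sum_divide_distrib[symmetric])

lemma av_cong: "(\<And>x. x \<in> W \<Longrightarrow> f x = g x) \<Longrightarrow> av f = av g"
  by (simp add: av_def)

lemma av_mono: "(\<And>x. x \<in> W \<Longrightarrow> f x \<le> g x) \<Longrightarrow> av f \<le> av g"
  unfolding av_def using card_pos by (intro divide_right_mono sum_mono) auto

lemma av_nonneg: "(\<And>x. x \<in> W \<Longrightarrow> 0 \<le> f x) \<Longrightarrow> 0 \<le> av f"
  using av_mono[of "\<lambda>_. 0" f] by simp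

lemma av_le_const: "(\<And>x. x \<in> W \<Longrightarrow> f x \<le> c) \<Longrightarrow> av f \<le> c"
  using av_mono[of f "\<lambda>_. c"] by simp

lemma av_swap: "av (\<lambda>x. av (\<lambda>y. f x y)) = av (\<lambda>y. av (\<lambda>x. f x y))"
  unfolding av_def sum_divide_distrib[symmetric] by (subst sum.swap) simp

lemma av_point: "x \<in> W \<Longrightarrow> av (\<lambda>y. of_bool (y = x)) = 1 / real (card W)"
  using fin by (simp add: av_def of_bool_def)

definition mu :: "'a set \<Rightarrow> real" where
  "mu X = av (\<lambda>x. of_bool (x \<in> X))"

lemma mu_nonneg [simp]: "0 \<le> mu X"
  unfolding mu_def by (rule av_nonneg) simp

lemma mu_le_1 [simp]: "mu X \<le> 1"
  unfolding mu_def by (rule av_le_const) simp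

lemma mu_mono: "X \<inter> W \<subseteq> Y \<Longrightarrow> mu X \<le> mu Y"
  unfolding mu_def by (rule av_mono) auto

lemma mu_card: "X \<subseteq> W \<Longrightarrow> mu X = real (card X) / real (card W)"
  using fin by (simp add: mu_def av_def of_bool_def sum.If_cases Int_absorb1)

end

text \<open>\<open>a, a'\<close> is the side of size two, \<open>b, b', b''\<close> the side of size three and \<open>v\<close> the isolated vertex.
  Distinctness across the sides is automatic in a loopless symmetric relation, as adjacent vertices differ and
  \<open>v\<close> has no neighbour among the others.\<close>

definition emb :: "('a \<Rightarrow> 'a \<Rightarrow> bool) \<Rightarrow> 'a \<Rightarrow> 'a \<Rightarrow> 'a \<Rightarrow> 'a \<Rightarrow> 'a \<Rightarrow> 'a \<Rightarrow> bool" where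
  "emb adj a a' b b' b'' v \<longleftrightarrow>
     a \<noteq> a' \<and> b \<noteq> b' \<and> b \<noteq> b'' \<and> b' \<noteq> b'' \<and>
     adj a b \<and> adj a b' \<and> adj a b'' \<and> adj a' b \<and> adj a' b' \<and> adj a' b'' \<and>
     \<not> adj a a' \<and> \<not> adj b b' \<and> \<not> adj b b'' \<and> \<not> adj b' b'' \<and>
     \<not> adj v a \<and> \<not> adj v a' \<and> \<not> adj v b \<and> \<not> adj v b' \<and> \<not> adj v b''"

context vertices begin

text \<open>The density of copies in which \<open>x\<close> is on the side of size two and its neighbour \<open>y\<close> on the other one.\<close>

definition extension_density :: "('a \<Rightarrow> 'a \<Rightarrow> bool) \<Rightarrow> 'a \<Rightarrow> 'a \<Rightarrow> real" where
  "extension_density adj x y =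
     av (\<lambda>v. av (\<lambda>a. av (\<lambda>b. av (\<lambda>b'. of_bool (emb adj x a y b b' v)))))"

definition emb_density :: "('a \<Rightarrow> 'a \<Rightarrow> bool) \<Rightarrow> real" where
  "emb_density adj = av (\<lambda>x. av (\<lambda>y. extension_density adj x y))"

end

locale graph = vertices W for W :: "'a set" +
  fixes adj :: "'a \<Rightarrow> 'a \<Rightarrow> bool"
  assumes sym: "adj x y \<Longrightarrow> adj y x" and irr: "\<not> adj x x"
begin

lemma adj_commute: "adj x y \<longleftrightarrow> adj y x"
  using sym by blast

definition dg :: "'a \<Rightarrow> real" where
  "dg x = mu {y. adj x y}"

lemma dg_nonneg [simp]: "0 \<le> dg x" by (simp add: dg_def)

lemma dg_pos: assumes "y \<in> W" "adj x y" shows "dg x > 0"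
proof -
  have "1 / real (card W) = mu {y}" using assms mu_card[of "{y}"] by simp
  also have "\<dots> \<le> dg x" unfolding dg_def using assms by (intro mu_mono) auto
  finally show ?thesis using card_pos by (smt (verit) divide_pos_pos)
qed

text \<open>By convexity \<open>1 / (dg x + dg y)\<close> is at most the average of \<open>1 / (2 * dg x)\<close> and \<open>1 / (2 * dg y)\<close>, and
  summing \<open>1 / dg x\<close> over the neighbours \<open>y\<close> of \<open>x\<close> gives at most one.\<close>

lemma sum_inverse_degrees:
  "av (\<lambda>x. av (\<lambda>y. of_bool (adj x y \<and> x \<in> Q \<and> y \<in> Q) / (dg x + dg y))) \<le> mu Q / 2"
proof -
  define f where "f x y = (of_bool (adj x y \<and> x \<in> Q \<and> y \<in> Q) :: real)" for x y
  have f_sym: "f x y = f y x" for x y unfolding f_def using adj_commute[of x y] by (simp add: conj_ac)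
  have "av (\<lambda>x. av (\<lambda>y. f x y / (dg x + dg y))) \<le>
      av (\<lambda>x. av (\<lambda>y. f x y / (4 * dg x) + f x y / (4 * dg y)))"
  proof (intro av_mono)
    fix x y assume xy: "x \<in> W" "y \<in> W"
    show "f x y / (dg x + dg y) \<le> f x y / (4 * dg x) + f x y / (4 * dg y)"
    proof (cases "adj x y")
      case True
      have p: "dg x > 0" "dg y > 0" using dg_pos True sym xy by blast+
      have "1 / (dg x + dg y) \<le> 1 / (4 * dg x) + 1 / (4 * dg y)"
      proof -
        have "1 / (4 * dg x) + 1 / (4 * dg y) - 1 / (dg x + dg y)
            = (dg x - dg y)\<^sup>2 / (4 * dg x * dg y * (dg x + dg y))"
          using p by (simp add: divide_simps add_pos_pos) (simp add: field_simps power2_eq_square)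
        also have "\<dots> \<ge> 0" using p by simp
        finally show ?thesis by simp
      qed
      then show ?thesis unfolding f_def by (cases "x \<in> Q \<and> y \<in> Q") auto
    qed (simp add: f_def)
  qed
  also have "\<dots> = av (\<lambda>x. av (\<lambda>y. f x y / (4 * dg x))) + av (\<lambda>x. av (\<lambda>y. f x y / (4 * dg y)))"
    by (simp add: av_add)
  also have "av (\<lambda>x. av (\<lambda>y. f x y / (4 * dg y))) = av (\<lambda>y. av (\<lambda>x. f y x / (4 * dg y)))"
    by (subst av_swap) (simp add: f_sym)
  also have "av (\<lambda>x. av (\<lambda>y. f x y / (4 * dg x))) \<le> av (\<lambda>x. of_bool (x \<in> Q) / 4)"
  proof (rule av_mono)
    fix x assume x: "x \<in> W"
    have "av (\<lambda>y. f x y) \<le> of_bool (x \<in> Q) * dg x"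
      unfolding f_def dg_def mu_def av_cmult[symmetric] by (rule av_mono) auto
    then have "av (\<lambda>y. f x y / (4 * dg x)) \<le> of_bool (x \<in> Q) * dg x / (4 * dg x)"
      by (simp only: av_divide) (intro divide_right_mono, auto)
    also have "\<dots> \<le> of_bool (x \<in> Q) / 4" by (cases "dg x = 0") auto
    finally show "av (\<lambda>y. f x y / (4 * dg x)) \<le> of_bool (x \<in> Q) / 4" .
  qed
  finally show ?thesis unfolding f_def mu_def by simp
qed

end

section \<open>Copies that contain a given edge\<close>

text \<open>The functions \<open>(p + r) (p - r)\<^sup>3\<close> of this and the next lemma arise in \<open>Psi_le_av\<close>: \<open>p\<close> is the measure of
  the neighbourhood of an edge, and \<open>r\<close> the part of it that a further vertex is adjacent to.\<close>

lemma detached_cube_small: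
  fixes p r :: real
  assumes "0 \<le> r" "r \<le> p / 2"
  shows "(p + r) * (p - r) ^ 3 \<le> p ^ 4 - 13 / 8 * p ^ 3 * r"
proof -
  have "p ^ 4 - 13 / 8 * p ^ 3 * r - (p + r) * (p - r) ^ 3
      = r * ((p / 2 - r) * (3 / 4 * p\<^sup>2 + r * (3 / 2 * p - r)))"
    by (simp add: field_simps power2_eq_square power3_eq_cube power4_eq_xxxx)
  also have "\<dots> \<ge> 0" using assms by (intro mult_nonneg_nonneg add_nonneg_nonneg) auto
  finally show ?thesis by simp
qed

lemma detached_cube_antimono:
  fixes p r s :: real
  assumes "0 \<le> r" "r \<le> s" "s \<le> p"
  shows "(p + s) * (p - s) ^ 3 \<le> (p + r) * (p - r) ^ 3"
proof -
  have 1: "(p + s) * (p - s) \<le> (p + r) * (p - r)"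
    using mult_mono[OF assms(2,2)] assms by (simp add: algebra_simps)
  have 2: "(p - s)\<^sup>2 \<le> (p - r)\<^sup>2" using assms by (intro power_mono) auto
  have "((p + s) * (p - s)) * (p - s)\<^sup>2 \<le> ((p + r) * (p - r)) * (p - r)\<^sup>2"
    using assms by (intro mult_mono[OF 1 2]) auto
  moreover have "(p + u) * (p - u) ^ 3 = ((p + u) * (p - u)) * (p - u)\<^sup>2" for u
    by (simp add: power2_eq_square power3_eq_cube)
  ultimately show ?thesis by (simp only:)
qed

lemma mult_sum_le_cube:
  fixes a b :: real
  assumes "0 \<le> a + b"
  shows "a * b * (a + b) \<le> (a + b) ^ 3 / 4"
proof -
  have "(a + b) ^ 3 / 4 - a * b * (a + b) = (a + b) * ((a - b)\<^sup>2 / 4)"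
    by (simp add: field_simps power2_eq_square power3_eq_cube)
  also have "\<dots> \<ge> 0" using assms by simp
  finally show ?thesis by simp
qed

lemma cube_times_rest_le:
  fixes s c :: real
  assumes "0 \<le> s" "0 \<le> c" "s + c \<le> 1"
  shows "s ^ 3 * c \<le> 27 / 256"
proof -
  have "s ^ 3 * c \<le> s ^ 3 * (1 - s)" using assms by (intro mult_left_mono) auto
  moreover have "27 / 256 - s ^ 3 * (1 - s) = (s - 3/4)\<^sup>2 * (s\<^sup>2 + s / 2 + 3 / 16)"
    by (simp add: field_simps power2_eq_square power3_eq_cube)
  moreover have "(s - 3/4)\<^sup>2 * (s\<^sup>2 + s / 2 + 3 / 16) \<ge> 0"
    using assms by (intro mult_nonneg_nonneg add_nonneg_nonneg) auto
  ultimately show ?thesis by linarith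
qed

context vertices begin

lemma mu_Un_disjoint: "X \<inter> Y \<inter> W = {} \<Longrightarrow> mu (X \<union> Y) = mu X + mu Y"
  unfolding mu_def av_add[symmetric] by (rule av_cong) auto

lemma mu_split: "mu X = mu (X \<inter> Y) + mu (X - Y)"
  unfolding mu_def av_add[symmetric] by (rule av_cong) auto

lemma mu_Un_le: "mu (X \<union> Y) \<le> mu X + mu Y"
  unfolding mu_def av_add[symmetric] by (rule av_mono) auto

lemma mu_compl: "mu (- X) = 1 - mu X"
  using mu_split[of UNIV X] by (simp add: mu_def Compl_eq_Diff_UNIV)

lemma mu_cong: "X \<inter> W = Y \<inter> W \<Longrightarrow> mu X = mu Y"
  unfolding mu_def by (rule av_cong) auto

end

context graph begin

definition nb :: "'a \<Rightarrow> 'a set" where "nb x = {y. adj x y}"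

definition edge_density :: "'a \<Rightarrow> 'a \<Rightarrow> real" where
  "edge_density x y = extension_density adj x y + extension_density adj y x"

text \<open>In a disjoint union of complete bipartite graphs this vanishes for all vertices \<open>v\<close> outside the component of the
  edge \<open>x y\<close>.\<close>

definition r :: "'a \<Rightarrow> 'a \<Rightarrow> 'a \<Rightarrow> real" where
  "r x y v = mu (nb v \<inter> (nb x \<union> nb y))"

text \<open>The candidates for the isolated vertex in the copies that use the edge \<open>x y\<close>.\<close>

definition far :: "'a \<Rightarrow> 'a \<Rightarrow> 'a set" where
  "far x y = - (nb x \<union> nb y)"

lemma dg_nb: "dg x = mu (nb x)"
  by (simp add: dg_def nb_def)

lemma extension_density_nonneg [simp]: "0 \<le> extension_density adj x y"
  unfolding extension_density_def by (intro av_nonneg) simp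

lemma edge_density_nonneg [simp]: "0 \<le> edge_density x y"
  by (simp add: edge_density_def)

lemma edge_density_commute: "edge_density x y = edge_density y x"
  by (simp add: edge_density_def)

lemma extension_density_nonadj: "\<not> adj x y \<Longrightarrow> extension_density adj x y = 0"
  by (simp add: extension_density_def emb_def)

lemma dg_sum: "dg x + dg y = mu (nb x \<union> nb y) + mu (nb x \<inter> nb y)"
  unfolding dg_nb mu_def av_add[symmetric] by (rule av_cong) auto

text \<open>For a fixed isolated vertex \<open>v\<close> the remaining vertices must avoid the neighbourhood of \<open>v\<close>.\<close>

lemma extension_density_le:
  "extension_density adj x y \<le>
     av (\<lambda>v. of_bool (v \<in> far x y) * (mu (nb y - nb x - nb v) * mu (nb x - nb y - nb v) ^ 2))"
  unfolding extension_density_def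
proof (rule av_mono)
  fix v
  have "av (\<lambda>a. av (\<lambda>b. av (\<lambda>b'. of_bool (emb adj x a y b b' v)))) \<le>
     av (\<lambda>a. av (\<lambda>b. av (\<lambda>b'. of_bool (v \<in> far x y) *
        (of_bool (a \<in> nb y - nb x - nb v) * (of_bool (b \<in> nb x - nb y - nb v) *
          of_bool (b' \<in> nb x - nb y - nb v))))))"
    by (intro av_mono) (auto simp: emb_def far_def nb_def adj_commute)
  also have "\<dots> = of_bool (v \<in> far x y) * (mu (nb y - nb x - nb v) * mu (nb x - nb y - nb v) ^ 2)"
    by (simp add: mu_def power2_eq_square)
  finally show "av (\<lambda>a. av (\<lambda>b. av (\<lambda>b'. of_bool (emb adj x a y b b' v)))) \<le> \<dots>" .
qed

text \<open>The two extension densities combine to \<open>a b (a + b)\<close>, which is at most \<open>(a + b)\<^sup>3 / 4\<close> with equality for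
  sides of the same size.\<close>

lemma edge_density_le_cube:
  "edge_density x y \<le>
     av (\<lambda>v. of_bool (v \<in> far x y) * (mu ((nb x \<union> nb y) - (nb x \<inter> nb y) - nb v) ^ 3 / 4))"
proof -
  let ?a = "\<lambda>v. mu (nb y - nb x - nb v)" and ?b = "\<lambda>v. mu (nb x - nb y - nb v)"
  have far_comm: "far y x = far x y" by (auto simp: far_def)
  have "edge_density x y \<le>
      av (\<lambda>v. of_bool (v \<in> far x y) * (?a v * ?b v ^ 2) + of_bool (v \<in> far x y) * (?b v * ?a v ^ 2))"
    unfolding edge_density_def av_add
    using extension_density_le[of x y] extension_density_le[of y x] by (simp add: far_comm)
  also have "\<dots> \<le> av (\<lambda>v. of_bool (v \<in> far x y) *
      (mu ((nb x \<union> nb y) - (nb x \<inter> nb y) - nb v) ^ 3 / 4))"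
  proof (rule av_mono)
    fix v
    have "mu ((nb x \<union> nb y) - (nb x \<inter> nb y) - nb v) = ?a v + ?b v"
      unfolding mu_def av_add[symmetric] by (rule av_cong) auto
    then show "of_bool (v \<in> far x y) * (?a v * ?b v ^ 2) + of_bool (v \<in> far x y) * (?b v * ?a v ^ 2)
      \<le> of_bool (v \<in> far x y) * (mu ((nb x \<union> nb y) - (nb x \<inter> nb y) - nb v) ^ 3 / 4)"
      using mult_sum_le_cube[of "?a v" "?b v"]
      by (auto simp: algebra_simps power2_eq_square)
  qed
  finally show ?thesis .
qed

lemma edge_density_le_UT:
  "edge_density x y \<le> (mu (nb x \<union> nb y) - mu (nb x \<inter> nb y)) ^ 3 * (1 - mu (nb x \<union> nb y)) / 4"
proof -
  let ?s = "mu (nb x \<union> nb y) - mu (nb x \<inter> nb y)"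
  have s: "mu ((nb x \<union> nb y) - (nb x \<inter> nb y)) = ?s"
    using mu_split[of "nb x \<union> nb y" "nb x \<inter> nb y"]
    by (simp add: Int_absorb1[of "nb x \<inter> nb y" "nb x \<union> nb y"] le_infI1)
  have "edge_density x y \<le> av (\<lambda>v. of_bool (v \<in> far x y) * (?s ^ 3 / 4))"
    by (rule order.trans[OF edge_density_le_cube], rule av_mono, rule mult_left_mono)
      (auto simp flip: s intro!: power_mono mu_mono)
  also have "\<dots> = mu (far x y) * (?s ^ 3 / 4)" by (simp add: mu_def)
  also have "mu (far x y) = 1 - mu (nb x \<union> nb y)" unfolding far_def by (rule mu_compl)
  finally show ?thesis by (simp add: mult.commute)
qed

lemma edge_density_le_const: "edge_density x y \<le> 27 / 1024"
proof -
  let ?p = "mu (nb x \<union> nb y)" and ?t = "mu (nb x \<inter> nb y)"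
  have "?t \<le> ?p" by (rule mu_mono) auto
  moreover have "?p \<le> 1" by simp
  moreover have "0 \<le> ?t" by (rule mu_nonneg)
  ultimately have "(?p - ?t) ^ 3 * (1 - ?p) \<le> 27 / 256"
    by (intro cube_times_rest_le) linarith+
  then show ?thesis using edge_density_le_UT[of x y] by simp
qed

text \<open>The vertices far from the edge \<open>x y\<close> that see at most half of its neighbourhood. They play the role of the
  other component. The remaining far vertices are called exceptional.\<close>

definition D :: "'a \<Rightarrow> 'a \<Rightarrow> 'a set" where
  "D x y = {v \<in> far x y. r x y v \<le> mu (nb x \<union> nb y) / 2}"

text \<open>The density of the edges that leak from \<open>D x y\<close> into the neighbourhood of \<open>x y\<close>.\<close>

definition R :: "'a \<Rightarrow> 'a \<Rightarrow> real" where
  "R x y = av (\<lambda>v. of_bool (v \<in> D x y) * r x y v)"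

text \<open>Weighting by the degrees makes this summable over edges by \<open>sum_inverse_degrees\<close>. In a complete bipartite
  component of relative size \<open>q\<close> with sides of the same size its value is \<open>q\<^sup>4 (1 - q)\<close>.\<close>

definition Psi :: "'a \<Rightarrow> 'a \<Rightarrow> real" where
  "Psi x y = 4 * edge_density x y * (dg x + dg y)"

lemma r_nonneg [simp]: "0 \<le> r x y v" by (simp add: r_def)

lemma r_le: "r x y v \<le> mu (nb x \<union> nb y)" unfolding r_def by (rule mu_mono) auto

text \<open>Common neighbours of \<open>x\<close> and \<open>y\<close> increase \<open>dg x + dg y\<close> but, like the neighbours of \<open>v\<close>, they cannot be used
  in copies on the edge \<open>x y\<close>. If both together have measure \<open>z\<close>, the contribution of \<open>v\<close> is at most
  \<open>(p + z) (p - z)\<^sup>3\<close>, which decreases in \<open>z\<close>, so that only the neighbours of \<open>v\<close> have to be kept.\<close>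

lemma Psi_le_av:
  "Psi x y \<le> av (\<lambda>v. of_bool (v \<in> far x y) *
     ((mu (nb x \<union> nb y) + r x y v) * (mu (nb x \<union> nb y) - r x y v) ^ 3))"
proof -
  let ?p = "mu (nb x \<union> nb y)" and ?t = "mu (nb x \<inter> nb y)"
  let ?s = "\<lambda>v. mu ((nb x \<union> nb y) - (nb x \<inter> nb y) - nb v)"
  have "Psi x y \<le> 4 * av (\<lambda>v. of_bool (v \<in> far x y) * (?s v ^ 3 / 4)) * (?p + ?t)"
    unfolding Psi_def dg_sum using edge_density_le_cube[of x y]
    by (intro mult_right_mono) auto
  also have "\<dots> = av (\<lambda>v. of_bool (v \<in> far x y) * ((?p + ?t) * ?s v ^ 3))"
    by (simp add: av_cmult[symmetric] av_multc[symmetric] algebra_simps del: av_cmult av_multc)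
  also have "\<dots> \<le> av (\<lambda>v. of_bool (v \<in> far x y) * ((?p + r x y v) * (?p - r x y v) ^ 3))"
  proof (intro av_mono mult_left_mono)
    fix v
    \<comment> \<open>\<open>z\<close> is the part of the neighbourhood lost to common neighbours or to \<open>v\<close>.\<close>
    define z where "z = ?p - ?s v"
    have sp: "?p = mu ((nb x \<inter> nb y) \<union> ((nb x \<union> nb y) \<inter> nb v)) + ?s v"
      by (subst mu_Un_disjoint[symmetric]) (auto intro!: arg_cong[where f = mu])
    have "?t \<le> z" unfolding z_def using sp mu_mono[of "nb x \<inter> nb y" "(nb x \<inter> nb y) \<union> ((nb x \<union> nb y) \<inter> nb v)"]
      by auto
    moreover have rz: "r x y v \<le> z" unfolding z_def r_def
      using sp mu_mono[of "nb v \<inter> (nb x \<union> nb y)" "(nb x \<inter> nb y) \<union> ((nb x \<union> nb y) \<inter> nb v)"] by auto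
    moreover have "z \<le> ?p" unfolding z_def by simp
    ultimately have "(?p + ?t) * (?p - z) ^ 3 \<le> (?p + z) * (?p - z) ^ 3"
      by (intro mult_right_mono) auto
    also have "\<dots> \<le> (?p + r x y v) * (?p - r x y v) ^ 3"
      using rz \<open>z \<le> ?p\<close> by (intro detached_cube_antimono) auto
    finally show "(?p + ?t) * ?s v ^ 3 \<le> (?p + r x y v) * (?p - r x y v) ^ 3"
      by (simp add: z_def)
  qed simp
  finally show ?thesis .
qed

text \<open>A vertex \<open>v\<close> of \<open>D x y\<close> contributes \<open>p\<^sup>4\<close> minus a term linear in \<open>r x y v\<close>, and an exceptional one at most
  \<open>(p + p / 2) (p / 2)\<^sup>3 = 3 / 16 p\<^sup>4\<close>.\<close>

lemma Psi_le:
  defines "p \<equiv> \<lambda>x y. mu (nb x \<union> nb y)"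
  shows "Psi x y \<le> p x y ^ 4 * (mu (D x y) + 3 / 16 * mu (far x y - D x y)) - 13 / 8 * p x y ^ 3 * R x y"
proof -
  let ?p = "p x y"
  have p0: "0 \<le> ?p" by (simp add: p_def)
  have "Psi x y \<le> av (\<lambda>v. of_bool (v \<in> D x y) * ?p ^ 4 - 13 / 8 * ?p ^ 3 * (of_bool (v \<in> D x y) * r x y v)
      + of_bool (v \<in> far x y - D x y) * (3 / 16 * ?p ^ 4))"
  proof (rule order.trans[OF Psi_le_av], rule av_mono)
    fix v
    consider "v \<notin> far x y" | "v \<in> D x y" | "v \<in> far x y" "v \<notin> D x y" by blast
    then show "of_bool (v \<in> far x y) * ((mu (nb x \<union> nb y) + r x y v) * (mu (nb x \<union> nb y) - r x y v) ^ 3)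
      \<le> of_bool (v \<in> D x y) * ?p ^ 4 - 13 / 8 * ?p ^ 3 * (of_bool (v \<in> D x y) * r x y v)
      + of_bool (v \<in> far x y - D x y) * (3 / 16 * ?p ^ 4)"
    proof cases
      case 1
      then have "v \<notin> D x y" by (simp add: D_def)
      with 1 show ?thesis by simp
    next
      case 2
      then have "v \<in> far x y" "r x y v \<le> ?p / 2" by (auto simp: D_def p_def)
      with 2 show ?thesis using detached_cube_small[of "r x y v" ?p] by (simp add: p_def)
    next
      case 3
      then have "?p / 2 \<le> r x y v" by (auto simp: D_def p_def)
      with 3 show ?thesis
        using detached_cube_antimono[of "?p / 2" "r x y v" ?p] p0 r_le[of x y v]
        by (simp add: p_def power3_eq_cube power4_eq_xxxx)
    qed
  qed
  also have "\<dots> = mu (D x y) * ?p ^ 4 - 13 / 8 * ?p ^ 3 * R x y + mu (far x y - D x y) * (3 / 16 * ?p ^ 4)"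
    by (simp add: av_add av_diff mu_def R_def)
  finally show ?thesis by (simp add: algebra_simps)
qed

end

section \<open>Counting over edges\<close>

text \<open>The neighbourhood of an edge inside \<open>D x y\<close> may exceed \<open>D x y\<close>, and then \<open>U\<^sup>4 (1 - U)\<close> exceeds
  \<open>d\<^sup>4 (1 - d)\<close>. The constant \<open>K\<close> bounds this growth linearly in \<open>U - d\<close>; the factor \<open>U\<close> cancels later
  against \<open>dg u + dg v\<close>. The inequality is strict so that equality cases stay visible.\<close>

definition growth_const :: "real \<Rightarrow> real \<Rightarrow> bool" where
  "growth_const d K \<longleftrightarrow> 0 \<le> K \<and> 0 \<le> d \<and> d \<le> 4 / 5 \<and>
     (\<forall>U. d < U \<longrightarrow> U \<le> 1 \<longrightarrow> U ^ 4 * (1 - U) < d ^ 4 * (1 - d) + K * U * (U - d))"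

lemma fourth_power_rest_mono:
  fixes U d :: real
  assumes "0 \<le> U" "U \<le> d" "d \<le> 4 / 5"
  shows "U ^ 4 * (1 - U) \<le> d ^ 4 * (1 - d)"
proof (rule DERIV_nonneg_imp_nondecreasing[OF assms(2), of "\<lambda>U. U ^ 4 * (1 - U)"])
  fix x assume x: "U \<le> x" "x \<le> d"
  have "((\<lambda>U. U ^ 4 * (1 - U)) has_real_derivative x ^ 3 * (4 - 5 * x)) (at x)"
    by (auto intro!: derivative_eq_intros simp: power3_eq_cube power4_eq_xxxx algebra_simps)
  moreover have "0 \<le> x ^ 3 * (4 - 5 * x)" using x assms by (intro mult_nonneg_nonneg) auto
  ultimately show "\<exists>y. ((\<lambda>U. U ^ 4 * (1 - U)) has_real_derivative y) (at x) \<and> 0 \<le> y" by blast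
qed

lemma diff_cube_sum_le:
  fixes U t :: real
  assumes "0 \<le> t" "t \<le> U"
  shows "(U - t) ^ 3 * (U + t) \<le> U ^ 4"
  using detached_cube_antimono[of 0 t U] assms
  by (simp add: mult.commute power3_eq_cube power4_eq_xxxx)

lemma growth_bound:
  fixes U t d K w :: real
  assumes "growth_const d K" "0 \<le> t" "t \<le> U" "U \<le> 1" "U \<le> d + w" "0 \<le> w"
  shows "(U - t) ^ 3 * (1 - U) * (U + t) \<le> d ^ 4 * (1 - d) + K * w * (U + t)"
proof -
  have "(U - t) ^ 3 * (U + t) * (1 - U) \<le> U ^ 4 * (1 - U)"
    using diff_cube_sum_le[of t U] assms by (intro mult_right_mono) auto
  also have "\<dots> \<le> d ^ 4 * (1 - d) + K * w * (U + t)"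
  proof (cases "U \<le> d")
    case True
    have K: "0 \<le> K" "d \<le> 4 / 5" using assms(1) by (auto simp: growth_const_def)
    have "0 \<le> K * w * (U + t)" using assms K by (intro mult_nonneg_nonneg) auto
    moreover have "U ^ 4 * (1 - U) \<le> d ^ 4 * (1 - d)"
      using fourth_power_rest_mono[of U d] True assms K by linarith
    ultimately show ?thesis by linarith
  next
    case False
    have "U ^ 4 * (1 - U) \<le> d ^ 4 * (1 - d) + K * U * (U - d)"
      using assms False by (auto simp: growth_const_def intro: less_imp_le)
    also have "K * U * (U - d) \<le> K * (U + t) * w"
      using assms False by (intro mult_mono mult_left_mono) (auto simp: growth_const_def)
    finally show ?thesis by (simp add: mult_ac)
  qed
  finally show ?thesis by (simp add: mult_ac)
qed

context graph begin

definition total :: real where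
  "total = av (\<lambda>x. av (\<lambda>y. of_bool (adj x y) * edge_density x y))"

definition inside :: "'a set \<Rightarrow> real" where
  "inside Q = av (\<lambda>x. av (\<lambda>y. of_bool (adj x y \<and> x \<in> Q \<and> y \<in> Q) * edge_density x y))"

lemma total_eq: "total = 2 * emb_density adj"
proof -
  have "total = av (\<lambda>x. av (\<lambda>y. extension_density adj x y + extension_density adj y x))"
    unfolding total_def edge_density_def
    by (intro av_cong) (auto simp: extension_density_nonadj adj_commute)
  also have "\<dots> = emb_density adj + av (\<lambda>x. av (\<lambda>y. extension_density adj y x))"
    by (simp add: av_add emb_density_def)
  also have "av (\<lambda>x. av (\<lambda>y. extension_density adj y x)) = emb_density adj"
    unfolding emb_density_def by (subst av_swap) simp
  finally show ?thesis by simp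
qed

text \<open>The use of \<open>Psi\<close>: a bound that holds for all edges bounds the copies counted by the edges inside any
  set, in proportion to the size of the set.\<close>

lemma inside_le:
  assumes "\<And>u v. u \<in> W \<Longrightarrow> v \<in> W \<Longrightarrow> adj u v \<Longrightarrow> Psi u v \<le> k" and "0 \<le> k"
  shows "inside Q \<le> k / 8 * mu Q"
proof -
  have "inside Q \<le> av (\<lambda>x. av (\<lambda>y. (k / 4) * (of_bool (adj x y \<and> x \<in> Q \<and> y \<in> Q) / (dg x + dg y))))"
    unfolding inside_def
  proof (intro av_mono)
    fix x y assume xy: "x \<in> W" "y \<in> W"
    show "of_bool (adj x y \<and> x \<in> Q \<and> y \<in> Q) * edge_density x y
      \<le> (k / 4) * (of_bool (adj x y \<and> x \<in> Q \<and> y \<in> Q) / (dg x + dg y))"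
    proof (cases "adj x y")
      case True
      have "dg x + dg y > 0" using dg_pos[of y x] True xy by (simp add: add_pos_nonneg)
      then show ?thesis using assms(1)[OF xy True] True
        by (auto simp: Psi_def field_simps)
    qed simp
  qed
  also have "\<dots> = (k / 4) * av (\<lambda>x. av (\<lambda>y. of_bool (adj x y \<and> x \<in> Q \<and> y \<in> Q) / (dg x + dg y)))"
    by (simp only: av_cmult)
  also have "\<dots> \<le> (k / 4) * (mu Q / 2)"
    using sum_inverse_degrees assms(2) by (intro mult_left_mono) auto
  finally show ?thesis by simp
qed

lemma total_inside_UNIV: "total = inside UNIV"
  by (simp add: total_def inside_def)

text \<open>An edge that leaves \<open>D x y\<close> ends in the neighbourhood of \<open>x y\<close>, which is measured by \<open>R\<close>, or in
  an exceptional vertex. For these edges the crude bound \<open>27 / 1024\<close> for the density of copies suffices.\<close>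

lemma total_le_split:
  "total \<le> inside (- D x y) + 27 / 512 * (R x y + mu (far x y - D x y) * mu (D x y)) + inside (D x y)"
proof -
  let ?D = "D x y" and ?B = "far x y - D x y" and ?f = "\<lambda>u v. of_bool (adj u v) * edge_density u v"
  let ?X = "av (\<lambda>u. av (\<lambda>v. of_bool (u \<in> ?D \<and> v \<notin> ?D \<and> adj u v) * edge_density u v))"
  have sw: "av (\<lambda>u. av (\<lambda>v. of_bool (u \<notin> ?D \<and> v \<in> ?D \<and> adj u v) * edge_density u v)) = ?X"
    by (subst av_swap) (intro av_cong, simp add: edge_density_commute adj_commute conj_ac cong: conj_cong)
  have X: "?X \<le> 27 / 1024 * (R x y + mu ?B * mu ?D)"
  proof -
    have "?X \<le> av (\<lambda>u. of_bool (u \<in> ?D) * (27 / 1024 * (r x y u + mu ?B)))"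
    proof (rule av_mono)
      fix u
      have "av (\<lambda>v. of_bool (u \<in> ?D \<and> v \<notin> ?D \<and> adj u v) * edge_density u v)
        \<le> av (\<lambda>v. of_bool (u \<in> ?D) * (27 / 1024 * (of_bool (v \<in> nb u \<inter> (nb x \<union> nb y)) + of_bool (v \<in> ?B))))"
        using edge_density_le_const edge_density_nonneg
        by (intro av_mono) (auto simp: nb_def far_def)
      also have "\<dots> = of_bool (u \<in> ?D) * (27 / 1024 * (r x y u + mu ?B))"
        by (simp add: r_def mu_def av_add del: Diff_iff Int_iff)
      finally show "av (\<lambda>v. of_bool (u \<in> ?D \<and> v \<notin> ?D \<and> adj u v) * edge_density u v) \<le> \<dots>" .
    qed
    also have "av (\<lambda>u. of_bool (u \<in> ?D) * (27 / 1024 * (r x y u + mu ?B))) =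
        27 / 1024 * (R x y + mu ?B * mu ?D)"
    proof -
      have "av (\<lambda>u. of_bool (u \<in> ?D) * (27 / 1024 * (r x y u + mu ?B))) =
        av (\<lambda>u. 27 / 1024 * (of_bool (u \<in> ?D) * r x y u + of_bool (u \<in> ?D) * mu ?B))"
        by (rule av_cong) auto
      also have "\<dots> = 27 / 1024 * (av (\<lambda>u. of_bool (u \<in> ?D) * r x y u) + av (\<lambda>u. of_bool (u \<in> ?D)) * mu ?B)"
        by (subst av_cmult, subst av_add, subst av_multc) (rule refl)
      finally show ?thesis unfolding R_def mu_def by (simp only: mult.commute)
    qed
    finally show ?thesis .
  qed
  have "total = av (\<lambda>u. av (\<lambda>v. of_bool (adj u v \<and> u \<in> - ?D \<and> v \<in> - ?D) * edge_density u v
      + (of_bool (u \<in> ?D \<and> v \<notin> ?D \<and> adj u v) * edge_density u v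
        + of_bool (u \<notin> ?D \<and> v \<in> ?D \<and> adj u v) * edge_density u v)
      + of_bool (adj u v \<and> u \<in> ?D \<and> v \<in> ?D) * edge_density u v))"
    unfolding total_def by (intro av_cong) auto
  also have "\<dots> = inside (- ?D) + 2 * ?X + inside ?D"
    by (simp add: av_add inside_def sw)
  finally show ?thesis using X by (simp add: algebra_simps)
qed

text \<open>An edge inside \<open>D x y\<close> sees only \<open>D x y\<close>, the exceptional vertices and what leaks into the neighbourhood
  of \<open>x y\<close>.\<close>

lemma union_of_D_edge:
  assumes "u \<in> D x y" "v \<in> D x y"
  shows "mu (nb u \<union> nb v) \<le> mu (D x y) + (mu (far x y - D x y) + r x y u + r x y v)"
proof -
  have "mu (nb u \<union> nb v) \<le> mu (D x y \<union> ((far x y - D x y) \<union>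
      ((nb u \<inter> (nb x \<union> nb y)) \<union> (nb v \<inter> (nb x \<union> nb y)))))"
    by (rule mu_mono) (auto simp: far_def)
  also have "\<dots> \<le> mu (D x y) + (mu (far x y - D x y) + (r x y u + r x y v))"
    unfolding r_def by (intro order.trans[OF mu_Un_le] add_left_mono) simp
  finally show ?thesis by simp
qed

text \<open>A version of \<open>inside_le\<close> in which the bound for \<open>Psi u v\<close> may exceed \<open>g\<close> by an error proportional to
  \<open>dg u + dg v\<close>. The degree sum cancels, so the error contributes without any loss.\<close>

lemma inside_D_le:
  assumes K: "0 \<le> K" and g: "0 \<le> g"
    and le: "\<And>u v. u \<in> D x y \<Longrightarrow> v \<in> D x y \<Longrightarrow> u \<in> W \<Longrightarrow> v \<in> W \<Longrightarrow> adj u v \<Longrightarrow>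
      4 * edge_density u v * (dg u + dg v)
        \<le> g + K * (mu (far x y - D x y) + r x y u + r x y v) * (dg u + dg v)"
  shows "8 * inside (D x y) \<le> g * mu (D x y)
      + 2 * K * (mu (far x y - D x y) * (mu (D x y))\<^sup>2 + 2 * mu (D x y) * R x y)"
proof -
  let ?D = "D x y" and ?b = "mu (far x y - D x y)" and ?r = "r x y"
  let ?a = "\<lambda>u v. of_bool (adj u v \<and> u \<in> ?D \<and> v \<in> ?D) :: real"
  let ?d = "\<lambda>u. of_bool (u \<in> ?D) :: real"
  have "4 * inside ?D = av (\<lambda>u. av (\<lambda>v. 4 * (?a u v * edge_density u v)))"
    by (simp only: inside_def av_cmult)
  also have "\<dots> \<le> av (\<lambda>u. av (\<lambda>v. g * (?a u v / (dg u + dg v))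
      + K * (?b * (?d u * ?d v) + ?d u * ?r u * ?d v + ?d u * (?d v * ?r v))))"
  proof (intro av_mono)
    fix u v assume uv: "u \<in> W" "v \<in> W"
    show "4 * (?a u v * edge_density u v) \<le> g * (?a u v / (dg u + dg v))
      + K * (?b * (?d u * ?d v) + ?d u * ?r u * ?d v + ?d u * (?d v * ?r v))"
    proof (cases "adj u v \<and> u \<in> ?D \<and> v \<in> ?D")
      case True
      then have p: "dg u + dg v > 0" using dg_pos[of v u] uv by (simp add: add_pos_nonneg)
      have "4 * edge_density u v \<le> (g + K * (?b + ?r u + ?r v) * (dg u + dg v)) / (dg u + dg v)"
        using le[of u v] True uv p by (simp add: pos_le_divide_eq)
      also have "\<dots> = g / (dg u + dg v) + K * (?b + ?r u + ?r v)"
        using p by (simp add: add_divide_distrib)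
      finally show ?thesis using True by simp
    next
      case False
      then show ?thesis using K by auto
    qed
  qed
  also have "\<dots> = g * av (\<lambda>u. av (\<lambda>v. ?a u v / (dg u + dg v)))
      + K * (?b * (mu ?D * mu ?D) + R x y * mu ?D + mu ?D * R x y)"
    by (simp only: av_add av_cmult av_multc mu_def R_def)
  also have "\<dots> \<le> g * (mu ?D / 2) + K * (?b * (mu ?D * mu ?D) + R x y * mu ?D + mu ?D * R x y)"
    using sum_inverse_degrees[of ?D] g by (intro add_right_mono mult_left_mono) auto
  finally show ?thesis by (simp add: algebra_simps power2_eq_square)
qed

lemma inside_D_growth:
  assumes "growth_const (mu (D x y)) K"
  shows "8 * inside (D x y) \<le> mu (D x y) ^ 5 * (1 - mu (D x y))
      + 2 * K * (mu (far x y - D x y) * (mu (D x y))\<^sup>2 + 2 * mu (D x y) * R x y)"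
proof -
  let ?d = "mu (D x y)"
  have "8 * inside (D x y) \<le> (?d ^ 4 * (1 - ?d)) * ?d
      + 2 * K * (mu (far x y - D x y) * ?d\<^sup>2 + 2 * ?d * R x y)"
  proof (rule inside_D_le)
    fix u v assume uv: "u \<in> D x y" "v \<in> D x y"
    let ?U = "mu (nb u \<union> nb v)" and ?t = "mu (nb u \<inter> nb v)"
    have "4 * edge_density u v * (dg u + dg v) \<le> (?U - ?t) ^ 3 * (1 - ?U) * (?U + ?t)"
      using edge_density_le_UT[of u v] unfolding dg_sum by (intro mult_right_mono) auto
    also have "\<dots> \<le> ?d ^ 4 * (1 - ?d) + K * (mu (far x y - D x y) + r x y u + r x y v) * (?U + ?t)"
      using union_of_D_edge[OF uv] by (intro growth_bound assms mu_mono) auto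
    finally show "4 * edge_density u v * (dg u + dg v) \<le> ?d ^ 4 * (1 - ?d)
        + K * (mu (far x y - D x y) + r x y u + r x y v) * (dg u + dg v)"
      unfolding dg_sum .
  qed (use assms in \<open>auto simp: growth_const_def\<close>)
  then show ?thesis by (simp add: power4_eq_xxxx power_def numeral_eq_Suc mult_ac)
qed

lemma obtain_max_edge:
  assumes "u \<in> W" "v \<in> W" "adj u v"
  obtains x y where "x \<in> W" "y \<in> W" "adj x y"
    "\<And>u v. u \<in> W \<Longrightarrow> v \<in> W \<Longrightarrow> adj u v \<Longrightarrow> Psi u v \<le> Psi x y"
proof -
  let ?E = "{e \<in> W \<times> W. adj (fst e) (snd e)}"
  have "finite ?E" "?E \<noteq> {}" using assms fin by auto
  then have "Max ((\<lambda>e. Psi (fst e) (snd e)) ` ?E) \<in> (\<lambda>e. Psi (fst e) (snd e)) ` ?E"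
    by (intro Max_in) auto
  then obtain e where e: "e \<in> ?E" "Max ((\<lambda>e. Psi (fst e) (snd e)) ` ?E) = Psi (fst e) (snd e)"
    by blast
  have "Psi u v \<le> Psi (fst e) (snd e)" if "u \<in> W" "v \<in> W" "adj u v" for u v
    unfolding e(2)[symmetric] using that \<open>finite ?E\<close>
    by (intro Max_ge finite_imageI) (auto intro!: image_eqI[of _ _ "(u, v)"])
  with e(1) show ?thesis by (intro that[of "fst e" "snd e"]) auto
qed

lemma Psi_nonneg [simp]: "0 \<le> Psi x y"
  by (simp add: Psi_def)

lemma mu_far_D: "mu (nb x \<union> nb y) + mu (far x y - D x y) + mu (D x y) = 1"
proof -
  have "mu (far x y) = 1 - mu (nb x \<union> nb y)" unfolding far_def by (rule mu_compl)
  moreover have "mu (far x y) = mu (D x y) + mu (far x y - D x y)"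
  proof -
    have "far x y \<inter> D x y = D x y" by (auto simp: D_def)
    then show ?thesis using mu_split[of "far x y" "D x y"] by simp
  qed
  ultimately show ?thesis by simp
qed

end

section \<open>The extremal constants\<close>

text \<open>\<open>Lam q\<close> is a cubic in \<open>q (1 - q)\<close> whose derivative vanishes at \<open>beta0\<close>.\<close>

definition beta0 :: real where "beta0 = (4 - sqrt 10) / 6"
definition alpha :: real where "alpha = (1 - sqrt (1 - 4 * beta0)) / 2"
definition Lam :: "real \<Rightarrow> real" where "Lam q = q ^ 5 * (1 - q) + q * (1 - q) ^ 5"

lemma beta0_root: "6 * beta0\<^sup>2 - 8 * beta0 + 1 = 0"
  by (simp add: beta0_def field_simps power2_eq_square)

lemma beta0_bounds: "1396 / 10000 < beta0" "beta0 < 13963 / 100000"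
proof -
  have "316222 / 100000 < sqrt (10::real)" by (rule real_less_rsqrt) (simp add: power2_eq_square)
  moreover have "sqrt (10::real) < 31624 / 10000" by (rule real_less_lsqrt) (simp_all add: power2_eq_square)
  ultimately show "1396 / 10000 < beta0" "beta0 < 13963 / 100000" by (simp_all add: beta0_def)
qed

lemma alpha_mult: "alpha * (1 - alpha) = beta0"
  using beta0_bounds by (simp add: alpha_def field_simps)

lemma alpha_bounds: "1677 / 10000 < alpha" "alpha < 1678 / 10000"
proof -
  have half: "alpha \<le> 1 / 2" using beta0_bounds by (simp add: alpha_def)
  show "1677 / 10000 < alpha"
  proof (rule ccontr)
    assume "\<not> 1677 / 10000 < alpha"
    then have "(1677 / 10000 - alpha) * (1 - 1677 / 10000 - alpha) \<ge> 0" by (intro mult_nonneg_nonneg) auto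
    then show False using alpha_mult beta0_bounds by (simp add: field_simps)
  qed
  show "alpha < 1678 / 10000"
  proof (rule ccontr)
    assume "\<not> alpha < 1678 / 10000"
    then have "(alpha - 1678 / 10000) * (1 - 1678 / 10000 - alpha) \<ge> 0" using half by (intro mult_nonneg_nonneg) auto
    then show False using alpha_mult beta0_bounds by (simp add: field_simps)
  qed
qed

lemma Lam_eq: "Lam q = (q * (1 - q)) - 4 * (q * (1 - q))\<^sup>2 + 2 * (q * (1 - q)) ^ 3"
  by (simp add: Lam_def power2_eq_square power3_eq_cube power_def numeral_eq_Suc algebra_simps)

text \<open>As \<open>beta0\<close> is a critical point of the cubic, the difference has \<open>beta0\<close> as a double root.\<close>

lemma Lam_diff:
  "Lam alpha - Lam q = (q * (1 - q) - beta0)\<^sup>2 * (4 - 2 * (q * (1 - q)) - 4 * beta0)"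
proof -
  have *: "(beta0 - 4 * beta0\<^sup>2 + 2 * beta0 ^ 3) - (b - 4 * b\<^sup>2 + 2 * b ^ 3)
      = (b - beta0)\<^sup>2 * (4 - 2 * b - 4 * beta0) + (beta0 - b) * (6 * beta0\<^sup>2 - 8 * beta0 + 1)" for b
    by (simp add: power2_eq_square power3_eq_cube algebra_simps)
  show ?thesis unfolding Lam_eq alpha_mult * beta0_root by simp
qed

lemma mult_compl_le: "q * (1 - q) \<le> (1 / 4 :: real)"
proof -
  have "1 / 4 - q * (1 - q) = (q - 1 / 2)\<^sup>2" by (simp add: power2_eq_square algebra_simps)
  then show ?thesis using zero_le_power2[of "q - 1 / 2"] by linarith
qed

lemma Lam_le: "Lam q \<le> Lam alpha"
  and Lam_eq_iff: "Lam q = Lam alpha \<longleftrightarrow> q = alpha \<or> q = 1 - alpha"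
proof -
  have pos: "4 - 2 * (q * (1 - q)) - 4 * beta0 > 0" using mult_compl_le[of q] beta0_bounds(2) by linarith
  then have "0 \<le> (q * (1 - q) - beta0)\<^sup>2 * (4 - 2 * (q * (1 - q)) - 4 * beta0)" by simp
  then show "Lam q \<le> Lam alpha" using Lam_diff[of q] by linarith
  have "Lam q = Lam alpha \<longleftrightarrow> q * (1 - q) = beta0" using Lam_diff[of q] pos by auto
  also have "\<dots> \<longleftrightarrow> (q - alpha) * (q - (1 - alpha)) = 0"
    using alpha_mult by (auto simp: algebra_simps)
  finally show "Lam q = Lam alpha \<longleftrightarrow> q = alpha \<or> q = 1 - alpha" by auto
qed

lemma Lam_alpha_lower: "67 / 1000 < Lam alpha"
proof -
  have "Lam (5/6) \<le> Lam alpha" by (rule Lam_le)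
  moreover have "67 / 1000 < Lam (5/6)" by (simp add: Lam_def power_def numeral_eq_Suc)
  ultimately show ?thesis by simp
qed

text \<open>A polynomial with positive Bernstein coefficients is positive; this certifies the quartic inequalities below.\<close>

lemma bernstein4_pos:
  fixes t :: real
  assumes "0 \<le> t" "t \<le> 1" "0 < b0" "0 < b1" "0 < b2" "0 < b3" "0 < b4"
  shows "0 < b0 * (1 - t) ^ 4 + 4 * b1 * t * (1 - t) ^ 3 + 6 * b2 * t\<^sup>2 * (1 - t)\<^sup>2
    + 4 * b3 * t ^ 3 * (1 - t) + b4 * t ^ 4"
proof -
  have "0 < b0 * (1 - t) ^ 4 + b4 * t ^ 4"
    using assms by (cases "t = 0") (auto intro!: add_nonneg_pos mult_pos_pos)
  moreover have "0 \<le> 4 * b1 * t * (1 - t) ^ 3 + 6 * b2 * t\<^sup>2 * (1 - t)\<^sup>2 + 4 * b3 * t ^ 3 * (1 - t)"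
    using assms by (intro add_nonneg_nonneg mult_nonneg_nonneg) auto
  ultimately show ?thesis by linarith
qed

text \<open>Dividing the defining inequality by \<open>U - d\<close> and dropping \<open>d\<^sup>4\<close> leaves a condition that is monotone in \<open>d\<close>,
  so that \<open>d\<close> may be replaced by \<open>min U a\<close>.\<close>

lemma growth_constI:
  fixes a d :: real
  assumes "0 \<le> d" "d \<le> a" "a \<le> 1 / 2"
    and far: "\<And>U. a \<le> U \<Longrightarrow> U \<le> 1 \<Longrightarrow> (1 - U) * ((U + a) * (U\<^sup>2 + a\<^sup>2)) < a * U"
  shows "growth_const d a"
  unfolding growth_const_def
proof (intro conjI allI impI)
  fix U assume U: "d < U" "U \<le> 1"
  define m where "m = min U a"
  have m: "d \<le> m" "m \<le> U" "0 \<le> m" using U assms by (auto simp: m_def)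
  have "(1 - U) * ((U + m) * (U\<^sup>2 + m\<^sup>2)) < a * U"
  proof (cases "a \<le> U")
    case True
    then show ?thesis using far U by (simp add: m_def)
  next
    case False
    then have "m = U" by (simp add: m_def)
    have "U * (1 - U) < 1 / 4"
    proof -
      have "1 / 4 - U * (1 - U) = (U - 1 / 2)\<^sup>2" by (simp add: power2_eq_square algebra_simps)
      moreover have "0 < (U - 1 / 2)\<^sup>2" using False assms by simp
      ultimately show ?thesis by linarith
    qed
    then have "4 * U\<^sup>2 * (U * (1 - U)) < 4 * U\<^sup>2 * (1 / 4)"
      using U assms by (intro mult_strict_left_mono) auto
    also have "\<dots> \<le> a * U" using False U assms by (simp add: power2_eq_square mult_right_mono)
    finally show ?thesis by (simp add: \<open>m = U\<close> power2_eq_square algebra_simps)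
  qed
  moreover have "(U + d) * (U\<^sup>2 + d\<^sup>2) \<le> (U + m) * (U\<^sup>2 + m\<^sup>2)"
    using m assms U by (intro mult_mono add_mono power_mono) auto
  then have "(1 - U) * ((U + d) * (U\<^sup>2 + d\<^sup>2)) \<le> (1 - U) * ((U + m) * (U\<^sup>2 + m\<^sup>2))"
    using U by (intro mult_left_mono) auto
  moreover have "0 \<le> d ^ 4" by simp
  ultimately have "(1 - U) * ((U + d) * (U\<^sup>2 + d\<^sup>2)) - d ^ 4 < a * U" by linarith
  then have "(U - d) * ((1 - U) * ((U + d) * (U\<^sup>2 + d\<^sup>2)) - d ^ 4) < (U - d) * (a * U)"
    using U by (intro mult_strict_left_mono) auto
  then show "U ^ 4 * (1 - U) < d ^ 4 * (1 - d) + a * U * (U - d)"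
    by (simp add: power2_eq_square power4_eq_xxxx algebra_simps)
qed (use assms in auto)

lemma growth_const_quarter:
  assumes "0 \<le> d" "d \<le> 1 / 4"
  shows "growth_const d (1 / 4)"
proof (rule growth_constI)
  fix U :: real assume U: "1 / 4 \<le> U" "U \<le> 1"
  \<comment> \<open>The difference has positive Bernstein coefficients on both halves of the range.\<close>
  have "0 < 1 / 4 * U - (1 - U) * ((U + 1 / 4) * (U\<^sup>2 + (1 / 4)\<^sup>2))" (is "0 < ?f")
  proof (cases "U \<le> 1 / 2")
    case True
    have "?f = (1 / 64) * (1 - ((U - 1 / 4) * 4)) ^ 4 + 4 * (9 / 512) * ((U - 1 / 4) * 4) * (1 - ((U - 1 / 4) * 4)) ^ 3 + 6 * (1 / 64) * ((U - 1 / 4) * 4)\<^sup>2 * (1 - ((U - 1 / 4) * 4))\<^sup>2 + 4 * (11 / 1024) * ((U - 1 / 4) * 4) ^ 3 * (1 - ((U - 1 / 4) * 4)) + (1 / 128) * ((U - 1 / 4) * 4) ^ 4"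
      by (simp add: power2_eq_square power3_eq_cube power4_eq_xxxx field_simps)
    then show ?thesis
      using bernstein4_pos[of "(U - 1 / 4) * 4" "1 / 64" "9 / 512" "1 / 64" "11 / 1024" "1 / 128"] U True by simp
  next
    case False
    have "?f = (1 / 128) * (1 - (2 * U - 1)) ^ 4 + 4 * (1 / 512) * (2 * U - 1) * (1 - (2 * U - 1)) ^ 3 + 6 * (1 / 256) * (2 * U - 1)\<^sup>2 * (1 - (2 * U - 1))\<^sup>2 + 4 * (27 / 512) * (2 * U - 1) ^ 3 * (1 - (2 * U - 1)) + (1 / 4) * (2 * U - 1) ^ 4"
      by (simp add: power2_eq_square power3_eq_cube power4_eq_xxxx field_simps)
    then show ?thesis
      using bernstein4_pos[of "2 * U - 1" "1 / 128" "1 / 512" "1 / 256" "27 / 512" "1 / 4"] U False by simp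
  qed
  then show "(1 - U) * ((U + 1 / 4) * (U\<^sup>2 + (1 / 4)\<^sup>2)) < 1 / 4 * U" by simp
qed (use assms in auto)

lemma growth_const_third:
  assumes "0 \<le> d" "d \<le> 1 / 3"
  shows "growth_const d (1 / 3)"
proof (rule growth_constI)
  fix U :: real assume U: "1 / 3 \<le> U" "U \<le> 1"
  \<comment> \<open>The difference has positive Bernstein coefficients on both halves of the range.\<close>
  have "0 < 1 / 3 * U - (1 - U) * ((U + 1 / 3) * (U\<^sup>2 + (1 / 3)\<^sup>2))" (is "0 < ?f")
  proof (cases "U \<le> 1 / 2")
    case True
    have "?f = (1 / 81) * (1 - ((U - 1 / 3) * 6)) ^ 4 + 4 * (1 / 72) * ((U - 1 / 3) * 6) * (1 - ((U - 1 / 3) * 6)) ^ 3 + 6 * (7 / 486) * ((U - 1 / 3) * 6)\<^sup>2 * (1 - ((U - 1 / 3) * 6))\<^sup>2 + 4 * (19 / 1296) * ((U - 1 / 3) * 6) ^ 3 * (1 - ((U - 1 / 3) * 6)) + (7 / 432) * ((U - 1 / 3) * 6) ^ 4"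
      by (simp add: power2_eq_square power3_eq_cube power4_eq_xxxx field_simps)
    then show ?thesis
      using bernstein4_pos[of "(U - 1 / 3) * 6" "1 / 81" "1 / 72" "7 / 486" "19 / 1296" "7 / 432"] U True by simp
  next
    case False
    have "?f = (7 / 432) * (1 - (2 * U - 1)) ^ 4 + 4 * (1 / 48) * (2 * U - 1) * (1 - (2 * U - 1)) ^ 3 + 6 * (1 / 27) * (2 * U - 1)\<^sup>2 * (1 - (2 * U - 1))\<^sup>2 + 4 * (23 / 216) * (2 * U - 1) ^ 3 * (1 - (2 * U - 1)) + (1 / 3) * (2 * U - 1) ^ 4"
      by (simp add: power2_eq_square power3_eq_cube power4_eq_xxxx field_simps)
    then show ?thesis
      using bernstein4_pos[of "2 * U - 1" "7 / 432" "1 / 48" "1 / 27" "23 / 216" "1 / 3"] U False by simp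
  qed
  then show "(1 - U) * ((U + 1 / 3) * (U\<^sup>2 + (1 / 3)\<^sup>2)) < 1 / 3 * U" by simp
qed (use assms in auto)

section \<open>The inequality between the parameters of a maximal edge\<close>

lemma fourth_power_rest_antimono:
  fixes U d :: real
  assumes "4 / 5 \<le> d" "d \<le> U"
  shows "U ^ 4 * (1 - U) \<le> d ^ 4 * (1 - d)"
proof (rule DERIV_nonpos_imp_nonincreasing[OF assms(2), of "\<lambda>U. U ^ 4 * (1 - U)"])
  fix x assume x: "d \<le> x" "x \<le> U"
  have "((\<lambda>U. U ^ 4 * (1 - U)) has_real_derivative x ^ 3 * (4 - 5 * x)) (at x)"
    by (auto intro!: derivative_eq_intros simp: power3_eq_cube power4_eq_xxxx algebra_simps)
  moreover have "x ^ 3 * (4 - 5 * x) \<le> 0" using x assms by (intro mult_nonneg_nonpos) auto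
  ultimately show "\<exists>y. ((\<lambda>U. U ^ 4 * (1 - U)) has_real_derivative y) (at x) \<and> y \<le> 0" by blast
qed

lemma fourth_power_rest_le:
  fixes U :: real
  assumes "0 \<le> U"
  shows "U ^ 4 * (1 - U) \<le> 256 / 3125"
proof (cases "U \<le> 4 / 5")
  case True
  then show ?thesis using fourth_power_rest_mono[of U "4/5"] assms by (simp add: power_def numeral_eq_Suc)
next
  case False
  then show ?thesis using fourth_power_rest_antimono[of "4/5" U] by (simp add: power_def numeral_eq_Suc)
qed

lemma small_part_antimono:
  fixes d e :: real
  assumes "0 \<le> e" "e \<le> d" "d \<le> 1 / 3"
  shows "67 / 1000 * (1 - d) + d ^ 5 * (1 - d) \<le> 67 / 1000 * (1 - e) + e ^ 5 * (1 - e)"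
proof (rule DERIV_nonpos_imp_nonincreasing[OF assms(2), of "\<lambda>d. 67 / 1000 * (1 - d) + d ^ 5 * (1 - d)"])
  fix x assume x: "e \<le> x" "x \<le> d"
  have "((\<lambda>d. 67 / 1000 * (1 - d) + d ^ 5 * (1 - d)) has_real_derivative - (67 / 1000) + x ^ 4 * (5 - 6 * x)) (at x)"
    by (auto intro!: derivative_eq_intros simp: power4_eq_xxxx power_def numeral_eq_Suc algebra_simps)
  moreover have "x ^ 4 * (5 - 6 * x) \<le> (1 / 3) ^ 4 * 5"
    using x assms by (intro mult_mono power_mono) auto
  then have "- (67 / 1000) + x ^ 4 * (5 - 6 * x) \<le> 0" by (simp add: power4_eq_xxxx)
  ultimately show "\<exists>y. ((\<lambda>d. 67 / 1000 * (1 - d) + d ^ 5 * (1 - d)) has_real_derivative y) (at x) \<and> y \<le> 0" by blast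
qed

text \<open>If \<open>D x y\<close> has measure between \<open>21 / 100\<close> and \<open>1 / 3\<close>, then the neighbourhood of the maximal edge is too small
  for the extremal value, and \<open>67 / 1000 < Lam alpha\<close> cannot be reached. Here \<open>psi\<close> stands for \<open>Psi x y\<close> and \<open>y\<close> for
  \<open>8 * total\<close>. The exceptional vertices (\<open>b\<close>) and crossing edges (\<open>R\<close>) help in the bound for \<open>y\<close>, but they
  reduce \<open>psi\<close> by more if \<open>k\<close> times the reduction outweighs the help.\<close>

lemma small_big_part_step:
  fixes p b d R psi y K k l E e :: real
  assumes nn: "0 \<le> p" "0 \<le> b" "0 \<le> d" "0 \<le> R" "0 \<le> K"
    and psi: "67 / 1000 \<le> psi"
      "psi + 13 / 8 * p ^ 3 * R + 13 / 16 * p ^ 4 * b \<le> 67 / 1000 + E"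
    and y: "y \<le> (1 - d) * psi + 27 / 64 * (R + b * d) + (d ^ 5 * (1 - d) + 2 * K * (b * d\<^sup>2 + 2 * d * R))"
    and d: "e \<le> d" "0 \<le> e" "d \<le> 1 / 3" and p: "l \<le> p" "0 \<le> l"
    and k: "1 - e \<le> k" "27 / 64 + 4 * K * d \<le> k * (13 / 8 * l ^ 3)"
      "27 / 64 * d + 2 * K * d\<^sup>2 \<le> k * (13 / 16 * l ^ 4)"
    and num: "67 / 1000 * (1 - e) + e ^ 5 * (1 - e) + k * E < 67 / 1000"
  shows "y < 67 / 1000"
proof -
  have k0: "0 \<le> k" using k d by linarith
  have "(1 - d) * psi = 67 / 1000 * (1 - d) + (1 - d) * (psi - 67 / 1000)" by (simp add: algebra_simps)
  moreover have "(1 - d) * (psi - 67 / 1000) \<le> k * (psi - 67 / 1000)"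
    using k psi d by (intro mult_right_mono) auto
  moreover have "(27 / 64 + 4 * K * d) * R \<le> (k * (13 / 8 * p ^ 3)) * R"
  proof -
    have "k * (13 / 8 * l ^ 3) \<le> k * (13 / 8 * p ^ 3)"
      using p k0 by (intro mult_left_mono power_mono) auto
    with k(2) nn show ?thesis by (intro mult_right_mono) auto
  qed
  moreover have "(27 / 64 * d + 2 * K * d\<^sup>2) * b \<le> (k * (13 / 16 * p ^ 4)) * b"
  proof -
    have "k * (13 / 16 * l ^ 4) \<le> k * (13 / 16 * p ^ 4)"
      using p k0 by (intro mult_left_mono power_mono) auto
    with k(3) nn show ?thesis by (intro mult_right_mono) auto
  qed
  ultimately have "y \<le> 67 / 1000 * (1 - d) + d ^ 5 * (1 - d)
      + k * (psi - 67 / 1000 + 13 / 8 * p ^ 3 * R + 13 / 16 * p ^ 4 * b)"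
    using y by (simp add: field_simps)
  also have "k * (psi - 67 / 1000 + 13 / 8 * p ^ 3 * R + 13 / 16 * p ^ 4 * b) \<le> k * E"
    using psi k0 by (intro mult_left_mono) auto
  finally show ?thesis using num small_part_antimono[of e d] d by linarith
qed

text \<open>The range of \<open>p\<close> is split such that on each piece the value \<open>u\<^sup>4 (1 - u)\<close> at its right end \<open>u\<close> and the lower
  bounds for \<open>p\<close> and \<open>d\<close> suffice; \<open>k\<close> is slightly larger than what the two cost conditions demand.\<close>

lemma big_part_not_small:
  fixes p b d R psi y yD :: real
  assumes nn: "0 \<le> p" "0 \<le> b" "0 \<le> d" "0 \<le> R" and sum: "p + b + d = 1"
    and psi: "67 / 1000 \<le> psi" "psi \<le> p ^ 4 * (d + 3 / 16 * b) - 13 / 8 * p ^ 3 * R"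
    and y: "y \<le> (1 - d) * psi + 27 / 64 * (R + b * d) + yD"
    and yD: "\<And>K. growth_const d K \<Longrightarrow> yD \<le> d ^ 5 * (1 - d) + 2 * K * (b * d\<^sup>2 + 2 * d * R)"
    and d: "21 / 100 \<le> d"
  shows "y < 67 / 1000"
proof -
  have d_eq: "d = 1 - p - b" using sum by simp
  have e: "psi + 13 / 8 * p ^ 3 * R + 13 / 16 * p ^ 4 * b \<le> p ^ 4 * (1 - p)"
    using psi(2) unfolding d_eq by (simp add: algebra_simps)
  have nn2: "0 \<le> 13 / 8 * p ^ 3 * R" "0 \<le> 13 / 16 * p ^ 4 * b" using nn by auto
  have low: "67 / 1000 \<le> p ^ 4 * (1 - p)" using e nn2 psi(1) by linarith
  have p79: "p \<le> 79 / 100" using sum d nn by linarith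
  have p23: "2 / 3 < p"
  proof (rule ccontr)
    assume "\<not> 2 / 3 < p"
    then have "p ^ 4 * (1 - p) \<le> (2/3) ^ 4 * (1 - 2 / 3)" using nn by (intro fourth_power_rest_mono) auto
    with low show False by (simp add: power4_eq_xxxx)
  qed
  have d3: "d \<le> 1 / 3" using p23 sum nn by linarith
  have up: "psi + 13 / 8 * p ^ 3 * R + 13 / 16 * p ^ 4 * b \<le> 67 / 1000 + (u ^ 4 * (1 - u) - 67 / 1000)"
    if "p \<le> u" "u \<le> 4 / 5" for u
    using fourth_power_rest_mono[of p u] that nn e by linarith
  have third: "y \<le> (1 - d) * psi + 27 / 64 * (R + b * d) + (d ^ 5 * (1 - d) + 2 * (1 / 3) * (b * d\<^sup>2 + 2 * d * R))"
    using y yD[OF growth_const_third[OF nn(3) d3]] by linarith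
  have quarter: "y \<le> (1 - d) * psi + 27 / 64 * (R + b * d) + (d ^ 5 * (1 - d) + 2 * (1 / 4) * (b * d\<^sup>2 + 2 * d * R))"
    if "d \<le> 1 / 4"
    using y yD[OF growth_const_quarter[OF nn(3) that]] by linarith
  have dd: "d\<^sup>2 \<le> c * d" if "d \<le> c" for c
    using that nn by (simp add: power2_eq_square mult_right_mono)
  have dp: "d \<le> 1 - p" using sum nn by linarith
  consider "p \<le> 7 / 10" | "7 / 10 \<le> p" "p \<le> 29 / 40" | "29 / 40 \<le> p" "p \<le> 3 / 4" "1 / 4 \<le> d"
    | "29 / 40 \<le> p" "p \<le> 3 / 4" "d \<le> 1 / 4" | "3 / 4 \<le> p" "p \<le> 77 / 100" | "77 / 100 \<le> p"
    by linarith
  then show ?thesis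
  proof cases
    case 1
    show ?thesis
      by (rule small_big_part_step[where p = p and k = "9 / 5" and l = "2 / 3" and e = "21 / 100"
            and K = "1 / 3" and E = "(7/10) ^ 4 * (1 - 7/10) - 67 / 1000", OF nn _ psi(1) up third])
        (use 1 d d3 p23 dd[OF d3] in \<open>simp_all add: power_divide\<close>)
  next
    case 2
    then have "d \<le> 3 / 10" using dp by linarith
    then show ?thesis
      by (intro small_big_part_step[where p = p and k = "59 / 40" and l = "7 / 10" and e = "21 / 100"
            and K = "1 / 3" and E = "(29/40) ^ 4 * (1 - 29/40) - 67 / 1000", OF nn _ psi(1) up third])
        (use 2 d d3 p23 dd[of "3/10"] in \<open>simp_all add: power_divide\<close>)
  next
    case 3
    then have "d \<le> 11 / 40" using dp by linarith
    then show ?thesis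
      by (intro small_big_part_step[where p = p and k = "1274 / 1000" and l = "29 / 40" and e = "1 / 4"
            and K = "1 / 3" and E = "(3/4) ^ 4 * (1 - 3/4) - 67 / 1000", OF nn _ psi(1) up third])
        (use 3 d d3 p23 dd[of "11/40"] in \<open>simp_all add: power_divide\<close>)
  next
    case 4
    then show ?thesis
      by (intro small_big_part_step[where p = p and k = "1086 / 1000" and l = "29 / 40" and e = "21 / 100"
            and K = "1 / 4" and E = "(3/4) ^ 4 * (1 - 3/4) - 67 / 1000", OF nn _ psi(1) up quarter])
        (use 4 d d3 p23 dd[of "1/4"] in \<open>simp_all add: power_divide\<close>)
  next
    case 5
    then have "d \<le> 1 / 4" using dp by linarith
    then show ?thesis
      by (intro small_big_part_step[where p = p and k = "982 / 1000" and l = "3 / 4" and e = "21 / 100"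
            and K = "1 / 4" and E = "(77/100) ^ 4 * (1 - 77/100) - 67 / 1000", OF nn _ psi(1) up quarter])
        (use 5 d d3 p23 dd[of "1/4"] in \<open>simp_all add: power_divide\<close>)
  next
    case 6
    then have "d \<le> 23 / 100" using dp by linarith
    then show ?thesis
      by (intro small_big_part_step[where p = p and k = "88 / 100" and l = "77 / 100" and e = "21 / 100"
            and K = "1 / 4" and E = "(79/100) ^ 4 * (1 - 79/100) - 67 / 1000", OF nn _ psi(1) up quarter])
        (use 6 d d3 p23 p79 dd[of "23/100"] in \<open>simp_all add: power_divide\<close>)
  qed
qed

text \<open>If \<open>D x y\<close> is small, every exceptional vertex costs strictly more than it gains. The right-hand side is the
  coefficient of \<open>b\<close> in \<open>big_part_large\<close>, diminished by what compensates for replacing \<open>p\<close> by \<open>q = p + b\<close> in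
  the coefficient of \<open>R\<close>.\<close>

lemma exceptional_cost_pos:
  fixes q d p :: real
  assumes q: "79 / 100 \<le> q" "q \<le> 9 / 10" and d: "d = 1 - q" and p: "23 / 25 * q \<le> p" "p \<le> q"
  shows "1 / 2000 \<le> q * (d * (q ^ 3 + q\<^sup>2 * p + q * p\<^sup>2 + p ^ 3)) - 3 / 16 * q * p ^ 4
     - 27 / 64 * d - 1 / 2 * d\<^sup>2 - 1106 / 10000 * q ^ 3"
proof -
  have nn: "0 \<le> p" "0 \<le> q" "0 \<le> d" using assms by auto
  have s3: "27664 / 10000 * q ^ 3 \<le> q ^ 3 + q\<^sup>2 * p + q * p\<^sup>2"
  proof -
    have "q\<^sup>2 * (23 / 25 * q) \<le> q\<^sup>2 * p" using p nn by (intro mult_left_mono) auto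
    moreover have "q * (23 / 25 * q)\<^sup>2 \<le> q * p\<^sup>2" using p nn by (intro mult_left_mono power_mono) auto
    ultimately show ?thesis by (simp add: power2_eq_square power3_eq_cube field_simps)
  qed
  have p4: "3 / 16 * p ^ 4 \<le> 3 / 16 * (q * p ^ 3)"
    using mult_right_mono[OF p(2), of "p ^ 3"] nn by (simp add: power4_eq_xxxx power3_eq_cube mult_ac)
  have main: "d * (27664 / 10000 * q ^ 3) + (d - 3 / 16 * q) * p ^ 3
      \<le> d * (q ^ 3 + q\<^sup>2 * p + q * p\<^sup>2 + p ^ 3) - 3 / 16 * p ^ 4"
    using mult_left_mono[OF s3 nn(3)] p4 by (simp add: algebra_simps)
  define X where "X = d * (q ^ 3 + q\<^sup>2 * p + q * p\<^sup>2 + p ^ 3) - 3 / 16 * p ^ 4"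
  have "1 / 2000 \<le> q * X - 27 / 64 * d - 1 / 2 * d\<^sup>2 - 1106 / 10000 * q ^ 3"
  proof (cases "3 / 16 * q \<le> d")
    case True
    then have "0 \<le> (d - 3 / 16 * q) * p ^ 3" using nn by (intro mult_nonneg_nonneg) auto
    then have "d * (27664 / 10000 * q ^ 3) \<le> X" using main unfolding X_def by linarith
    then have "q * (d * (27664 / 10000 * q ^ 3)) \<le> q * X" using nn by (intro mult_left_mono) auto
    then have qX: "27664 / 10000 * (q ^ 4 * (1 - q)) \<le> q * X"
      by (simp add: d power4_eq_xxxx power3_eq_cube mult_ac)
    have q843: "q \<le> 843 / 1000" using True d by simp
    have "792 / 10000 \<le> q ^ 4 * (1 - q)"
    proof (cases "q \<le> 4 / 5")
      case True
      then have "(79 / 100) ^ 4 * (1 - 79 / 100) \<le> q ^ 4 * (1 - q)"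
        using q by (intro fourth_power_rest_mono) auto
      then show ?thesis by (simp add: power_divide)
    next
      case False
      then have "(843 / 1000) ^ 4 * (1 - 843 / 1000) \<le> q ^ 4 * (1 - q)"
        using q843 by (intro fourth_power_rest_antimono) auto
      then show ?thesis by (simp add: power_divide)
    qed
    moreover have "q ^ 3 \<le> (843 / 1000) ^ 3" using q843 nn by (intro power_mono) auto
    then have "q ^ 3 \<le> 6 / 10" by (simp add: power_divide)
    moreover have d21: "d \<le> 21 / 100" using q d by simp
    moreover have "d\<^sup>2 \<le> (21 / 100)\<^sup>2" using d21 nn by (intro power_mono) auto
    then have "d\<^sup>2 \<le> 45 / 1000" by (simp add: power_divide)
    ultimately show ?thesis using qX by linarith
  next
    case False
    then have "(d - 3 / 16 * q) * q ^ 3 \<le> (d - 3 / 16 * q) * p ^ 3"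
      using p nn by (intro mult_left_mono_neg power_mono) auto
    then have "d * (27664 / 10000 * q ^ 3) + (d - 3 / 16 * q) * q ^ 3 \<le> X"
      using main unfolding X_def by linarith
    then have "q * (d * (27664 / 10000 * q ^ 3) + (d - 3 / 16 * q) * q ^ 3) \<le> q * X"
      using nn by (intro mult_left_mono) auto
    also have "q * (d * (27664 / 10000 * q ^ 3) + (d - 3 / 16 * q) * q ^ 3)
       = q ^ 4 * (37664 / 10000 - 39539 / 10000 * q)"
      by (simp add: d power4_eq_xxxx power3_eq_cube field_simps)
    finally have qX: "q ^ 4 * (37664 / 10000 - 39539 / 10000 * q) \<le> q * X" .
    have q842: "842 / 1000 \<le> q" using False d by simp
    \<comment> \<open>Every monotone term is evaluated at the worse end of an interval containing \<open>q\<close>.\<close>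
    have step: ?thesis if lu: "l \<le> q" "q \<le> u" "0 \<le> l" "0 \<le> u" "0 \<le> 37664 / 10000 - 39539 / 10000 * u"
      and num: "1 / 2000 \<le> l ^ 4 * (37664 / 10000 - 39539 / 10000 * u) - 27 / 64 * (1 - l)
         - 1 / 2 * (1 - l)\<^sup>2 - 1106 / 10000 * u ^ 3" for l u
    proof -
      have "l ^ 4 * (37664 / 10000 - 39539 / 10000 * u) \<le> q ^ 4 * (37664 / 10000 - 39539 / 10000 * q)"
        using lu by (intro mult_mono power_mono) auto
      moreover have "q ^ 3 \<le> u ^ 3" using lu nn by (intro power_mono) auto
      moreover have "d\<^sup>2 \<le> (1 - l)\<^sup>2" using lu nn d by (intro power_mono) auto
      moreover have "d \<le> 1 - l" using lu d by simp
      moreover have "1 / 2000 \<le> X' - 27 / 64 * d - 1 / 2 * d' - 1106 / 10000 * q'"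
        if "A \<le> B" "q' \<le> u'" "d' \<le> l'" "d \<le> 1 - l" "B \<le> X'"
          "1 / 2000 \<le> A - 27 / 64 * (1 - l) - 1 / 2 * l' - 1106 / 10000 * u'" for A B X' d' l' q' u' :: real
        using that by argo
      ultimately show ?thesis using qX num by blast
    qed
    consider "q \<le> 87 / 100" | "87 / 100 \<le> q" "q \<le> 885 / 1000"
      | "885 / 1000 \<le> q" "q \<le> 893 / 1000" | "893 / 1000 \<le> q" by linarith
    then show ?thesis
    proof cases
      case 1
      show ?thesis by (rule step[of "842 / 1000" "87 / 100"]) (use 1 q842 in \<open>simp_all add: power_divide\<close>)
    next
      case 2
      show ?thesis by (rule step[of "87 / 100" "885 / 1000"]) (use 2 in \<open>simp_all add: power_divide\<close>)
    next
      case 3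
      show ?thesis by (rule step[of "885 / 1000" "893 / 1000"]) (use 3 in \<open>simp_all add: power_divide\<close>)
    next
      case 4
      show ?thesis by (rule step[of "893 / 1000" "9 / 10"]) (use 4 q in \<open>simp_all add: power_divide\<close>)
    qed
  qed
  then show ?thesis unfolding X_def by (simp add: algebra_simps)
qed

text \<open>In the range of the extremal graphs the bound is \<open>Lam d\<close> minus the costs of exceptional vertices and of
  crossing edges, so that equality forces both to vanish.\<close>

lemma big_part_large:
  fixes p b d R psi y yD :: real
  assumes nn: "0 \<le> p" "0 \<le> b" "0 \<le> d" "0 \<le> R" and sum: "p + b + d = 1"
    and psi: "67 / 1000 \<le> psi" "psi \<le> p ^ 4 * (d + 3 / 16 * b) - 13 / 8 * p ^ 3 * R"
    and y: "y \<le> (1 - d) * psi + 27 / 64 * (R + b * d) + yD"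
    and yD: "yD \<le> d ^ 5 * (1 - d) + 1 / 2 * (b * d\<^sup>2 + 2 * d * R)"
    and d: "d \<le> 21 / 100"
  shows "y \<le> Lam d - 1 / 1000 * R - 1 / 2000 * b"
proof -
  have d_eq: "d = 1 - p - b" using sum by simp
  have e: "psi + 13 / 8 * p ^ 3 * R + 13 / 16 * p ^ 4 * b \<le> p ^ 4 * (1 - p)"
    using psi(2) unfolding d_eq by (simp add: algebra_simps)
  have nn2: "0 \<le> 13 / 8 * p ^ 3 * R" "0 \<le> 13 / 16 * p ^ 4 * b" using nn by auto
  have low: "67 / 1000 \<le> p ^ 4 * (1 - p)" using e nn2 psi(1) by linarith
  have p1: "p \<le> 1" using nn sum by linarith
  have p9: "p \<le> 9 / 10"
  proof (rule ccontr)
    assume "\<not> p \<le> 9 / 10"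
    then have "p ^ 4 * (1 - p) \<le> (9 / 10) ^ 4 * (1 - 9 / 10)" by (intro fourth_power_rest_antimono) auto
    then show False using low by (simp add: power_divide)
  qed
  \<comment> \<open>Too small a \<open>p\<close> or \<open>d\<close> would make \<open>p\<^sup>4 (d + 3 / 16 b)\<close> smaller than \<open>67 / 1000\<close>; substituting for \<open>b\<close> gives this form.\<close>
  have mono: "p ^ 4 * (c - 3 / 16 * p) \<le> u ^ 4 * (c - 3 / 16 * u)"
    if "p \<le> u" "u \<le> 9 / 10" "1 / 4 \<le> c" for c u :: real
  proof (rule DERIV_nonneg_imp_nondecreasing[OF that(1), of "\<lambda>p. p ^ 4 * (c - 3 / 16 * p)"])
    fix x assume x: "p \<le> x" "x \<le> u"
    have "((\<lambda>p. p ^ 4 * (c - 3 / 16 * p)) has_real_derivative x ^ 3 * (4 * c - 15 / 16 * x)) (at x)"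
      by (auto intro!: derivative_eq_intros simp: power3_eq_cube power4_eq_xxxx field_simps)
    moreover have "0 \<le> x ^ 3 * (4 * c - 15 / 16 * x)" using x that nn by (intro mult_nonneg_nonneg) auto
    ultimately show "\<exists>y. ((\<lambda>p. p ^ 4 * (c - 3 / 16 * p)) has_real_derivative y) (at x) \<and> 0 \<le> y" by blast
  qed
  have p74: "74 / 100 \<le> p"
  proof (rule ccontr)
    assume *: "\<not> 74 / 100 \<le> p"
    have "psi \<le> p ^ 4 * (d + 3 / 16 * b)" using psi(2) nn2 by linarith
    also have "d + 3 / 16 * b \<le> 358125 / 1000000 - 3 / 16 * p" using d d_eq by linarith
    then have "p ^ 4 * (d + 3 / 16 * b) \<le> p ^ 4 * (358125 / 1000000 - 3 / 16 * p)"
      using nn by (intro mult_left_mono) auto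
    also have "\<dots> \<le> (74 / 100) ^ 4 * (358125 / 1000000 - 3 / 16 * (74 / 100))" using * by (intro mono) auto
    finally show False using psi(1) by (simp add: power_divide)
  qed
  have d10: "1 / 10 \<le> d"
  proof (rule ccontr)
    assume *: "\<not> 1 / 10 \<le> d"
    have "psi \<le> p ^ 4 * (d + 3 / 16 * b)" using psi(2) nn2 by linarith
    also have "d + 3 / 16 * b \<le> 26875 / 100000 - 3 / 16 * p" using * d_eq by linarith
    then have "p ^ 4 * (d + 3 / 16 * b) \<le> p ^ 4 * (26875 / 100000 - 3 / 16 * p)"
      using nn by (intro mult_left_mono) auto
    also have "\<dots> \<le> (9 / 10) ^ 4 * (26875 / 100000 - 3 / 16 * (9 / 10))" using p9 by (intro mono) auto
    finally show False using psi(1) by (simp add: power_divide)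
  qed
  have rest: "13 / 8 * p ^ 3 * R + 13 / 16 * p ^ 4 * b \<le> 1492 / 100000"
    using e psi(1) fourth_power_rest_le[OF nn(1)] by linarith
  have "(74 / 100) ^ 3 \<le> p ^ 3" "(74 / 100) ^ 4 \<le> p ^ 4" using p74 by (auto intro!: power_mono)
  then have p34: "405 / 1000 \<le> p ^ 3" "2998 / 10000 \<le> p ^ 4" by (simp_all add: power_divide)
  have "13 / 8 * (405 / 1000) * R \<le> 13 / 8 * p ^ 3 * R" using p34 nn by (intro mult_right_mono mult_left_mono) auto
  then have R: "R \<le> 2268 / 100000" using rest nn2 by linarith
  have "13 / 16 * (2998 / 10000) * b \<le> 13 / 16 * p ^ 4 * b" using p34 nn by (intro mult_right_mono mult_left_mono) auto
  then have b: "b \<le> 613 / 10000" using rest nn2 by linarith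
  define q where "q = 1 - d"
  have q: "q = p + b" "79 / 100 \<le> q" "q \<le> 9 / 10" "d = 1 - q" using sum d d10 by (auto simp: q_def)
  have cost: "1 / 2000 \<le> q * (d * (q ^ 3 + q\<^sup>2 * p + q * p\<^sup>2 + p ^ 3)) - 3 / 16 * q * p ^ 4
     - 27 / 64 * d - 1 / 2 * d\<^sup>2 - 1106 / 10000 * q ^ 3"
    using q b nn by (intro exceptional_cost_pos) auto
  have p3: "q ^ 3 - 3 * q\<^sup>2 * b \<le> p ^ 3"
  proof -
    have "p ^ 3 - (q ^ 3 - 3 * q\<^sup>2 * b) = b\<^sup>2 * (3 * q - b)"
      by (simp add: q(1) power2_eq_square power3_eq_cube algebra_simps)
    also have "\<dots> \<ge> 0" using q nn by (intro mult_nonneg_nonneg) auto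
    finally show ?thesis by simp
  qed
  \<comment> \<open>The loss \<open>3 q\<^sup>2 b\<close> in \<open>p3\<close> multiplies \<open>13 / 8 * q * R\<close>, and \<open>39 / 8\<close> times the bound for \<open>R\<close> is below \<open>1106 / 10000\<close>.\<close>
  have costR: "1 / 1000 * R - 1106 / 10000 * q ^ 3 * b \<le> R * (13 / 8 * (p ^ 3 * q) - 27 / 64 - d)"
  proof -
    have "(79 / 100) ^ 4 \<le> q ^ 4" using q by (intro power_mono) auto
    then have "1 / 1000 \<le> 13 / 8 * q ^ 4 - 27 / 64 - d" using q by (simp add: power_divide)
    then have "R * (1 / 1000) \<le> R * (13 / 8 * q ^ 4 - 27 / 64 - d)" using nn by (intro mult_left_mono) auto
    moreover have "R * (39 / 8 * (q ^ 3 * b)) \<le> 2268 / 100000 * (39 / 8 * (q ^ 3 * b))"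
      using R nn q by (intro mult_right_mono) auto
    moreover have "2268 / 100000 * (39 / 8 * (q ^ 3 * b)) \<le> 1106 / 10000 * (q ^ 3 * b)"
      using nn q by simp
    moreover have "R * ((q ^ 3 - 3 * q\<^sup>2 * b) * q) \<le> R * (p ^ 3 * q)"
      using p3 nn q by (intro mult_left_mono mult_right_mono) auto
    ultimately show ?thesis by (simp add: power2_eq_square power3_eq_cube power4_eq_xxxx field_simps)
  qed
  have "y \<le> q * (p ^ 4 * (d + 3 / 16 * b) - 13 / 8 * p ^ 3 * R) + 27 / 64 * (R + b * d)
      + (d ^ 5 * (1 - d) + 1 / 2 * (b * d\<^sup>2 + 2 * d * R))"
  proof -
    have "y \<le> q * psi + 27 / 64 * (R + b * d) + yD" using y by (simp only: q_def)
    moreover have "q * psi \<le> q * (p ^ 4 * (d + 3 / 16 * b) - 13 / 8 * p ^ 3 * R)"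
      using psi(2) q(2) by (intro mult_left_mono) auto
    ultimately show ?thesis using yD by linarith
  qed
  also have "\<dots> = Lam d - R * (13 / 8 * (p ^ 3 * q) - 27 / 64 - d)
      - b * (q * (d * (q ^ 3 + q\<^sup>2 * p + q * p\<^sup>2 + p ^ 3)) - 3 / 16 * q * p ^ 4 - 27 / 64 * d - 1 / 2 * d\<^sup>2)"
  proof -
    have "q ^ 5 * d - q * p ^ 4 * d = b * (q * (d * (q ^ 3 + q\<^sup>2 * p + q * p\<^sup>2 + p ^ 3)))"
      unfolding q(1) by (simp add: power2_eq_square power3_eq_cube power4_eq_xxxx power_def numeral_eq_Suc algebra_simps)
    moreover have "Lam d = d ^ 5 * (1 - d) + d * q ^ 5" by (simp add: Lam_def q_def)
    ultimately show ?thesis by (simp add: field_simps)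
  qed
  also have "\<dots> \<le> Lam d - (1 / 1000 * R - 1106 / 10000 * q ^ 3 * b) - b * (1 / 2000 + 1106 / 10000 * q ^ 3)"
    using costR mult_left_mono[OF cost nn(2)] by (simp add: field_simps)
  finally show ?thesis by (simp add: field_simps)
qed

text \<open>The parameters of a maximal edge: \<open>p\<close>, \<open>b\<close> and \<open>d\<close> are the measures of its neighbourhood, of the
  exceptional vertices and of \<open>D x y\<close>, while \<open>psi\<close> is \<open>Psi x y\<close>, \<open>y\<close> is \<open>8 * total\<close> and \<open>yD\<close> is the contribution
  of the edges inside \<open>D x y\<close>. Of the two bounds for \<open>y\<close> the first ignores \<open>D x y\<close>, and the second treats the
  edges inside and outside \<open>D x y\<close> separately.\<close>

theorem master_inequality:
  fixes p b d R psi y yD :: real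
  assumes nn: "0 \<le> p" "0 \<le> b" "0 \<le> d" "0 \<le> R" and sum: "p + b + d = 1"
    and psi: "psi \<le> p ^ 4 * (d + 3 / 16 * b) - 13 / 8 * p ^ 3 * R"
    and y: "y \<le> psi" "y \<le> (1 - d) * psi + 27 / 64 * (R + b * d) + yD"
    and yD: "\<And>K. growth_const d K \<Longrightarrow> yD \<le> d ^ 5 * (1 - d) + 2 * K * (b * d\<^sup>2 + 2 * d * R)"
  shows "y < 67 / 1000 \<or> d \<le> 21 / 100" "y \<le> Lam alpha"
proof -
  show *: "y < 67 / 1000 \<or> d \<le> 21 / 100"
    using big_part_not_small[OF nn sum _ psi y(2) yD] y(1) by fastforce
  show "y \<le> Lam alpha"
  proof (cases "y < 67 / 1000")
    case False
    then have "d \<le> 21 / 100" "67 / 1000 \<le> psi" using * y(1) by auto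
    moreover have "yD \<le> d ^ 5 * (1 - d) + 1 / 2 * (b * d\<^sup>2 + 2 * d * R)"
      using yD[OF growth_const_quarter[OF nn(3)]] calculation(1) by simp
    ultimately show ?thesis
      using big_part_large[OF nn sum _ psi y(2)] Lam_le[of d] nn by fastforce
  qed (use Lam_alpha_lower in simp)
qed

lemma master_equality:
  fixes p b d R psi yD :: real
  assumes nn: "0 \<le> p" "0 \<le> b" "0 \<le> d" "0 \<le> R" and sum: "p + b + d = 1"
    and psi: "psi \<le> p ^ 4 * (d + 3 / 16 * b) - 13 / 8 * p ^ 3 * R"
    and y: "Lam alpha \<le> psi" "Lam alpha \<le> (1 - d) * psi + 27 / 64 * (R + b * d) + yD"
    and yD: "yD \<le> d ^ 5 * (1 - d) + 1 / 2 * (b * d\<^sup>2 + 2 * d * R)"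
    and d21: "d \<le> 21 / 100"
  shows "b = 0 \<and> R = 0 \<and> d = alpha \<and> psi = (1 - alpha) ^ 4 * alpha \<and> yD = alpha ^ 5 * (1 - alpha)"
proof -
  have psi67: "67 / 1000 \<le> psi" using Lam_alpha_lower y(1) by linarith
  have le: "Lam alpha \<le> Lam d - 1 / 1000 * R - 1 / 2000 * b"
    by (rule big_part_large[OF nn sum psi67 psi y(2) yD d21])
  then have bR: "b = 0" "R = 0" and "Lam d = Lam alpha" using Lam_le[of d] nn by linarith+
  then have d: "d = alpha" using Lam_eq_iff[of d] d21 alpha_bounds by auto
  then have p: "p = 1 - alpha" using sum bR by simp
  have *: "psi \<le> (1 - alpha) ^ 4 * alpha" using psi by (simp add: bR d p)
  moreover have "yD \<le> alpha ^ 5 * (1 - alpha)" using yD by (simp add: bR d)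
  moreover have "(1 - alpha) ^ 5 * alpha + alpha ^ 5 * (1 - alpha) \<le> (1 - alpha) * psi + yD"
    using y(2) by (simp add: bR d Lam_def mult.commute)
  moreover have "(1 - alpha) * ((1 - alpha) ^ 4 * alpha) = (1 - alpha) ^ 5 * alpha"
    by (simp add: power_def numeral_eq_Suc)
  moreover have "(1 - alpha) * psi \<le> (1 - alpha) * ((1 - alpha) ^ 4 * alpha)"
    using * alpha_bounds by (intro mult_left_mono) auto
  ultimately have "(1 - alpha) * psi = (1 - alpha) * ((1 - alpha) ^ 4 * alpha)" "yD = alpha ^ 5 * (1 - alpha)"
    by linarith+
  then show "b = 0 \<and> R = 0 \<and> d = alpha \<and> psi = (1 - alpha) ^ 4 * alpha \<and> yD = alpha ^ 5 * (1 - alpha)"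
    using bR d alpha_bounds by simp
qed

section \<open>Near equality\<close>

text \<open>The passage from equality to near equality: the constraints are summarised as \<open>0 \<le> h x\<close> and the distance
  from the extremal point as \<open>g x\<close>.\<close>

lemma compact_slack:
  fixes h g :: "'b :: t2_space \<Rightarrow> real"
  assumes K: "compact K" and h: "continuous_on K h" and g: "continuous_on K g"
    and imp: "\<And>x. x \<in> K \<Longrightarrow> 0 \<le> h x \<Longrightarrow> g x < e"
  shows "\<exists>k>0. \<forall>x\<in>K. - k \<le> h x \<longrightarrow> g x < e"
proof (cases "K \<inter> g -` {e..} = {}")
  case True
  then show ?thesis by (intro exI[of _ 1]) (auto simp: not_le[symmetric])
next
  case False
  have "closed (K \<inter> g -` {e..})"
    using g compact_imp_closed[OF K] by (intro continuous_closed_preimage) auto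
  then have "compact (K \<inter> (K \<inter> g -` {e..}))" using K by (intro compact_Int_closed)
  then have "compact (K \<inter> g -` {e..})" by (simp add: Int_assoc[symmetric])
  moreover have "continuous_on (K \<inter> g -` {e..}) h" using h by (rule continuous_on_subset) auto
  ultimately obtain x where x: "x \<in> K \<inter> g -` {e..}" "\<forall>y\<in>K \<inter> g -` {e..}. h y \<le> h x"
    using continuous_attains_sup[of "K \<inter> g -` {e..}" h] False by blast
  have "h x < 0" using imp[of x] x(1) by force
  then show ?thesis using x(2) by (intro exI[of _ "- h x / 2"]) force
qed

lemma near_master_equality:
  fixes e :: real
  assumes "0 < e"
  obtains k where "0 < k"
    "\<And>p b d R psi yD. \<lbrakk>0 \<le> p; 0 \<le> b; 0 \<le> d; 0 \<le> R; R \<le> 1; p + b + d = 1; 0 \<le> psi; psi \<le> 1; 0 \<le> yD; yD \<le> 8;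
        psi \<le> p ^ 4 * (d + 3 / 16 * b) - 13 / 8 * p ^ 3 * R;
        Lam alpha - k \<le> psi; Lam alpha - k \<le> (1 - d) * psi + 27 / 64 * (R + b * d) + yD;
        yD \<le> d ^ 5 * (1 - d) + 1 / 2 * (b * d\<^sup>2 + 2 * d * R); d \<le> 21 / 100\<rbrakk>
      \<Longrightarrow> b + R + \<bar>d - alpha\<bar> + \<bar>psi - (1 - alpha) ^ 4 * alpha\<bar> + \<bar>yD - alpha ^ 5 * (1 - alpha)\<bar> < e"
proof -
  define K :: "(real \<times> real \<times> real \<times> real \<times> real) set"
    where "K = {0..1} \<times> {0..21/100} \<times> {0..1} \<times> {0..1} \<times> {0..8}"
  define h :: "real \<times> real \<times> real \<times> real \<times> real \<Rightarrow> real" where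
    "h = (\<lambda>(b, d, R, psi, yD). min (1 - b - d) (min (psi - Lam alpha)
      (min ((1 - d) * psi + 27 / 64 * (R + b * d) + yD - Lam alpha)
       (min ((1 - b - d) ^ 4 * (d + 3 / 16 * b) - 13 / 8 * (1 - b - d) ^ 3 * R - psi)
        (d ^ 5 * (1 - d) + 1 / 2 * (b * d\<^sup>2 + 2 * d * R) - yD)))))"
  define g :: "real \<times> real \<times> real \<times> real \<times> real \<Rightarrow> real" where
    "g = (\<lambda>(b, d, R, psi, yD). b + R + \<bar>d - alpha\<bar> + \<bar>psi - (1 - alpha) ^ 4 * alpha\<bar>
      + \<bar>yD - alpha ^ 5 * (1 - alpha)\<bar>)"
  have "compact K" unfolding K_def by (intro compact_Times compact_Icc)
  moreover have "continuous_on K h" unfolding h_def case_prod_beta by (intro continuous_intros)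
  moreover have "continuous_on K g" unfolding g_def case_prod_beta by (intro continuous_intros)
  moreover have "g x < e" if x: "x \<in> K" "0 \<le> h x" for x
  proof -
    obtain b d R psi yD where xe: "x = (b, d, R, psi, yD)" by (metis prod.exhaust)
    have hh: "0 \<le> 1 - b - d \<and> 0 \<le> psi - Lam alpha \<and>
        0 \<le> (1 - d) * psi + 27 / 64 * (R + b * d) + yD - Lam alpha \<and>
        0 \<le> (1 - b - d) ^ 4 * (d + 3 / 16 * b) - 13 / 8 * (1 - b - d) ^ 3 * R - psi \<and>
        0 \<le> d ^ 5 * (1 - d) + 1 / 2 * (b * d\<^sup>2 + 2 * d * R) - yD"
      using x(2) unfolding xe h_def prod.case min.bounded_iff .
    have box: "0 \<le> b" "0 \<le> d" "0 \<le> R" "d \<le> 21 / 100" using x(1) by (auto simp: xe K_def)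
    have "b = 0 \<and> R = 0 \<and> d = alpha \<and> psi = (1 - alpha) ^ 4 * alpha \<and> yD = alpha ^ 5 * (1 - alpha)"
      using hh unfolding le_diff_eq add_0_left
      by (elim conjE) (rule master_equality[of "1 - b - d"]; (rule box)?; simp)
    then show ?thesis using assms by (simp add: xe g_def)
  qed
  ultimately have "\<exists>k>0. \<forall>x\<in>K. - k \<le> h x \<longrightarrow> g x < e"
    by (rule compact_slack)
  then obtain k where k: "0 < k" "\<And>x. x \<in> K \<Longrightarrow> - k \<le> h x \<Longrightarrow> g x < e"
    by blast
  show ?thesis
  proof (rule that[OF k(1)])
    fix p b d R psi yD :: real
    assume *: "0 \<le> p" "0 \<le> b" "0 \<le> d" "0 \<le> R" "R \<le> 1" "p + b + d = 1" "0 \<le> psi" "psi \<le> 1" "0 \<le> yD" "yD \<le> 8"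
        "psi \<le> p ^ 4 * (d + 3 / 16 * b) - 13 / 8 * p ^ 3 * R"
        "Lam alpha - k \<le> psi" "Lam alpha - k \<le> (1 - d) * psi + 27 / 64 * (R + b * d) + yD"
        "yD \<le> d ^ 5 * (1 - d) + 1 / 2 * (b * d\<^sup>2 + 2 * d * R)" "d \<le> 21 / 100"
    have p: "1 - b - d = p" using * by simp
    have "(b, d, R, psi, yD) \<in> K" using * by (simp add: K_def)
    moreover have "- k \<le> h (b, d, R, psi, yD)"
      unfolding h_def prod.case min.bounded_iff p using * k(1) by (intro conjI) linarith+
    ultimately show "b + R + \<bar>d - alpha\<bar> + \<bar>psi - (1 - alpha) ^ 4 * alpha\<bar> + \<bar>yD - alpha ^ 5 * (1 - alpha)\<bar> < e"
      using k(2)[of "(b, d, R, psi, yD)"] by (simp add: g_def)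
  qed
qed

text \<open>For an edge \<open>x y\<close> with private neighbourhoods of measures \<open>a\<close> and \<open>b\<close> and \<open>t\<close> for the common neighbours, the
  left-hand side is \<open>Psi x y\<close> if \<open>I\<close> measures the failure of the neighbourhoods to be complete bipartite.\<close>

lemma tight_count_le:
  fixes a b t I :: real
  assumes nn: "0 \<le> a" "0 \<le> b" "0 \<le> t" "0 \<le> I" and U: "a + b + t \<le> 1"
  shows "4 * ((1 - (a + b + t)) * (a * b * (a + b)) - I) * (a + b + 2 * t)
     \<le> (a + b + t) ^ 4 * (1 - (a + b + t))"
proof -
  let ?U = "a + b + t"
  have "4 * (a * b * (a + b)) \<le> (a + b) ^ 3" using mult_sum_le_cube[of a b] nn by simp
  then have "(1 - ?U) * (4 * (a * b * (a + b))) \<le> (1 - ?U) * (a + b) ^ 3"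
    using U by (intro mult_left_mono) auto
  then have "4 * ((1 - ?U) * (a * b * (a + b)) - I) \<le> (1 - ?U) * (a + b) ^ 3" using nn by simp
  then have "4 * ((1 - ?U) * (a * b * (a + b)) - I) * (a + b + 2 * t)
      \<le> (1 - ?U) * (a + b) ^ 3 * (a + b + 2 * t)" using nn by (intro mult_right_mono) auto
  also have "\<dots> = (1 - ?U) * ((?U - t) ^ 3 * (?U + t))" by simp
  also have "\<dots> \<le> (1 - ?U) * ?U ^ 4" using diff_cube_sum_le[of t ?U] nn U by (intro mult_left_mono) auto
  finally show ?thesis by (simp add: mult.commute)
qed

lemma tight_count_eq:
  fixes a b t I :: real
  assumes nn: "0 \<le> a" "0 \<le> b" "0 \<le> t" "0 \<le> I" and U: "0 < a + b + t" "a + b + t < 1"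
    and eq: "(a + b + t) ^ 4 * (1 - (a + b + t))
       \<le> 4 * ((1 - (a + b + t)) * (a * b * (a + b)) - I) * (a + b + 2 * t)"
  shows "t = 0 \<and> a = b \<and> I = 0"
proof -
  let ?U = "a + b + t"
  have 1: "?U ^ 4 - (a + b) ^ 3 * (a + b + 2 * t) = t * (2 * (a + b) ^ 3 + 6 * (a + b)\<^sup>2 * t + 4 * (a + b) * t\<^sup>2 + t ^ 3)"
    by (simp add: power2_eq_square power3_eq_cube power4_eq_xxxx algebra_simps)
  have 2: "4 * (a * b * (a + b)) = (a + b) ^ 3 - (a + b) * (a - b)\<^sup>2"
    by (simp add: power2_eq_square power3_eq_cube algebra_simps)
  have "(1 - ?U) * (t * (2 * (a + b) ^ 3 + 6 * (a + b)\<^sup>2 * t + 4 * (a + b) * t\<^sup>2 + t ^ 3))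
      + (1 - ?U) * ((a + b) * (a - b)\<^sup>2 * (a + b + 2 * t)) + 4 * I * (a + b + 2 * t)
    = ?U ^ 4 * (1 - ?U) - 4 * ((1 - ?U) * (a * b * (a + b)) - I) * (a + b + 2 * t)"
  proof -
    have "4 * ((1 - ?U) * (a * b * (a + b)) - I) * (a + b + 2 * t)
      = (1 - ?U) * (4 * (a * b * (a + b))) * (a + b + 2 * t) - 4 * I * (a + b + 2 * t)"
      by (simp add: algebra_simps)
    also have "\<dots> = (1 - ?U) * ((a + b) ^ 3 - (a + b) * (a - b)\<^sup>2) * (a + b + 2 * t) - 4 * I * (a + b + 2 * t)"
      by (simp only: 2)
    finally show ?thesis unfolding 1[symmetric] by (simp only:) (simp add: left_diff_distrib right_diff_distrib mult_ac)
  qed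
  then have sum0: "(1 - ?U) * (t * (2 * (a + b) ^ 3 + 6 * (a + b)\<^sup>2 * t + 4 * (a + b) * t\<^sup>2 + t ^ 3))
      + (1 - ?U) * ((a + b) * (a - b)\<^sup>2 * (a + b + 2 * t)) + 4 * I * (a + b + 2 * t) \<le> 0"
    using eq by simp
  have nn3: "0 \<le> (1 - ?U) * (t * (2 * (a + b) ^ 3 + 6 * (a + b)\<^sup>2 * t + 4 * (a + b) * t\<^sup>2 + t ^ 3))"
    "0 \<le> (1 - ?U) * ((a + b) * (a - b)\<^sup>2 * (a + b + 2 * t))" "0 \<le> 4 * I * (a + b + 2 * t)"
    using nn U by (auto intro!: mult_nonneg_nonneg add_nonneg_nonneg)
  have z: "(1 - ?U) * (t * (2 * (a + b) ^ 3 + 6 * (a + b)\<^sup>2 * t + 4 * (a + b) * t\<^sup>2 + t ^ 3)) = 0"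
    "(1 - ?U) * ((a + b) * (a - b)\<^sup>2 * (a + b + 2 * t)) = 0" "4 * I * (a + b + 2 * t) = 0"
    using sum0 nn3 by linarith+
  have "t = 0"
  proof (rule ccontr)
    assume "t \<noteq> 0"
    then have "0 < t" using nn by simp
    then have "0 < 2 * (a + b) ^ 3 + 6 * (a + b)\<^sup>2 * t + 4 * (a + b) * t\<^sup>2 + t ^ 3"
      using nn by (intro add_nonneg_pos add_nonneg_nonneg mult_nonneg_nonneg) auto
    with z(1) U \<open>0 < t\<close> show False by simp
  qed
  moreover have "0 < a + b" using U \<open>t = 0\<close> by simp
  ultimately show ?thesis using z(2,3) U by auto
qed

lemma near_tight_big:
  fixes e q :: real
  assumes "0 < e" "0 < q" "q < 1"
  obtains k where "0 < k"
    "\<And>a b t I. \<lbrakk>0 \<le> a; 0 \<le> b; 0 \<le> t; 0 \<le> I; I \<le> 1; a + b + t \<le> 1; \<bar>a + b + t - q\<bar> \<le> k;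
        q ^ 4 * (1 - q) - k \<le> 4 * ((1 - (a + b + t)) * (a * b * (a + b)) - I) * (a + b + 2 * t)\<rbrakk>
      \<Longrightarrow> \<bar>a - q / 2\<bar> + \<bar>b - q / 2\<bar> + t + I < e"
proof -
  define K :: "(real \<times> real \<times> real \<times> real) set" where "K = {0..1} \<times> {0..1} \<times> {0..1} \<times> {0..1}"
  define h :: "real \<times> real \<times> real \<times> real \<Rightarrow> real" where
    "h = (\<lambda>(a, b, t, I). min (- \<bar>a + b + t - q\<bar>)
       (4 * ((1 - (a + b + t)) * (a * b * (a + b)) - I) * (a + b + 2 * t) - q ^ 4 * (1 - q)))"
  define g :: "real \<times> real \<times> real \<times> real \<Rightarrow> real" where
    "g = (\<lambda>(a, b, t, I). \<bar>a - q / 2\<bar> + \<bar>b - q / 2\<bar> + t + I)"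
  have "compact K" unfolding K_def by (intro compact_Times compact_Icc)
  moreover have "continuous_on K h" unfolding h_def case_prod_beta by (intro continuous_intros)
  moreover have "continuous_on K g" unfolding g_def case_prod_beta by (intro continuous_intros)
  moreover have "g x < e" if x: "x \<in> K" "0 \<le> h x" for x
  proof -
    obtain a b t I where xe: "x = (a, b, t, I)" by (metis prod.exhaust)
    have hh: "0 \<le> - \<bar>a + b + t - q\<bar> \<and>
        0 \<le> 4 * ((1 - (a + b + t)) * (a * b * (a + b)) - I) * (a + b + 2 * t) - q ^ 4 * (1 - q)"
      using x(2) unfolding xe h_def prod.case min.bounded_iff .
    then have q: "a + b + t = q" by simp
    have box: "0 \<le> a" "0 \<le> b" "0 \<le> t" "0 \<le> I" using x(1) by (auto simp: xe K_def)
    have "t = 0 \<and> a = b \<and> I = 0"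
      using hh assms q by (intro tight_count_eq box) (auto simp only: le_diff_eq add_0_left)
    then show ?thesis using assms q by (auto simp: xe g_def)
  qed
  ultimately have "\<exists>k>0. \<forall>x\<in>K. - k \<le> h x \<longrightarrow> g x < e"
    by (rule compact_slack)
  then obtain k where k: "0 < k" "\<And>x. x \<in> K \<Longrightarrow> - k \<le> h x \<Longrightarrow> g x < e"
    by blast
  show ?thesis
  proof (rule that[OF k(1)])
    fix a b t I :: real
    assume *: "0 \<le> a" "0 \<le> b" "0 \<le> t" "0 \<le> I" "I \<le> 1" "a + b + t \<le> 1" "\<bar>a + b + t - q\<bar> \<le> k"
        "q ^ 4 * (1 - q) - k \<le> 4 * ((1 - (a + b + t)) * (a * b * (a + b)) - I) * (a + b + 2 * t)"
    have "(a, b, t, I) \<in> K" using * by (simp add: K_def)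
    moreover have "- k \<le> h (a, b, t, I)"
      unfolding h_def prod.case min.bounded_iff using * by (intro conjI) linarith+
    ultimately show "\<bar>a - q / 2\<bar> + \<bar>b - q / 2\<bar> + t + I < e"
      using k(2)[of "(a, b, t, I)"] by (simp add: g_def)
  qed
qed

lemma fourth_power_rest_strict_mono:
  fixes U d :: real
  assumes "0 \<le> U" "U < d" "d < 4 / 5"
  shows "U ^ 4 * (1 - U) < d ^ 4 * (1 - d)"
proof -
  define m where "m = (U + d) / 2"
  have m: "U < m" "m < d" using assms by (auto simp: m_def)
  have "m ^ 4 * (1 - m) < d ^ 4 * (1 - d)"
  proof (rule DERIV_pos_imp_increasing[OF m(2), of "\<lambda>U. U ^ 4 * (1 - U)"])
    fix x assume x: "m \<le> x" "x \<le> d"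
    have "((\<lambda>U. U ^ 4 * (1 - U)) has_real_derivative x ^ 3 * (4 - 5 * x)) (at x)"
      by (auto intro!: derivative_eq_intros simp: power3_eq_cube power4_eq_xxxx algebra_simps)
    moreover have "0 < x ^ 3 * (4 - 5 * x)" using x m assms by (intro mult_pos_pos) auto
    ultimately show "\<exists>y. ((\<lambda>U. U ^ 4 * (1 - U)) has_real_derivative y) (at x) \<and> 0 < y" by blast
  qed
  moreover have "U ^ 4 * (1 - U) \<le> m ^ 4 * (1 - m)" using m assms by (intro fourth_power_rest_mono) auto
  ultimately show ?thesis by simp
qed

text \<open>The edge inside \<open>D x y\<close> that realises the small component: \<open>w\<close> bounds how far its neighbourhood exceeds
  \<open>D x y\<close>. As the inequality in \<open>growth_const\<close> is strict, a larger neighbourhood is impossible, and then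
  the term with \<open>w\<close> forces \<open>w = 0\<close>.\<close>

lemma tight_small_eq:
  fixes a b t I w :: real
  assumes nn: "0 \<le> a" "0 \<le> b" "0 \<le> t" "0 \<le> I" "0 \<le> w" and U: "a + b + t \<le> 1" "a + b + t \<le> alpha + w"
    and eq: "alpha ^ 4 * (1 - alpha) + 1 / 4 * w * (a + b + 2 * t)
       \<le> 4 * ((1 - (a + b + t)) * (a * b * (a + b)) - I) * (a + b + 2 * t)"
  shows "a = alpha / 2 \<and> b = alpha / 2 \<and> t = 0 \<and> I = 0 \<and> w = 0"
proof -
  let ?U = "a + b + t"
  have le: "alpha ^ 4 * (1 - alpha) + 1 / 4 * w * (a + b + 2 * t) \<le> ?U ^ 4 * (1 - ?U)"
    using eq tight_count_le[OF nn(1-4) U(1)] by linarith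
  have gc: "growth_const alpha (1 / 4)" using alpha_bounds by (intro growth_const_quarter) auto
  have nnw: "0 \<le> w * (a + b + 2 * t)" using nn by simp
  have "\<not> alpha < ?U"
  proof
    assume *: "alpha < ?U"
    have 1: "?U ^ 4 * (1 - ?U) < alpha ^ 4 * (1 - alpha) + 1 / 4 * ?U * (?U - alpha)"
      using gc * U(1) unfolding growth_const_def by blast
    have 2: "?U * (?U - alpha) \<le> (a + b + 2 * t) * w"
      using U nn * alpha_bounds by (intro mult_mono) auto
    have "1 / 4 * ?U * (?U - alpha) \<le> 1 / 4 * w * (a + b + 2 * t)"
      using mult_left_mono[OF 2, of "1 / 4"] by (simp add: mult_ac)
    then show False using le 1 by linarith
  qed
  moreover have "\<not> ?U < alpha"
  proof
    assume "?U < alpha"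
    then have "?U ^ 4 * (1 - ?U) < alpha ^ 4 * (1 - alpha)"
      using nn alpha_bounds by (intro fourth_power_rest_strict_mono) auto
    then show False using le nnw by simp
  qed
  ultimately have Ua: "?U = alpha" by simp
  then have "w * (a + b + 2 * t) = 0" using le nnw by simp
  moreover have "a + b + 2 * t \<noteq> 0" using Ua nn alpha_bounds by simp
  ultimately have "w = 0" by simp
  then have "?U ^ 4 * (1 - ?U) \<le> 4 * ((1 - ?U) * (a * b * (a + b)) - I) * (a + b + 2 * t)"
    using eq by (simp add: Ua)
  then have "t = 0 \<and> a = b \<and> I = 0"
    using nn Ua alpha_bounds by (intro tight_count_eq) auto
  then show ?thesis using Ua \<open>w = 0\<close> by auto
qed

lemma near_tight_small:
  fixes e :: real
  assumes "0 < e"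
  obtains k where "0 < k"
    "\<And>a b t I w d. \<lbrakk>0 \<le> a; 0 \<le> b; 0 \<le> t; 0 \<le> I; I \<le> 1; 0 \<le> w; w \<le> 3; a + b + t \<le> 1; a + b + t \<le> d + w;
        0 \<le> d; \<bar>d - alpha\<bar> \<le> k;
        d ^ 4 * (1 - d) - k + 1 / 4 * w * (a + b + 2 * t)
          \<le> 4 * ((1 - (a + b + t)) * (a * b * (a + b)) - I) * (a + b + 2 * t)\<rbrakk>
      \<Longrightarrow> \<bar>a - alpha / 2\<bar> + \<bar>b - alpha / 2\<bar> + t + I + w < e"
proof -
  define K :: "(real \<times> real \<times> real \<times> real \<times> real \<times> real) set"
    where "K = {0..1} \<times> {0..1} \<times> {0..1} \<times> {0..1} \<times> {0..3} \<times> {0..2}"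
  define h :: "real \<times> real \<times> real \<times> real \<times> real \<times> real \<Rightarrow> real" where
    "h = (\<lambda>(a, b, t, I, w, d). min (- \<bar>d - alpha\<bar>) (min (1 - (a + b + t)) (min (d + w - (a + b + t))
       (4 * ((1 - (a + b + t)) * (a * b * (a + b)) - I) * (a + b + 2 * t)
          - (d ^ 4 * (1 - d) + 1 / 4 * w * (a + b + 2 * t))))))"
  define g :: "real \<times> real \<times> real \<times> real \<times> real \<times> real \<Rightarrow> real" where
    "g = (\<lambda>(a, b, t, I, w, d). \<bar>a - alpha / 2\<bar> + \<bar>b - alpha / 2\<bar> + t + I + w)"
  have "compact K" unfolding K_def by (intro compact_Times compact_Icc)
  moreover have "continuous_on K h" unfolding h_def case_prod_beta by (intro continuous_intros)
  moreover have "continuous_on K g" unfolding g_def case_prod_beta by (intro continuous_intros)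
  moreover have "g x < e" if x: "x \<in> K" "0 \<le> h x" for x
  proof -
    obtain a b t I w d where xe: "x = (a, b, t, I, w, d)" by (metis prod.exhaust)
    have hh: "0 \<le> - \<bar>d - alpha\<bar> \<and> 0 \<le> 1 - (a + b + t) \<and> 0 \<le> d + w - (a + b + t) \<and>
        0 \<le> 4 * ((1 - (a + b + t)) * (a * b * (a + b)) - I) * (a + b + 2 * t)
          - (d ^ 4 * (1 - d) + 1 / 4 * w * (a + b + 2 * t))"
      using x(2) unfolding xe h_def prod.case min.bounded_iff .
    then have d: "d = alpha" by simp
    have box: "0 \<le> a" "0 \<le> b" "0 \<le> t" "0 \<le> I" "0 \<le> w" using x(1) by (auto simp: xe K_def)
    have "a + b + t \<le> 1" "a + b + t \<le> alpha + w" using hh unfolding d by linarith+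
    moreover have "alpha ^ 4 * (1 - alpha) + 1 / 4 * w * (a + b + 2 * t)
       \<le> 4 * ((1 - (a + b + t)) * (a * b * (a + b)) - I) * (a + b + 2 * t)"
      using hh unfolding d le_diff_eq add_0_left by (elim conjE)
    ultimately have "a = alpha / 2 \<and> b = alpha / 2 \<and> t = 0 \<and> I = 0 \<and> w = 0"
      by (intro tight_small_eq box)
    then show ?thesis using assms by (simp add: xe g_def)
  qed
  ultimately have "\<exists>k>0. \<forall>x\<in>K. - k \<le> h x \<longrightarrow> g x < e"
    by (rule compact_slack)
  then obtain k where k: "0 < k" "\<And>x. x \<in> K \<Longrightarrow> - k \<le> h x \<Longrightarrow> g x < e"
    by blast
  define k' where "k' = min k 1"
  show ?thesis
  proof (rule that[of k'])
    show "0 < k'" using k(1) by (simp add: k'_def)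
    fix a b t I w d :: real
    assume *: "0 \<le> a" "0 \<le> b" "0 \<le> t" "0 \<le> I" "I \<le> 1" "0 \<le> w" "w \<le> 3" "a + b + t \<le> 1" "a + b + t \<le> d + w"
        "0 \<le> d" "\<bar>d - alpha\<bar> \<le> k'"
        "d ^ 4 * (1 - d) - k' + 1 / 4 * w * (a + b + 2 * t)
          \<le> 4 * ((1 - (a + b + t)) * (a * b * (a + b)) - I) * (a + b + 2 * t)"
    have "k' \<le> k" "k' \<le> 1" by (simp_all add: k'_def)
    then have "d \<le> 2" using *(11) alpha_bounds by linarith
    then have "(a, b, t, I, w, d) \<in> K" using * by (simp add: K_def)
    moreover have "- k \<le> h (a, b, t, I, w, d)"
      unfolding h_def prod.case min.bounded_iff using * k(1) \<open>k' \<le> k\<close> by (intro conjI) linarith+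
    ultimately show "\<bar>a - alpha / 2\<bar> + \<bar>b - alpha / 2\<bar> + t + I + w < e"
      using k(2)[of "(a, b, t, I, w, d)"] by (simp add: g_def)
  qed
qed

section \<open>The density bound and the assignment of parts\<close>

text \<open>The first coordinate tells whether a part belongs to the large component, the second one its side.\<close>

type_synonym part = "bool \<times> bool"

definition partner :: "part \<Rightarrow> part" where "partner i = (fst i, \<not> snd i)"

definition share :: "part \<Rightarrow> real" where
  "share i = (if fst i then (1 - alpha) / 2 else alpha / 2)"

definition wrong :: "('a \<Rightarrow> 'a \<Rightarrow> bool) \<Rightarrow> ('a \<Rightarrow> part) \<Rightarrow> 'a \<Rightarrow> 'a \<Rightarrow> bool" where
  "wrong adj f x y \<longleftrightarrow> x \<noteq> y \<and> (adj x y \<longleftrightarrow> f y \<noteq> partner (f x))"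

context vertices begin

definition dens :: "('a \<Rightarrow> 'a \<Rightarrow> bool) \<Rightarrow> real" where
  "dens E = av (\<lambda>x. av (\<lambda>y. of_bool (E x y)))"

lemma dens_nonneg [simp]: "0 \<le> dens E"
  unfolding dens_def by (intro av_nonneg) simp

lemma dens_mono: "(\<And>x y. x \<in> W \<Longrightarrow> y \<in> W \<Longrightarrow> E x y \<Longrightarrow> F x y) \<Longrightarrow> dens E \<le> dens F"
  unfolding dens_def by (intro av_mono) auto

lemma dens_disj: "dens (\<lambda>x y. E x y \<or> F x y) \<le> dens E + dens F"
  unfolding dens_def av_add[symmetric] by (intro av_mono) auto

lemma dens_swap: "dens (\<lambda>x y. E y x) = dens E"
  unfolding dens_def by (rule av_swap)

lemma dens_fst: "dens (\<lambda>x y. x \<in> X) = mu X"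
  by (simp add: dens_def mu_def)

lemma dens_snd: "dens (\<lambda>x y. y \<in> X) = mu X"
  by (simp add: dens_def mu_def)

definition wrong_density :: "('a \<Rightarrow> 'a \<Rightarrow> bool) \<Rightarrow> ('a \<Rightarrow> part) \<Rightarrow> real" where
  "wrong_density adj f = dens (wrong adj f)"

end

context graph begin

lemma le_max_edge:
  assumes max: "\<And>u v. u \<in> W \<Longrightarrow> v \<in> W \<Longrightarrow> adj u v \<Longrightarrow> Psi u v \<le> Psi x y"
  shows "8 * total \<le> Psi x y"
    and "8 * total \<le> (1 - mu (D x y)) * Psi x y
      + 27 / 64 * (R x y + mu (far x y - D x y) * mu (D x y)) + 8 * inside (D x y)"
proof -
  have 1: "inside Q \<le> Psi x y / 8 * mu Q" for Q using inside_le[OF max] by simp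
  have "mu UNIV = 1" by (simp add: mu_def)
  then show "8 * total \<le> Psi x y" using 1[of UNIV] by (simp add: total_inside_UNIV)
  have "inside (- D x y) \<le> Psi x y / 8 * (1 - mu (D x y))" using 1[of "- D x y"] by (simp only: mu_compl)
  then show "8 * total \<le> (1 - mu (D x y)) * Psi x y
      + 27 / 64 * (R x y + mu (far x y - D x y) * mu (D x y)) + 8 * inside (D x y)"
    using total_le_split[of x y] by (simp add: algebra_simps)
qed

lemma R_nonneg [simp]: "0 \<le> R x y" unfolding R_def by (intro av_nonneg) simp

lemma R_le_1: "R x y \<le> 1"
  unfolding R_def by (rule av_le_const) (simp add: r_def mult_le_one)

text \<open>The constant \<open>16\<close> combines \<open>total = 2 * emb_density\<close> with the factor \<open>8\<close> of \<open>inside_le\<close>.\<close>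

theorem emb_density_le: "16 * emb_density adj \<le> Lam alpha"
proof (cases "\<exists>u\<in>W. \<exists>v\<in>W. adj u v")
  case True
  then obtain x y where max: "\<And>u v. u \<in> W \<Longrightarrow> v \<in> W \<Longrightarrow> adj u v \<Longrightarrow> Psi u v \<le> Psi x y"
    using obtain_max_edge by metis
  have "8 * total \<le> Lam alpha"
    by (rule master_inequality(2)[OF mu_nonneg mu_nonneg mu_nonneg R_nonneg mu_far_D Psi_le
          le_max_edge[OF max] inside_D_growth])
  then show ?thesis by (simp add: total_eq)
next
  case False
  then have "emb_density adj = av (\<lambda>x. av (\<lambda>y. 0))"
    unfolding emb_density_def by (intro av_cong) (auto simp: extension_density_nonadj)
  then show ?thesis using Lam_alpha_lower by simp
qed

definition ed :: "'a set \<Rightarrow> 'a set \<Rightarrow> real" where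
  "ed X Y = dens (\<lambda>x y. x \<in> X \<and> y \<in> Y \<and> adj x y)"

definition ned :: "'a set \<Rightarrow> 'a set \<Rightarrow> real" where
  "ned X Y = dens (\<lambda>x y. x \<in> X \<and> y \<in> Y \<and> \<not> adj x y)"

lemma ed_nonneg [simp]: "0 \<le> ed X Y" by (simp add: ed_def)
lemma ned_nonneg [simp]: "0 \<le> ned X Y" by (simp add: ned_def)

lemma extension_density_loss:
  fixes x y
  defines "A \<equiv> nb y - nb x" and "B \<equiv> nb x - nb y"
  shows "extension_density adj x y + mu (far x y) * mu B * ned A B \<le> mu (far x y) * mu A * (mu B)\<^sup>2"
    and "extension_density adj x y + mu (far x y) * mu A * ed B B \<le> mu (far x y) * mu A * (mu B)\<^sup>2"
proof -
  have "extension_density adj x y \<le> av (\<lambda>v. av (\<lambda>a. av (\<lambda>b. av (\<lambda>b'. of_bool (v \<in> far x y) *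
      ((of_bool (a \<in> A) * of_bool (b \<in> B) - of_bool (a \<in> A \<and> b \<in> B \<and> \<not> adj a b)) * of_bool (b' \<in> B))))))"
    unfolding extension_density_def A_def B_def
    by (intro av_mono) (auto simp: emb_def far_def nb_def adj_commute)
  also have "\<dots> = mu (far x y) * ((mu A * mu B - ned A B) * mu B)"
    by (simp add: av_diff mu_def ned_def dens_def)
  finally show "extension_density adj x y + mu (far x y) * mu B * ned A B \<le> mu (far x y) * mu A * (mu B)\<^sup>2"
    by (simp add: algebra_simps power2_eq_square)
  have "extension_density adj x y \<le> av (\<lambda>v. av (\<lambda>a. av (\<lambda>b. av (\<lambda>b'. of_bool (v \<in> far x y) *
      (of_bool (a \<in> A) * (of_bool (b \<in> B) * of_bool (b' \<in> B) - of_bool (b \<in> B \<and> b' \<in> B \<and> adj b b')))))))"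
    unfolding extension_density_def A_def B_def
    by (intro av_mono) (auto simp: emb_def far_def nb_def adj_commute)
  also have "\<dots> = mu (far x y) * (mu A * (mu B * mu B - ed B B))"
    by (simp add: av_diff mu_def ed_def dens_def)
  finally show "extension_density adj x y + mu (far x y) * mu A * ed B B \<le> mu (far x y) * mu A * (mu B)\<^sup>2"
    by (simp add: algebra_simps power2_eq_square)
qed

text \<open>How far the edge \<open>x y\<close> is from lying in all copies that its neighbourhoods allow. A small loss makes the
  private neighbourhoods nearly independent and nearly completely joined to each other (\<open>loss_ge\<close>).\<close>

definition loss :: "'a \<Rightarrow> 'a \<Rightarrow> real" where
  "loss x y = (1 - mu (nb x \<union> nb y)) * (mu (nb y - nb x) * mu (nb x - nb y) * (mu (nb y - nb x) + mu (nb x - nb y)))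
     - edge_density x y"

lemma mu_far: "mu (far x y) = 1 - mu (nb x \<union> nb y)"
  unfolding far_def by (rule mu_compl)

lemma far_commute: "far y x = far x y"
  by (auto simp: far_def)

lemma loss_ge:
  fixes x y
  defines "A \<equiv> nb y - nb x" and "B \<equiv> nb x - nb y" and "c \<equiv> mu (far x y)"
  shows "c * mu B * ned A B \<le> loss x y" "c * mu A * ed B B \<le> loss x y" "c * mu B * ed A A \<le> loss x y"
proof -
  note 1 = extension_density_loss[of x y, folded A_def B_def, folded c_def]
  note 2 = extension_density_loss[of y x, folded A_def B_def, unfolded far_commute[of y x], folded c_def]
  have l: "loss x y = (c * mu A * (mu B)\<^sup>2 - extension_density adj x y)
      + (c * mu B * (mu A)\<^sup>2 - extension_density adj y x)"
    by (simp add: loss_def edge_density_def A_def B_def c_def mu_far power2_eq_square algebra_simps)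
  have "0 \<le> c * mu B * ned A B" "0 \<le> c * mu A * ed B B" "0 \<le> c * mu B * ed A A" "0 \<le> c * mu A * ned B A"
    by (simp_all add: c_def)
  then show "c * mu B * ned A B \<le> loss x y" "c * mu A * ed B B \<le> loss x y" "c * mu B * ed A A \<le> loss x y"
    using 1 2 unfolding l by linarith+
qed

lemma loss_nonneg: "0 \<le> loss x y"
  using loss_ge(1)[of x y] order_trans[OF _ loss_ge(1)[of x y], of 0] by simp

lemma loss_le_1: "loss x y \<le> 1"
proof -
  let ?a = "mu (nb y - nb x)" and ?b = "mu (nb x - nb y)"
  have "(nb y - nb x) \<inter> (nb x - nb y) \<inter> W = {}" by blast
  then have ab: "?a + ?b \<le> 1"
    using mu_Un_disjoint mu_le_1[of "(nb y - nb x) \<union> (nb x - nb y)"] by metis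
  have m: "(1 - mu (nb x \<union> nb y)) * (?a * ?b * (?a + ?b)) \<le> 1 * (1 * 1)"
    using ab by (intro mult_mono mult_le_one mult_nonneg_nonneg) auto
  have "loss x y \<le> (1 - mu (nb x \<union> nb y)) * (?a * ?b * (?a + ?b))"
    unfolding loss_def by simp
  also note m
  finally show ?thesis by simp
qed

lemma union_parts: "mu (nb x \<union> nb y) = mu (nb y - nb x) + mu (nb x - nb y) + mu (nb x \<inter> nb y)"
  unfolding mu_def av_add[symmetric] by (rule av_cong) auto

lemma Psi_loss:
  fixes x y
  defines "a \<equiv> mu (nb y - nb x)" and "b \<equiv> mu (nb x - nb y)" and "t \<equiv> mu (nb x \<inter> nb y)"
  shows "Psi x y = 4 * ((1 - (a + b + t)) * (a * b * (a + b)) - loss x y) * (a + b + 2 * t)"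
  unfolding Psi_def dg_sum loss_def union_parts a_def b_def t_def by (simp add: algebra_simps)

text \<open>If no edge inside \<open>D x y\<close> came close to the value of an ideal small component, then \<open>inside_D_le\<close> would bound
  the contribution of \<open>D x y\<close> too well.\<close>

lemma obtain_small_edge:
  assumes big: "(mu (D x y) ^ 4 * (1 - mu (D x y)) - k) * mu (D x y)
      + 1 / 2 * (mu (far x y - D x y) * (mu (D x y))\<^sup>2 + 2 * mu (D x y) * R x y) < 8 * inside (D x y)"
    and g0: "0 \<le> mu (D x y) ^ 4 * (1 - mu (D x y)) - k"
  obtains u v where "u \<in> D x y" "v \<in> D x y" "u \<in> W" "v \<in> W" "adj u v"
    "mu (D x y) ^ 4 * (1 - mu (D x y)) - k
       + 1 / 4 * (mu (far x y - D x y) + r x y u + r x y v) * (dg u + dg v) < Psi u v"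
proof -
  note found = that
  show thesis
  proof (rule ccontr)
  assume none: "\<not> thesis"
  have *: "Psi u v \<le> mu (D x y) ^ 4 * (1 - mu (D x y)) - k
       + 1 / 4 * (mu (far x y - D x y) + r x y u + r x y v) * (dg u + dg v)"
    if "u \<in> D x y" "v \<in> D x y" "u \<in> W" "v \<in> W" "adj u v" for u v
    using found[OF that] none not_le by blast
  have "8 * inside (D x y) \<le> (mu (D x y) ^ 4 * (1 - mu (D x y)) - k) * mu (D x y)
      + 2 * (1 / 4) * (mu (far x y - D x y) * (mu (D x y))\<^sup>2 + 2 * mu (D x y) * R x y)"
    using * g0 by (intro inside_D_le) (auto simp: Psi_def)
  then show False using big by simp
  qed
qed

text \<open>\<open>A\<close> and \<open>B\<close> are the private neighbourhoods of the maximal edge and \<open>B'\<close> is one of those of the edge inside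
  \<open>D x y\<close>; all vertices that are left over join the remaining part.\<close>

definition assign :: "'a set \<Rightarrow> 'a set \<Rightarrow> 'a set \<Rightarrow> 'a \<Rightarrow> part" where
  "assign A B B' z = (if z \<in> A then (True, True) else if z \<in> B then (True, False)
     else if z \<in> B' then (False, False) else (False, True))"

text \<open>A wrong pair meets the leftover vertices, the common neighbours or the exceptional vertices, is an edge that
  crosses between the components, or is a defect inside one of the two bipartite graphs.\<close>

lemma assignment_wrong_le:
  fixes x y u v
  defines "A \<equiv> nb y - nb x" and "B \<equiv> nb x - nb y" and "A' \<equiv> nb v - nb u" and "B' \<equiv> nb u - nb v"
    and "T \<equiv> nb x \<inter> nb y" and "G \<equiv> far x y - D x y"
  defines "Z \<equiv> - (A \<union> B \<union> A' \<union> B')"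
  shows "wrong_density adj (assign A B B') \<le> 2 * mu Z + ed A A + ed B B + 2 * ned A B
     + 2 * mu T + 2 * mu G + 2 * R x y + ed A' A' + ed B' B' + 2 * ned A' B'"
proof -
  let ?P = "nb x \<union> nb y" and ?D = "D x y"
  have AB: "A \<inter> B = {}" "A' \<inter> B' = {}" by (auto simp: A_def B_def A'_def B'_def)
  have inP: "z \<in> ?P" if "z \<in> A \<or> z \<in> B" for z using that by (auto simp: A_def B_def)
  have kinds: "z \<in> A \<or> z \<in> B \<or> z \<in> T \<or> z \<in> G \<or> z \<in> ?D" for z
    by (auto simp: A_def B_def T_def G_def far_def)
  have nAB: "z \<notin> A \<and> z \<notin> B" if "z \<in> ?D" for z
    using that by (auto simp: A_def B_def D_def far_def)
  have nbc: "z' \<in> nb z \<longleftrightarrow> adj z z'" for z z' by (simp add: nb_def)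
  have "wrong_density adj (assign A B B') \<le> dens (\<lambda>z z'. z \<in> Z \<or> z' \<in> Z
      \<or> (z \<in> A \<and> z' \<in> A \<and> adj z z') \<or> (z \<in> B \<and> z' \<in> B \<and> adj z z')
      \<or> (z \<in> A \<and> z' \<in> B \<and> \<not> adj z z') \<or> (z' \<in> A \<and> z \<in> B \<and> \<not> adj z' z)
      \<or> z \<in> T \<or> z' \<in> T \<or> z \<in> G \<or> z' \<in> G
      \<or> (z \<in> ?D \<and> z' \<in> nb z \<inter> ?P) \<or> (z' \<in> ?D \<and> z \<in> nb z' \<inter> ?P)
      \<or> (z \<in> A' \<and> z' \<in> A' \<and> adj z z') \<or> (z \<in> B' \<and> z' \<in> B' \<and> adj z z')
      \<or> (z \<in> A' \<and> z' \<in> B' \<and> \<not> adj z z') \<or> (z' \<in> A' \<and> z \<in> B' \<and> \<not> adj z' z))"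
    unfolding wrong_density_def
  proof (rule dens_mono)
    fix z z' assume w: "wrong adj (assign A B B') z z'"
    let ?goal = "z \<in> Z \<or> z' \<in> Z
      \<or> (z \<in> A \<and> z' \<in> A \<and> adj z z') \<or> (z \<in> B \<and> z' \<in> B \<and> adj z z')
      \<or> (z \<in> A \<and> z' \<in> B \<and> \<not> adj z z') \<or> (z' \<in> A \<and> z \<in> B \<and> \<not> adj z' z)
      \<or> z \<in> T \<or> z' \<in> T \<or> z \<in> G \<or> z' \<in> G
      \<or> (z \<in> ?D \<and> z' \<in> nb z \<inter> ?P) \<or> (z' \<in> ?D \<and> z \<in> nb z' \<inter> ?P)
      \<or> (z \<in> A' \<and> z' \<in> A' \<and> adj z z') \<or> (z \<in> B' \<and> z' \<in> B' \<and> adj z z')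
      \<or> (z \<in> A' \<and> z' \<in> B' \<and> \<not> adj z z') \<or> (z' \<in> A' \<and> z \<in> B' \<and> \<not> adj z' z)"
    consider "z \<in> T \<or> z' \<in> T \<or> z \<in> G \<or> z' \<in> G \<or> z \<in> Z \<or> z' \<in> Z"
      | "z \<in> A \<or> z \<in> B" "z' \<in> A \<or> z' \<in> B"
      | "z \<in> A \<or> z \<in> B" "z' \<in> ?D" | "z \<in> ?D" "z' \<in> A \<or> z' \<in> B"
      | "z \<in> ?D" "z' \<in> ?D" "z \<notin> Z" "z' \<notin> Z"
      using kinds[of z] kinds[of z'] by blast
    then show ?goal
    proof cases
      case 1 then show ?thesis by (elim disjE) simp_all
    next
      case 2
      then have "(z \<in> A \<and> z' \<in> A \<and> adj z z') \<or> (z \<in> B \<and> z' \<in> B \<and> adj z z')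
          \<or> (z \<in> A \<and> z' \<in> B \<and> \<not> adj z z') \<or> (z' \<in> A \<and> z \<in> B \<and> \<not> adj z' z)"
        using w AB adj_commute[of z z']
        by (auto simp: wrong_def assign_def partner_def split: if_splits)
      then show ?thesis by (elim disjE) simp_all
    next
      case 3
      then have "adj z z'" using w AB nAB[of z']
        by (auto simp: wrong_def assign_def partner_def split: if_splits)
      then have "z' \<in> ?D \<and> z \<in> nb z' \<inter> ?P" using 3 inP[of z] nbc sym by blast
      then show ?thesis by simp
    next
      case 4
      then have "adj z z'" using w AB nAB[of z]
        by (auto simp: wrong_def assign_def partner_def split: if_splits)
      then have "z \<in> ?D \<and> z' \<in> nb z \<inter> ?P" using 4 inP[of z'] nbc by blast
      then show ?thesis by simp
    next
      case 5
      then have "(z \<in> A' \<or> z \<in> B')" "(z' \<in> A' \<or> z' \<in> B')" using nAB by (auto simp: Z_def)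
      then have "(z \<in> A' \<and> z' \<in> A' \<and> adj z z') \<or> (z \<in> B' \<and> z' \<in> B' \<and> adj z z')
          \<or> (z \<in> A' \<and> z' \<in> B' \<and> \<not> adj z z') \<or> (z' \<in> A' \<and> z \<in> B' \<and> \<not> adj z' z)"
        using w AB nAB[OF 5(1)] nAB[OF 5(2)] adj_commute[of z z']
        by (auto simp: wrong_def assign_def partner_def split: if_splits)
      then show ?thesis by (elim disjE) simp_all
    qed
  qed
  also have "\<dots> \<le> mu Z + (mu Z + (ed A A + (ed B B + (ned A B + (ned A B
     + (mu T + (mu T + (mu G + (mu G + (R x y + (R x y + (ed A' A' + (ed B' B' + (ned A' B' + ned A' B'))))))))))))))"
  proof -
    have R1: "dens (\<lambda>z z'. z \<in> ?D \<and> z' \<in> nb z \<inter> ?P) = R x y"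
    proof -
      have "dens (\<lambda>z z'. z \<in> ?D \<and> z' \<in> nb z \<inter> ?P)
          = av (\<lambda>z. av (\<lambda>z'. of_bool (z \<in> ?D) * of_bool (z' \<in> nb z \<inter> ?P)))"
        unfolding dens_def by (intro av_cong) simp
      then show ?thesis by (simp only: av_cmult R_def r_def mu_def)
    qed
    have R2: "dens (\<lambda>z z'. z' \<in> ?D \<and> z \<in> nb z' \<inter> ?P) = R x y"
      using R1 by (subst dens_swap)
    have N2: "dens (\<lambda>z z'. z' \<in> X \<and> z \<in> Y \<and> \<not> adj z' z) = ned X Y" for X Y
      unfolding ned_def by (rule dens_swap)
    show ?thesis
      by (intro order.trans[OF dens_disj] add_mono) (simp_all only: dens_fst dens_snd R1 R2 N2 ed_def ned_def order_refl)
  qed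
  finally show ?thesis by simp
qed

end

section \<open>Stability\<close>

lemma fifth_power_rest_lipschitz:
  fixes x y :: real
  assumes "0 \<le> x" "x \<le> 1" "0 \<le> y" "y \<le> 1"
  shows "\<bar>x ^ 5 * (1 - x) - y ^ 5 * (1 - y)\<bar> \<le> 11 * \<bar>x - y\<bar>"
proof -
  have 1: "\<bar>x ^ m - y ^ m\<bar> \<le> real m * \<bar>x - y\<bar>" for m
    using norm_power_diff[of x y m] assms by simp
  have "x ^ 5 * (1 - x) - y ^ 5 * (1 - y) = (x ^ 5 - y ^ 5) - (x ^ 6 - y ^ 6)"
    by (simp add: power_def numeral_eq_Suc algebra_simps)
  then show ?thesis using 1[of 5] 1[of 6] by simp
qed

context graph begin

lemma inside_nonneg [simp]: "0 \<le> inside Q"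
  unfolding inside_def by (intro av_nonneg mult_nonneg_nonneg) auto

lemma inside_le_1: "inside Q \<le> 1"
proof -
  have "edge_density x y \<le> 1" for x y using edge_density_le_const[of x y] by simp
  then show ?thesis unfolding inside_def by (intro av_le_const mult_le_one) auto
qed

lemma exists_edge: assumes "0 < emb_density adj" obtains u v where "u \<in> W" "v \<in> W" "adj u v"
proof (rule ccontr)
  assume "\<not> thesis"
  then have "emb_density adj = av (\<lambda>x. av (\<lambda>y. 0))"
    using that unfolding emb_density_def by (intro av_cong) (metis extension_density_nonadj)
  with assms show False by simp
qed

text \<open>The near equality case of \<open>master_inequality\<close> applied to the maximal edge. The premise \<open>k1(3)\<close> is the
  conclusion of \<open>near_master_equality\<close>.\<close>

lemma obtain_near_extremal_edge:
  assumes "0 < e1"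
    and k1: "0 < k1" "k1 \<le> Lam alpha - 67 / 1000"
      "\<And>p b d R psi yD. \<lbrakk>0 \<le> p; 0 \<le> b; 0 \<le> d; 0 \<le> R; R \<le> 1; p + b + d = 1; 0 \<le> psi; psi \<le> 1; 0 \<le> yD; yD \<le> 8;
        psi \<le> p ^ 4 * (d + 3 / 16 * b) - 13 / 8 * p ^ 3 * R;
        Lam alpha - k1 \<le> psi; Lam alpha - k1 \<le> (1 - d) * psi + 27 / 64 * (R + b * d) + yD;
        yD \<le> d ^ 5 * (1 - d) + 1 / 2 * (b * d\<^sup>2 + 2 * d * R); d \<le> 21 / 100\<rbrakk>
      \<Longrightarrow> b + R + \<bar>d - alpha\<bar> + \<bar>psi - (1 - alpha) ^ 4 * alpha\<bar> + \<bar>yD - alpha ^ 5 * (1 - alpha)\<bar> < e1"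
    and large: "Lam alpha - k1 \<le> 16 * emb_density adj"
  obtains x y where "mu (far x y - D x y) + R x y + \<bar>mu (D x y) - alpha\<bar> + \<bar>Psi x y - (1 - alpha) ^ 4 * alpha\<bar>
      + \<bar>8 * inside (D x y) - alpha ^ 5 * (1 - alpha)\<bar> < e1"
proof -
  have "0 < emb_density adj" using large k1(2) by linarith
  then obtain u v where "u \<in> W" "v \<in> W" "adj u v" by (rule exists_edge)
  then obtain x y where max: "\<And>u v. u \<in> W \<Longrightarrow> v \<in> W \<Longrightarrow> adj u v \<Longrightarrow> Psi u v \<le> Psi x y"
    using obtain_max_edge by metis
  let ?p = "mu (nb x \<union> nb y)" and ?b = "mu (far x y - D x y)" and ?d = "mu (D x y)"
  have y: "Lam alpha - k1 \<le> 8 * total" using large by (simp add: total_eq)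
  note le = le_max_edge[OF max]
  have d: "?d \<le> 21 / 100"
    using master_inequality(1)[OF mu_nonneg mu_nonneg mu_nonneg R_nonneg mu_far_D Psi_le le inside_D_growth]
      y k1(2) by linarith
  have "Psi x y \<le> ?p ^ 4 * (?d + 3 / 16 * ?b)"
  proof -
    have "0 \<le> 13 / 8 * ?p ^ 3 * R x y" by simp
    then show ?thesis using Psi_le[of x y] by linarith
  qed
  also have "\<dots> \<le> 1 * 1"
  proof -
    have "?d + 3 / 16 * ?b \<le> 1"
      using mu_far_D[of x y] mu_nonneg[of "nb x \<union> nb y"] mu_nonneg[of "far x y - D x y"] by linarith
    then show ?thesis by (intro mult_mono power_le_one) auto
  qed
  finally have psi1: "Psi x y \<le> 1" by simp
  have "?b + R x y + \<bar>?d - alpha\<bar> + \<bar>Psi x y - (1 - alpha) ^ 4 * alpha\<bar>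
      + \<bar>8 * inside (D x y) - alpha ^ 5 * (1 - alpha)\<bar> < e1"
  proof (rule k1(3)[OF mu_nonneg mu_nonneg mu_nonneg R_nonneg R_le_1 mu_far_D Psi_nonneg psi1])
    show "8 * inside (D x y) \<le> ?d ^ 5 * (1 - ?d) + 1 / 2 * (?b * ?d\<^sup>2 + 2 * ?d * R x y)"
      using inside_D_growth[OF growth_const_quarter[OF mu_nonneg]] d by simp
    show "8 * inside (D x y) \<le> 8" using inside_le_1 by simp
  qed (use le y d Psi_le[of x y] in auto)
  then show ?thesis by (rule that)
qed

text \<open>All error terms of \<open>assignment_wrong_le\<close> are small: the defects inside the components are bounded by the
  losses of the two edges, divided by factors that are at least \<open>1 / 25\<close>.\<close>

lemma stability_at_edges:
  fixes x y u v and e :: real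
  defines "A \<equiv> nb y - nb x" and "B \<equiv> nb x - nb y" and "A' \<equiv> nb v - nb u" and "B' \<equiv> nb u - nb v"
  assumes e: "0 < e" "e \<le> 1 / 100"
    and exc: "mu (far x y - D x y) + R x y \<le> e"
    and big: "\<bar>mu A - (1 - alpha) / 2\<bar> + \<bar>mu B - (1 - alpha) / 2\<bar> + mu (nb x \<inter> nb y) + loss x y < e"
    and small: "\<bar>mu A' - alpha / 2\<bar> + \<bar>mu B' - alpha / 2\<bar> + mu (nb u \<inter> nb v) + loss u v
      + (mu (far x y - D x y) + r x y u + r x y v) < e"
  shows "wrong_density adj (assign A B B') \<le> 300 * e"
    and "\<bar>mu {z. assign A B B' z = i} - share i\<bar> \<le> 300 * e"
proof -
  let ?S = "A \<union> B"
  define Z where "Z = - (A \<union> B \<union> A' \<union> B')"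
  have quot: "X \<le> 25 * e" if "s * X \<le> l" "l \<le> e" "1 / 25 \<le> s" "0 \<le> X" for s X l :: real
  proof -
    have "1 / 25 * X \<le> s * X" using that by (intro mult_right_mono) auto
    then show ?thesis using that by simp
  qed
  have prod: "1 / 25 \<le> c * s" if "1 / 10 \<le> c" "4 / 10 \<le> s" for c s :: real
    using mult_mono[OF that] that by simp
  have prod': "1 / 25 \<le> c * s" if "8 / 10 \<le> c" "7 / 100 \<le> s" for c s :: real
    using mult_mono[OF that] that by simp
  note nn = mu_nonneg[of "nb x \<inter> nb y"] mu_nonneg[of "nb u \<inter> nb v"] loss_nonneg[of x y] loss_nonneg[of u v]
    r_nonneg[of x y u] r_nonneg[of x y v] mu_nonneg[of "far x y - D x y"] R_nonneg[of x y]
  have A: "\<bar>mu A - (1 - alpha) / 2\<bar> \<le> e" and B: "\<bar>mu B - (1 - alpha) / 2\<bar> \<le> e"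
    and A': "\<bar>mu A' - alpha / 2\<bar> \<le> e" and B': "\<bar>mu B' - alpha / 2\<bar> \<le> e"
    and T: "mu (nb x \<inter> nb y) \<le> e" and T': "mu (nb u \<inter> nb v) \<le> e"
    and l: "loss x y \<le> e" and l': "loss u v \<le> e" and G: "mu (far x y - D x y) \<le> e" and R: "R x y \<le> e"
    and w: "r x y u + r x y v \<le> e"
    using exc big small nn by linarith+
  note lo = abs_le_D1[OF A] abs_le_D2[OF A] abs_le_D1[OF B] abs_le_D2[OF B]
    abs_le_D1[OF A'] abs_le_D2[OF A'] abs_le_D1[OF B'] abs_le_D2[OF B']
  have A4: "4 / 10 \<le> mu A" "4 / 10 \<le> mu B" using lo e alpha_bounds by (simp_all add: diff_divide_distrib)
  have A7: "7 / 100 \<le> mu A'" "7 / 100 \<le> mu B'" using lo e alpha_bounds by (simp_all add: diff_divide_distrib)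
  have c: "1 / 10 \<le> mu (far x y)"
    unfolding mu_far union_parts A_def[symmetric] B_def[symmetric] using lo T e alpha_bounds by (simp add: diff_divide_distrib)
  have c': "8 / 10 \<le> mu (far u v)"
    unfolding mu_far union_parts A'_def[symmetric] B'_def[symmetric] using lo T' e alpha_bounds by (simp add: diff_divide_distrib)
  note L = loss_ge[of x y, folded A_def B_def] and L' = loss_ge[of u v, folded A'_def B'_def]
  have bigs: "ned A B \<le> 25 * e" "ed B B \<le> 25 * e" "ed A A \<le> 25 * e"
    by (rule quot[OF L(1) l prod[OF c A4(2)] ned_nonneg] quot[OF L(2) l prod[OF c A4(1)] ed_nonneg]
       quot[OF L(3) l prod[OF c A4(2)] ed_nonneg])+
  have smalls: "ned A' B' \<le> 25 * e" "ed B' B' \<le> 25 * e" "ed A' A' \<le> 25 * e"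
    by (rule quot[OF L'(1) l' prod'[OF c' A7(2)] ned_nonneg] quot[OF L'(2) l' prod'[OF c' A7(1)] ed_nonneg]
       quot[OF L'(3) l' prod'[OF c' A7(2)] ed_nonneg])+
  have AB: "A \<inter> B \<inter> W = {}" "A' \<inter> B' \<inter> W = {}" by (auto simp: A_def B_def A'_def B'_def)
  have leak: "mu (X \<inter> ?S) \<le> r x y u + r x y v" if "X \<subseteq> A' \<union> B'" for X
  proof -
    have "mu (X \<inter> ?S) \<le> mu ((nb u \<inter> (nb x \<union> nb y)) \<union> (nb v \<inter> (nb x \<union> nb y)))"
      using that by (intro mu_mono) (auto simp: A_def B_def A'_def B'_def)
    also have "\<dots> \<le> r x y u + r x y v" unfolding r_def by (rule mu_Un_le)
    finally show ?thesis .
  qed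
  have S: "mu ?S = mu A + mu B" by (rule mu_Un_disjoint[OF AB(1)])
  have S': "mu (A' \<union> B' - ?S) = mu A' + mu B' - mu ((A' \<union> B') \<inter> ?S)"
    using mu_split[of "A' \<union> B'" ?S] mu_Un_disjoint[OF AB(2)] by simp
  have "mu (?S \<union> (A' \<union> B' - ?S)) = mu ?S + mu (A' \<union> B' - ?S)" by (rule mu_Un_disjoint) auto
  moreover have "Z = - (?S \<union> (A' \<union> B' - ?S))" by (auto simp: Z_def)
  ultimately have "mu Z = 1 - (mu ?S + mu (A' \<union> B' - ?S))" by (simp only: mu_compl)
  then have Z: "mu Z \<le> 5 * e"
    using S S' leak[of "A' \<union> B'"] lo w by (simp add: diff_divide_distrib)
  have "wrong_density adj (assign A B B') \<le> 2 * mu Z + ed A A + ed B B + 2 * ned A B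
     + 2 * mu (nb x \<inter> nb y) + 2 * mu (far x y - D x y) + 2 * R x y + ed A' A' + ed B' B' + 2 * ned A' B'"
    unfolding Z_def A_def B_def A'_def B'_def by (rule assignment_wrong_le)
  then show "wrong_density adj (assign A B B') \<le> 300 * e"
    using Z bigs smalls T G R e by linarith
  have "mu (B' - ?S) = mu B' - mu (B' \<inter> ?S)" using mu_split[of B' ?S] by simp
  then have BS: "\<bar>mu (B' - ?S) - alpha / 2\<bar> \<le> 2 * e"
    using leak[OF Un_upper2] w B' mu_nonneg[of "B' \<inter> ?S"] e by linarith
  have "mu (?S \<union> (B' - ?S)) = mu ?S + mu (B' - ?S)" by (rule mu_Un_disjoint) auto
  then have rest: "mu (- (?S \<union> (B' - ?S))) = 1 - (mu A + mu B) - mu (B' - ?S)"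
    using S by (simp only: mu_compl)
  have rest': "\<bar>1 - (mu A + mu B) - mu (B' - ?S) - alpha / 2\<bar> \<le> 300 * e"
    using lo abs_le_D1[OF BS] abs_le_D2[OF BS] e by (simp add: abs_le_iff diff_divide_distrib)
  obtain s c where i: "i = (s, c)" by (cases i)
  have "{z. assign A B B' z = i} = (if s then (if c then A else B - A) else (if c then - (?S \<union> (B' - ?S)) else B' - ?S))"
    by (auto simp: assign_def i)
  moreover have "B - A = B" by (auto simp: A_def B_def)
  ultimately show "\<bar>mu {z. assign A B B' z = i} - share i\<bar> \<le> 300 * e"
    using A B BS rest rest' e by (auto simp: share_def i)
qed

end

text \<open>The constants are chosen backwards: first the precision needed at the edge inside \<open>D x y\<close>, then the precision
  at the maximal edge that produces it.\<close>

theorem stability: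
  fixes e :: real
  assumes "0 < e"
  shows "\<exists>k>0. \<forall>(W :: 'a set) adj. graph W adj \<longrightarrow> Lam alpha - k \<le> 16 * vertices.emb_density W adj \<longrightarrow>
    (\<exists>f. vertices.wrong_density W adj f \<le> e \<and> (\<forall>i. \<bar>vertices.mu W {x. f x = i} - share i\<bar> \<le> e))"
proof -
  define e2 where "e2 = min (e / 300) (1 / 100)"
  have e2: "0 < e2" "e2 \<le> 1 / 100" "300 * e2 \<le> e" using assms by (auto simp: e2_def)
  have q: "0 < 1 - alpha" "1 - alpha < 1" using alpha_bounds by auto
  obtain k2 where k2: "0 < k2"
    "\<And>a b t I. \<lbrakk>0 \<le> a; 0 \<le> b; 0 \<le> t; 0 \<le> I; I \<le> 1; a + b + t \<le> 1; \<bar>a + b + t - (1 - alpha)\<bar> \<le> k2;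
        (1 - alpha) ^ 4 * (1 - (1 - alpha)) - k2 \<le> 4 * ((1 - (a + b + t)) * (a * b * (a + b)) - I) * (a + b + 2 * t)\<rbrakk>
      \<Longrightarrow> \<bar>a - (1 - alpha) / 2\<bar> + \<bar>b - (1 - alpha) / 2\<bar> + t + I < e2"
    using near_tight_big[OF e2(1) q] by blast
  obtain k3 where k3: "0 < k3"
    "\<And>a b t I w d. \<lbrakk>0 \<le> a; 0 \<le> b; 0 \<le> t; 0 \<le> I; I \<le> 1; 0 \<le> w; w \<le> 3; a + b + t \<le> 1; a + b + t \<le> d + w;
        0 \<le> d; \<bar>d - alpha\<bar> \<le> k3;
        d ^ 4 * (1 - d) - k3 + 1 / 4 * w * (a + b + 2 * t)
          \<le> 4 * ((1 - (a + b + t)) * (a * b * (a + b)) - I) * (a + b + 2 * t)\<rbrakk>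
      \<Longrightarrow> \<bar>a - alpha / 2\<bar> + \<bar>b - alpha / 2\<bar> + t + I + w < e2"
    using near_tight_small[OF e2(1)] by blast
  define nu where "nu = min k3 (1 / 100000)"
  have nu: "0 < nu" "nu \<le> k3" "nu \<le> 1 / 100000" using k3(1) by (auto simp: nu_def)
  \<comment> \<open>The gain \<open>nu * mu (D x y)\<close>, with \<open>mu (D x y) \<ge> 1 / 10\<close>, has to outweigh about \<open>14 * e1\<close>.\<close>
  define e1 where "e1 = min (min k2 nu) e2 / 200"
  have e1: "0 < e1" "e1 \<le> k2" "e1 \<le> nu / 200" "e1 \<le> e2" "e1 \<le> 1 / 100"
    using k2(1) nu e2 by (auto simp: e1_def)
  obtain k where k: "0 < k"
    "\<And>p b d R psi yD. \<lbrakk>0 \<le> p; 0 \<le> b; 0 \<le> d; 0 \<le> R; R \<le> 1; p + b + d = 1; 0 \<le> psi; psi \<le> 1; 0 \<le> yD; yD \<le> 8;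
        psi \<le> p ^ 4 * (d + 3 / 16 * b) - 13 / 8 * p ^ 3 * R;
        Lam alpha - k \<le> psi; Lam alpha - k \<le> (1 - d) * psi + 27 / 64 * (R + b * d) + yD;
        yD \<le> d ^ 5 * (1 - d) + 1 / 2 * (b * d\<^sup>2 + 2 * d * R); d \<le> 21 / 100\<rbrakk>
      \<Longrightarrow> b + R + \<bar>d - alpha\<bar> + \<bar>psi - (1 - alpha) ^ 4 * alpha\<bar> + \<bar>yD - alpha ^ 5 * (1 - alpha)\<bar> < e1"
    using near_master_equality[OF e1(1)] by blast
  define k1 where "k1 = min k (Lam alpha - 67 / 1000)"
  have k1: "0 < k1" "k1 \<le> Lam alpha - 67 / 1000" "k1 \<le> k" using k(1) Lam_alpha_lower by (auto simp: k1_def)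
  show ?thesis
  proof (intro exI[of _ k1] conjI allI impI)
    fix W :: "'a set" and adj
    assume "graph W adj" and large: "Lam alpha - k1 \<le> 16 * vertices.emb_density W adj"
    then interpret graph W adj by simp
    obtain x y where xy: "mu (far x y - D x y) + R x y + \<bar>mu (D x y) - alpha\<bar> + \<bar>Psi x y - (1 - alpha) ^ 4 * alpha\<bar>
      + \<bar>8 * inside (D x y) - alpha ^ 5 * (1 - alpha)\<bar> < e1"
    proof (rule obtain_near_extremal_edge[OF e1(1) k1(1,2) _ large])
      fix p b d R psi yD :: real
      assume "0 \<le> p" "0 \<le> b" "0 \<le> d" "0 \<le> R" "R \<le> 1" "p + b + d = 1" "0 \<le> psi" "psi \<le> 1" "0 \<le> yD" "yD \<le> 8"
        "psi \<le> p ^ 4 * (d + 3 / 16 * b) - 13 / 8 * p ^ 3 * R"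
        "Lam alpha - k1 \<le> psi" "Lam alpha - k1 \<le> (1 - d) * psi + 27 / 64 * (R + b * d) + yD"
        "yD \<le> d ^ 5 * (1 - d) + 1 / 2 * (b * d\<^sup>2 + 2 * d * R)" "d \<le> 21 / 100"
      with k1(3) show "b + R + \<bar>d - alpha\<bar> + \<bar>psi - (1 - alpha) ^ 4 * alpha\<bar> + \<bar>yD - alpha ^ 5 * (1 - alpha)\<bar> < e1"
        by - (rule k(2)[of p], (assumption | linarith)+)
    qed
    let ?b = "mu (far x y - D x y)" and ?d = "mu (D x y)"
    have b: "?b \<le> e1" and R: "R x y \<le> e1" and bR: "?b + R x y \<le> e1" and d: "\<bar>?d - alpha\<bar> \<le> e1"
      and bd: "?b + \<bar>?d - alpha\<bar> \<le> e1"
      and psi: "(1 - alpha) ^ 4 * alpha - e1 \<le> Psi x y"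
      and yD: "alpha ^ 5 * (1 - alpha) - e1 \<le> 8 * inside (D x y)"
      using xy R_nonneg[of x y] mu_nonneg[of "far x y - D x y"] by linarith+
    have big: "\<bar>mu (nb y - nb x) - (1 - alpha) / 2\<bar> + \<bar>mu (nb x - nb y) - (1 - alpha) / 2\<bar>
       + mu (nb x \<inter> nb y) + loss x y < e2"
    proof (rule k2(2)[OF mu_nonneg mu_nonneg mu_nonneg loss_nonneg loss_le_1])
      show "mu (nb y - nb x) + mu (nb x - nb y) + mu (nb x \<inter> nb y) \<le> 1"
        unfolding union_parts[symmetric] by simp
      show "\<bar>mu (nb y - nb x) + mu (nb x - nb y) + mu (nb x \<inter> nb y) - (1 - alpha)\<bar> \<le> k2"
        unfolding union_parts[symmetric] using mu_far_D[of x y] bd e1(2) mu_nonneg[of "far x y - D x y"] by linarith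
      show "(1 - alpha) ^ 4 * (1 - (1 - alpha)) - k2 \<le> 4 * ((1 - (mu (nb y - nb x) + mu (nb x - nb y) + mu (nb x \<inter> nb y)))
          * (mu (nb y - nb x) * mu (nb x - nb y) * (mu (nb y - nb x) + mu (nb x - nb y))) - loss x y)
          * (mu (nb y - nb x) + mu (nb x - nb y) + 2 * mu (nb x \<inter> nb y))"
        unfolding Psi_loss[symmetric] using psi e1(2) by simp
    qed
    have d10: "1 / 10 \<le> ?d" "?d \<le> 3 / 10" using d e1 alpha_bounds by linarith+
    have g0: "0 \<le> ?d ^ 4 * (1 - ?d) - nu"
    proof -
      have "(1 / 10) ^ 4 * (1 / 10) \<le> ?d ^ 4 * (1 - ?d)"
        using d10 by (intro mult_mono power_mono) auto
      then show ?thesis using nu by (simp add: power_divide)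
    qed
    obtain u v where uv: "u \<in> D x y" "v \<in> D x y" "u \<in> W" "v \<in> W" "adj u v"
      "?d ^ 4 * (1 - ?d) - nu + 1 / 4 * (?b + r x y u + r x y v) * (dg u + dg v) < Psi u v"
    proof (rule obtain_small_edge[OF _ g0])
      define X where "X = ?d ^ 5 * (1 - ?d)"
      have "\<bar>X - alpha ^ 5 * (1 - alpha)\<bar> \<le> 11 * \<bar>?d - alpha\<bar>"
        unfolding X_def using alpha_bounds by (intro fifth_power_rest_lipschitz) auto
      also have "\<dots> \<le> 11 * e1" using d by simp
      finally have "X - alpha ^ 5 * (1 - alpha) \<le> 11 * e1" by (rule abs_le_D1)
      then have X: "X \<le> alpha ^ 5 * (1 - alpha) + 11 * e1" by (simp only: diff_le_eq add.commute)
      have nd: "nu * (1 / 10) \<le> nu * ?d" using d10 nu by (intro mult_left_mono) auto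
      have bd2: "?b * ?d\<^sup>2 \<le> e1 * 1" using b e1(1) by (intro mult_mono power_le_one) auto
      have dR: "?d * R x y \<le> 1 * e1" using R e1(1) by (intro mult_mono) auto
      have "(?d ^ 4 * (1 - ?d) - nu) * ?d + 1 / 2 * (?b * ?d\<^sup>2 + 2 * ?d * R x y)
          = X - nu * ?d + 1 / 2 * (?b * ?d\<^sup>2) + ?d * R x y"
        by (simp add: X_def power_def numeral_eq_Suc algebra_simps)
      also have "\<dots> < 8 * inside (D x y)"
        using X nd bd2 dR yD e1(1,3) nu(1) by argo
      finally show "(?d ^ 4 * (1 - ?d) - nu) * ?d + 1 / 2 * (?b * ?d\<^sup>2 + 2 * ?d * R x y) < 8 * inside (D x y)" .
    qed
    have small: "\<bar>mu (nb v - nb u) - alpha / 2\<bar> + \<bar>mu (nb u - nb v) - alpha / 2\<bar>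
       + mu (nb u \<inter> nb v) + loss u v + (?b + r x y u + r x y v) < e2"
    proof (rule k3(2)[OF mu_nonneg mu_nonneg mu_nonneg loss_nonneg loss_le_1 _ _ _ _ mu_nonneg])
      show "0 \<le> ?b + r x y u + r x y v" by simp
      show "?b + r x y u + r x y v \<le> 3" unfolding r_def
        using mu_le_1[of "far x y - D x y"] mu_le_1[of "nb u \<inter> (nb x \<union> nb y)"] mu_le_1[of "nb v \<inter> (nb x \<union> nb y)"]
        by linarith
      show "mu (nb v - nb u) + mu (nb u - nb v) + mu (nb u \<inter> nb v) \<le> 1"
        unfolding union_parts[symmetric] by simp
      show "mu (nb v - nb u) + mu (nb u - nb v) + mu (nb u \<inter> nb v) \<le> ?d + (?b + r x y u + r x y v)"
        unfolding union_parts[symmetric] by (rule union_of_D_edge[OF uv(1,2)])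
      show "\<bar>?d - alpha\<bar> \<le> k3" using d e1(3) nu by linarith
      have "dg u + dg v = mu (nb v - nb u) + mu (nb u - nb v) + 2 * mu (nb u \<inter> nb v)"
        unfolding dg_sum union_parts by simp
      then show "?d ^ 4 * (1 - ?d) - k3 + 1 / 4 * (?b + r x y u + r x y v) * (mu (nb v - nb u) + mu (nb u - nb v) + 2 * mu (nb u \<inter> nb v))
        \<le> 4 * ((1 - (mu (nb v - nb u) + mu (nb u - nb v) + mu (nb u \<inter> nb v)))
          * (mu (nb v - nb u) * mu (nb u - nb v) * (mu (nb v - nb u) + mu (nb u - nb v))) - loss u v)
          * (mu (nb v - nb u) + mu (nb u - nb v) + 2 * mu (nb u \<inter> nb v))"
        unfolding Psi_loss[symmetric] using uv(6) nu(2) by simp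
    qed
    have exc: "?b + R x y \<le> e2" using bR e1(4) by linarith
    let ?f = "assign (nb y - nb x) (nb x - nb y) (nb u - nb v)"
    have "wrong_density adj ?f \<le> e" using stability_at_edges(1)[OF e2(1,2) exc big small] e2(3) by linarith
    moreover have "\<bar>mu {z. ?f z = i} - share i\<bar> \<le> e" for i
      using stability_at_edges(2)[OF e2(1,2) exc big small, of i] e2(3) by linarith
    ultimately show "\<exists>f. wrong_density adj f \<le> e \<and> (\<forall>i. \<bar>mu {x. f x = i} - share i\<bar> \<le> e)" by blast
  qed (rule k1(1))
qed

section \<open>Copies as functions on positions\<close>

text \<open>Positions follow the labels of \<open>F36\<close>: \<open>0, 1\<close> against \<open>2, 3, 5\<close>, with \<open>4\<close> isolated.\<close>

abbreviation pos :: "nat set" where "pos \<equiv> {..<6}"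

definition emb6 :: "('a \<Rightarrow> 'a \<Rightarrow> bool) \<Rightarrow> (nat \<Rightarrow> 'a) \<Rightarrow> bool" where
  "emb6 adj t \<longleftrightarrow> emb adj (t 0) (t 1) (t 2) (t 3) (t 5) (t 4)"

lemma pos_eq: "pos = {0, 1, 2, 3, 4, 5}" by auto

lemma sum_PiE_insert:
  fixes g :: "('i \<Rightarrow> 'a) \<Rightarrow> 'c :: comm_monoid_add"
  assumes "i \<notin> I"
  shows "(\<Sum>t\<in>PiE (insert i I) (\<lambda>_. W). g t) = (\<Sum>y\<in>W. \<Sum>t\<in>PiE I (\<lambda>_. W). g (t(i := y)))"
proof -
  have inj: "inj_on (\<lambda>(y, t). t(i := y)) (W \<times> PiE I (\<lambda>_. W))"
    using inj_combinator[OF assms, of "\<lambda>_. W"] by simp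
  show ?thesis
    unfolding PiE_insert_eq sum.reindex[OF inj] comp_def
    by (simp add: sum.cartesian_product case_prod_beta)
qed

context vertices begin

abbreviation n :: real where "n \<equiv> real (card W)"
abbreviation tuples :: "(nat \<Rightarrow> 'a) set" where "tuples \<equiv> PiE pos (\<lambda>_. W)"

text \<open>The probability that a uniformly random map from positions to vertices satisfies \<open>E\<close>. Tuples with repeated
  vertices are included, so that the positions are independent.\<close>

definition pr :: "((nat \<Rightarrow> 'a) \<Rightarrow> bool) \<Rightarrow> real" where
  "pr E = real (card {t \<in> tuples. E t}) / n ^ 6"

lemma n_pos [simp]: "0 < n" by (rule card_pos)

lemma finite_tuples [simp]: "finite tuples" using fin by (intro finite_PiE) auto

lemma pr_mono: "(\<And>t. t \<in> tuples \<Longrightarrow> E t \<Longrightarrow> F t) \<Longrightarrow> pr E \<le> pr F"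
  unfolding pr_def by (intro divide_right_mono of_nat_mono card_mono) auto

lemma pr_cong: "(\<And>t. t \<in> tuples \<Longrightarrow> E t \<longleftrightarrow> F t) \<Longrightarrow> pr E = pr F"
  using pr_mono[of E F] pr_mono[of F E] by (simp add: antisym)

lemma pr_union: "pr (\<lambda>t. E t \<or> F t) \<le> pr E + pr F"
proof -
  have "{t \<in> tuples. E t \<or> F t} = {t \<in> tuples. E t} \<union> {t \<in> tuples. F t}" by auto
  then have "card {t \<in> tuples. E t \<or> F t} \<le> card {t \<in> tuples. E t} + card {t \<in> tuples. F t}"
    by (simp add: card_Un_le)
  then have "real (card {t \<in> tuples. E t \<or> F t}) \<le> real (card {t \<in> tuples. E t}) + real (card {t \<in> tuples. F t})"
    by linarith
  then have "real (card {t \<in> tuples. E t \<or> F t}) / n ^ 6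
      \<le> (real (card {t \<in> tuples. E t}) + real (card {t \<in> tuples. F t})) / n ^ 6"
    by (intro divide_right_mono) auto
  then show ?thesis by (simp add: pr_def add_divide_distrib)
qed

lemma pr_disjoint:
  assumes "\<And>t. t \<in> tuples \<Longrightarrow> E t \<Longrightarrow> F t \<Longrightarrow> False"
  shows "pr (\<lambda>t. E t \<or> F t) = pr E + pr F"
proof -
  have "card {t \<in> tuples. E t \<or> F t} = card ({t \<in> tuples. E t} \<union> {t \<in> tuples. F t})"
    by (rule arg_cong[where f = card]) auto
  also have "\<dots> = card {t \<in> tuples. E t} + card {t \<in> tuples. F t}"
    using assms by (intro card_Un_disjoint) auto
  finally show ?thesis by (simp add: pr_def add_divide_distrib)
qed

lemma pr_split: "pr E = pr (\<lambda>t. E t \<and> F t) + pr (\<lambda>t. E t \<and> \<not> F t)"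
proof -
  have "pr E = pr (\<lambda>t. (E t \<and> F t) \<or> (E t \<and> \<not> F t))" by (rule pr_cong) auto
  then show ?thesis using pr_disjoint[of "\<lambda>t. E t \<and> F t" "\<lambda>t. E t \<and> \<not> F t"] by simp
qed

lemma pr_Ex: "finite X \<Longrightarrow> pr (\<lambda>t. \<exists>i\<in>X. E i t) \<le> (\<Sum>i\<in>X. pr (E i))"
proof (induction X rule: finite_induct)
  case empty
  then show ?case by (simp add: pr_def)
next
  case (insert i X)
  have "pr (\<lambda>t. \<exists>i\<in>insert i X. E i t) = pr (\<lambda>t. E i t \<or> (\<exists>i\<in>X. E i t))" by simp
  also have "\<dots> \<le> pr (E i) + pr (\<lambda>t. \<exists>i\<in>X. E i t)" by (rule pr_union)
  finally show ?case using insert by simp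
qed

lemma pr_Ex_disjoint:
  "finite X \<Longrightarrow> (\<And>i j t. i \<in> X \<Longrightarrow> j \<in> X \<Longrightarrow> i \<noteq> j \<Longrightarrow> E i t \<Longrightarrow> E j t \<Longrightarrow> False) \<Longrightarrow>
    pr (\<lambda>t. \<exists>i\<in>X. E i t) = (\<Sum>i\<in>X. pr (E i))"
proof (induction X rule: finite_induct)
  case empty
  then show ?case by (simp add: pr_def)
next
  case (insert i X)
  have "pr (\<lambda>t. \<exists>i\<in>insert i X. E i t) = pr (\<lambda>t. E i t \<or> (\<exists>i\<in>X. E i t))" by simp
  also have "\<dots> = pr (E i) + pr (\<lambda>t. \<exists>i\<in>X. E i t)" using insert.hyps insert.prems by (intro pr_disjoint) blast
  also have "pr (\<lambda>t. \<exists>i\<in>X. E i t) = (\<Sum>i\<in>X. pr (E i))"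
    by (rule insert.IH) (use insert.prems in blast)
  finally show ?case using insert.hyps by simp
qed

lemma emb_density_pr: "emb_density adj = pr (emb6 adj)"
proof -
  have e: "pos = insert 0 (insert 2 (insert 4 (insert 1 (insert 3 (insert 5 {})))))" by auto
  have p: "real (card {t \<in> tuples. P t}) = (\<Sum>t\<in>tuples. of_bool (P t))" for P
    by (simp add: of_bool_def sum.If_cases Collect_conj_eq)
  have "real (card {t \<in> tuples. emb6 adj t}) = (\<Sum>x\<in>W. \<Sum>y\<in>W. \<Sum>v\<in>W. \<Sum>a\<in>W. \<Sum>b\<in>W. \<Sum>b'\<in>W. of_bool (emb adj x a y b b' v))"
    unfolding p unfolding e by (simp add: sum_PiE_insert emb6_def)
  also have "\<dots> = n ^ 6 * emb_density adj"
    using card_pos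
    by (simp add: emb_density_def extension_density_def av_def sum_divide_distrib[symmetric] power_def numeral_eq_Suc)
  finally show ?thesis using card_pos by (simp add: pr_def)
qed

text \<open>Independence of the positions.\<close>

lemma pr_box:
  assumes "\<And>i. i \<in> pos \<Longrightarrow> S i \<subseteq> W"
  shows "pr (\<lambda>t. \<forall>i\<in>pos. t i \<in> S i) = (\<Prod>i\<in>pos. mu (S i))"
proof -
  have "{t \<in> tuples. \<forall>i\<in>pos. t i \<in> S i} = PiE pos S"
    using assms unfolding PiE_iff set_eq_iff by blast
  then have "real (card {t \<in> tuples. \<forall>i\<in>pos. t i \<in> S i}) = (\<Prod>i\<in>pos. real (card (S i)))"
    by (simp add: card_PiE)
  also have "\<dots> / n ^ 6 = (\<Prod>i\<in>pos. real (card (S i)) / n)" by (simp add: prod_dividef)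
  also have "\<dots> = (\<Prod>i\<in>pos. mu (S i))" using assms by (intro prod.cong) (auto simp: mu_card)
  finally show ?thesis by (simp add: pr_def)
qed

lemma mu_point: "x \<in> W \<Longrightarrow> mu {x} = 1 / n"
  using mu_card[of "{x}"] by simp

lemma mu_W: "mu W = 1" using mu_card[of W] card_pos by simp

lemma pr_pair_box:
  assumes S: "\<And>i. i \<in> pos \<Longrightarrow> S i \<subseteq> W" and pq: "p \<in> pos" "q \<in> pos" "p \<noteq> q"
  shows "pr (\<lambda>t. E (t p) (t q) \<and> (\<forall>i\<in>pos - {p, q}. t i \<in> S i)) = dens E * (\<Prod>i\<in>pos - {p, q}. mu (S i))"
proof -
  let ?X = "{(u, w). u \<in> W \<and> w \<in> W \<and> E u w}"
  have finX: "finite ?X" by (rule finite_subset[of _ "W \<times> W"]) (use fin in auto)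
  have "pr (\<lambda>t. E (t p) (t q) \<and> (\<forall>i\<in>pos - {p, q}. t i \<in> S i)) =
      pr (\<lambda>t. \<exists>e\<in>?X. \<forall>i\<in>pos. t i \<in> (if i = p then {fst e} else if i = q then {snd e} else S i))"
  proof (rule pr_cong)
    fix t assume t: "t \<in> tuples"
    then have W: "t p \<in> W" "t q \<in> W" using pq PiE_mem by fastforce+
    show "(E (t p) (t q) \<and> (\<forall>i\<in>pos - {p, q}. t i \<in> S i)) \<longleftrightarrow>
      (\<exists>e\<in>?X. \<forall>i\<in>pos. t i \<in> (if i = p then {fst e} else if i = q then {snd e} else S i))" (is "?l \<longleftrightarrow> ?r")
    proof
      assume ?l
      then show ?r using W by (intro bexI[of _ "(t p, t q)"]) auto
    next
      assume ?r
      then obtain e where e: "e \<in> ?X"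
        and all: "\<forall>i\<in>pos. t i \<in> (if i = p then {fst e} else if i = q then {snd e} else S i)" by blast
      have "t p = fst e" "t q = snd e" using bspec[OF all pq(1)] bspec[OF all pq(2)] pq(3) by auto
      then have "E (t p) (t q)" using e by auto
      moreover have "t i \<in> S i" if "i \<in> pos - {p, q}" for i using bspec[OF all, of i] that by auto
      ultimately show ?l by blast
    qed
  qed
  also have "\<dots> = (\<Sum>e\<in>?X. pr (\<lambda>t. \<forall>i\<in>pos. t i \<in> (if i = p then {fst e} else if i = q then {snd e} else S i)))"
  proof (rule pr_Ex_disjoint[OF finX])
    fix e e' :: "'a \<times> 'a" and t
    assume "e \<noteq> e'" and 1: "\<forall>i\<in>pos. t i \<in> (if i = p then {fst e} else if i = q then {snd e} else S i)"
      and 2: "\<forall>i\<in>pos. t i \<in> (if i = p then {fst e'} else if i = q then {snd e'} else S i)"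
    have "t p = fst e" "t q = snd e" "t p = fst e'" "t q = snd e'"
      using bspec[OF 1 pq(1)] bspec[OF 1 pq(2)] bspec[OF 2 pq(1)] bspec[OF 2 pq(2)] pq(3) by auto
    then show False using \<open>e \<noteq> e'\<close> by (simp add: prod_eq_iff)
  qed
  also have "\<dots> = (\<Sum>e\<in>?X. 1 / n\<^sup>2 * (\<Prod>i\<in>pos - {p, q}. mu (S i)))"
  proof (rule sum.cong[OF refl])
    fix e assume e: "e \<in> ?X"
    have "pr (\<lambda>t. \<forall>i\<in>pos. t i \<in> (if i = p then {fst e} else if i = q then {snd e} else S i))
        = (\<Prod>i\<in>pos. mu (if i = p then {fst e} else if i = q then {snd e} else S i))"
      using S e by (intro pr_box) auto
    also have "\<dots> = (\<Prod>i\<in>insert p (insert q (pos - {p, q})). mu (if i = p then {fst e} else if i = q then {snd e} else S i))"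
      using pq by (intro prod.cong) auto
    also have "\<dots> = mu {fst e} * (mu {snd e} * (\<Prod>i\<in>pos - {p, q}. mu (if i = p then {fst e} else if i = q then {snd e} else S i)))"
      using pq(3) by simp
    also have "(\<Prod>i\<in>pos - {p, q}. mu (if i = p then {fst e} else if i = q then {snd e} else S i))
        = (\<Prod>i\<in>pos - {p, q}. mu (S i))" by (rule prod.cong) auto
    finally show "pr (\<lambda>t. \<forall>i\<in>pos. t i \<in> (if i = p then {fst e} else if i = q then {snd e} else S i))
        = 1 / n\<^sup>2 * (\<Prod>i\<in>pos - {p, q}. mu (S i))"
      using e by (auto simp: mu_point power2_eq_square)
  qed
  also have "\<dots> = real (card ?X) / n\<^sup>2 * (\<Prod>i\<in>pos - {p, q}. mu (S i))" by simp
  also have "real (card ?X) / n\<^sup>2 = dens E"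
  proof -
    have "real (card ?X) = (\<Sum>e\<in>W \<times> W. of_bool (E (fst e) (snd e)))"
      using fin by (simp add: of_bool_def sum.If_cases case_prod_beta) (rule arg_cong[where f = card], auto)
    also have "\<dots> = (\<Sum>u\<in>W. \<Sum>w\<in>W. of_bool (E u w))"
      by (simp add: sum.cartesian_product case_prod_beta)
    finally show ?thesis by (simp add: dens_def av_def sum_divide_distrib[symmetric] power2_eq_square)
  qed
  finally show ?thesis .
qed

lemma pr_pair: assumes "p \<in> pos" "q \<in> pos" "p \<noteq> q" shows "pr (\<lambda>t. E (t p) (t q)) = dens E"
proof -
  have "pr (\<lambda>t. E (t p) (t q)) = pr (\<lambda>t. E (t p) (t q) \<and> (\<forall>i\<in>pos - {p, q}. t i \<in> W))"
    by (intro pr_cong) (auto simp: PiE_iff)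
  also have "\<dots> = dens E * (\<Prod>i\<in>pos - {p, q}. mu W)" by (rule pr_pair_box[OF _ assms]) auto
  finally show ?thesis by (simp add: mu_W)
qed

lemma pr_at_pair:
  assumes "x \<in> W" "j \<in> pos" "p \<in> pos" "q \<in> pos" "p \<noteq> q" "j \<noteq> p" "j \<noteq> q"
  shows "pr (\<lambda>t. t j = x \<and> E (t p) (t q)) = dens E / n"
proof -
  have "pr (\<lambda>t. t j = x \<and> E (t p) (t q)) = pr (\<lambda>t. E (t p) (t q) \<and> (\<forall>i\<in>pos - {p, q}. t i \<in> (if i = j then {x} else W)))"
    using assms by (intro pr_cong) (auto simp: PiE_iff)
  also have "\<dots> = dens E * (\<Prod>i\<in>pos - {p, q}. mu (if i = j then {x} else W))"
    using assms by (intro pr_pair_box) auto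
  also have "(\<Prod>i\<in>pos - {p, q}. mu (if i = j then {x} else W)) = (\<Prod>i\<in>pos - {p, q}. if i = j then 1 / n else 1)"
    using assms by (intro prod.cong) (auto simp: mu_point mu_W)
  also have "\<dots> = 1 / n" using assms by (simp add: prod.delta)
  finally show ?thesis by simp
qed

end

section \<open>Correcting a wrong pair\<close>

lemma partner_simps [simp]: "partner (partner i) = i" "partner i \<noteq> i" "i \<noteq> partner i" "fst (partner i) = fst i"
  "partner i = partner j \<longleftrightarrow> i = j"
  by (auto simp: partner_def prod_eq_iff)

text \<open>The part played by each position when a copy lies in the blowup.\<close>

definition role :: "part \<Rightarrow> part \<Rightarrow> nat \<Rightarrow> part" where
  "role i k p = (if p \<in> {0, 1} then i else if p = 4 then k else partner i)"

lemma emb6_cong: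
  assumes "\<And>p q. p \<in> pos \<Longrightarrow> q \<in> pos \<Longrightarrow> adj' (t p) (t q) \<longleftrightarrow> adj (t p) (t q)"
  shows "emb6 adj' t \<longleftrightarrow> emb6 adj t"
  unfolding emb6_def emb_def by (simp add: assms)

lemma emb6_role:
  assumes ok: "\<And>p q. p \<in> pos \<Longrightarrow> q \<in> pos \<Longrightarrow> p \<noteq> q \<Longrightarrow> t p \<noteq> t q \<and> \<not> wrong adj f (t p) (t q)"
    and role: "\<And>p. p \<in> pos \<Longrightarrow> f (t p) = role i k p" and k: "fst k \<noteq> fst i"
  shows "emb6 adj t"
proof -
  have a: "adj (t p) (t q) \<longleftrightarrow> role i k q = partner (role i k p)" if "p \<in> pos" "q \<in> pos" "p \<noteq> q" for p q
  proof -
    have "t p \<noteq> t q" "\<not> wrong adj f (t p) (t q)" using ok[OF that] by auto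
    then show ?thesis unfolding role[OF that(1), symmetric] role[OF that(2), symmetric] by (simp add: wrong_def)
  qed
  have "k \<noteq> i" "k \<noteq> partner i" "partner k \<noteq> i" "partner k \<noteq> partner i" "i \<noteq> partner k"
    using k by (auto simp: partner_def)
  then show ?thesis using ok unfolding emb6_def emb_def by (simp add: a role_def)
qed

context graph begin

lemma emb6_distinct:
  assumes e: "emb6 adj t" and pq: "p \<in> pos" "q \<in> pos" "p \<noteq> q"
  shows "t p \<noteq> t q"
proof -
  have d: "t 0 \<noteq> t 1" "t 2 \<noteq> t 3" "t 2 \<noteq> t 5" "t 3 \<noteq> t 5"
    using e unfolding emb6_def emb_def by blast+
  have a: "adj (t 0) (t 2)" "adj (t 0) (t 3)" "adj (t 0) (t 5)" "adj (t 1) (t 2)" "adj (t 1) (t 3)" "adj (t 1) (t 5)"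
    "\<not> adj (t 4) (t 0)" "\<not> adj (t 4) (t 1)" "\<not> adj (t 4) (t 2)"
    using e unfolding emb6_def emb_def by blast+
  have d': "t 0 \<noteq> t 2" "t 0 \<noteq> t 3" "t 0 \<noteq> t 5" "t 1 \<noteq> t 2" "t 1 \<noteq> t 3" "t 1 \<noteq> t 5"
    "t 4 \<noteq> t 0" "t 4 \<noteq> t 1" "t 4 \<noteq> t 2" "t 4 \<noteq> t 3" "t 4 \<noteq> t 5"
    using a irr sym by metis+
  have "p \<in> {0,1,2,3,4,5}" "q \<in> {0,1,2,3,4,5}" using pq by auto
  then show ?thesis using pq(3) d d' d[symmetric] d'[symmetric] by (elim insertE emptyE) simp_all
qed

text \<open>Two vertices on the same side have common neighbours in the copy, a vertex is tied to the other side through the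
  other vertices of its own side, and the isolated vertex can be compared with another vertex of the same side.
  So the remaining pairs force the parts of any two vertices to fit their adjacency.\<close>

lemma emb6_not_one_wrong:
  assumes e: "emb6 adj t" and jl: "j \<in> pos" "l \<in> pos" "j \<noteq> l"
    and ok: "\<And>p q. p \<in> pos \<Longrightarrow> q \<in> pos \<Longrightarrow> p \<noteq> q \<Longrightarrow> {p, q} \<noteq> {j, l} \<Longrightarrow> \<not> wrong adj f (t p) (t q)"
  shows "\<not> wrong adj f (t j) (t l)"
proof -
  define g where "g m = f (t m)" for m
  have r: "{p, q} = {j, l} \<or> (adj (t p) (t q) \<longleftrightarrow> g q = partner (g p))"
    if "p \<in> pos" "q \<in> pos" "p \<noteq> q" for p q
    using ok[OF that] emb6_distinct[OF e that] by (auto simp: wrong_def g_def)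
  have a: "adj (t 0) (t 2)" "adj (t 0) (t 3)" "adj (t 0) (t 5)" "adj (t 1) (t 2)" "adj (t 1) (t 3)" "adj (t 1) (t 5)"
    "\<not> adj (t 0) (t 1)" "\<not> adj (t 2) (t 3)" "\<not> adj (t 2) (t 5)" "\<not> adj (t 3) (t 5)"
    "\<not> adj (t 4) (t 0)" "\<not> adj (t 4) (t 1)" "\<not> adj (t 4) (t 2)" "\<not> adj (t 4) (t 3)" "\<not> adj (t 4) (t 5)"
    using e unfolding emb6_def emb_def by blast+
  have rs: "{0, 2} = {j, l} \<or> g 2 = partner (g 0)" "{0, 3} = {j, l} \<or> g 3 = partner (g 0)"
    "{0, 5} = {j, l} \<or> g 5 = partner (g 0)" "{1, 2} = {j, l} \<or> g 2 = partner (g 1)"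
    "{1, 3} = {j, l} \<or> g 3 = partner (g 1)" "{1, 5} = {j, l} \<or> g 5 = partner (g 1)"
    "{4, 0} = {j, l} \<or> g 0 \<noteq> partner (g 4)" "{4, 1} = {j, l} \<or> g 1 \<noteq> partner (g 4)"
    "{4, 2} = {j, l} \<or> g 2 \<noteq> partner (g 4)" "{4, 3} = {j, l} \<or> g 3 \<noteq> partner (g 4)"
    using r[of 0 2] r[of 0 3] r[of 0 5] r[of 1 2] r[of 1 3] r[of 1 5] r[of 4 0] r[of 4 1] r[of 4 2] r[of 4 3] a
    by simp_all
  have main: "adj (t p) (t q) \<longleftrightarrow> g q = partner (g p)"
    if pq: "{p, q} = {j, l}" and "(p, q) \<in> {(0,1),(0,2),(0,3),(0,5),(1,2),(1,3),(1,5),(2,3),(2,5),(3,5),(4,0),(4,1),(4,2),(4,3),(4,5)}" for p q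
    using that(2) rs[folded pq] a by (elim insertE emptyE) (simp_all add: doubleton_eq_iff)
  have "j \<in> {0,1,2,3,4,5}" "l \<in> {0,1,2,3,4,5}" using jl by auto
  then consider "(j, l) \<in> {(0,1),(0,2),(0,3),(0,5),(1,2),(1,3),(1,5),(2,3),(2,5),(3,5),(4,0),(4,1),(4,2),(4,3),(4,5)}"
    | "(l, j) \<in> {(0,1),(0,2),(0,3),(0,5),(1,2),(1,3),(1,5),(2,3),(2,5),(3,5),(4,0),(4,1),(4,2),(4,3),(4,5)}"
    using jl(3) by (elim insertE emptyE) simp_all
  then show ?thesis
  proof cases
    case 1
    then show ?thesis using main[of j l] by (simp add: wrong_def g_def)
  next
    case 2
    then have "adj (t l) (t j) \<longleftrightarrow> g j = partner (g l)" by (intro main) auto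
    then show ?thesis using adj_commute[of "t j" "t l"] by (auto simp: wrong_def g_def)
  qed
qed

end

context vertices begin

lemma dens_le:
  assumes "\<And>x. x \<in> W \<Longrightarrow> mu {w. E x w} \<le> c" shows "dens E \<le> c"
  using av_le_const[of "\<lambda>x. mu {w. E x w}" c] assms by (simp add: dens_def mu_def)

lemma pr_at_two:
  assumes xy: "x \<in> W" "y \<in> W" and jl: "j \<in> pos" "l \<in> pos" "j \<noteq> l"
    and pq: "p \<in> pos" "q \<in> pos" "p \<noteq> q" "{p, q} \<noteq> {j, l}"
    and E: "\<And>u w. E u w \<Longrightarrow> E w u" "\<And>z. z \<in> W \<Longrightarrow> mu {w. E z w} \<le> c"
  shows "pr (\<lambda>t. t j = x \<and> t l = y \<and> E (t p) (t q)) \<le> c / n\<^sup>2"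
proof -
  have one: "pr (\<lambda>t. t j = x \<and> t l = y \<and> E z (t m)) \<le> c / n\<^sup>2"
    if m: "m \<in> pos" "m \<noteq> j" "m \<noteq> l" and z: "z \<in> W" for m z
  proof -
    let ?S = "\<lambda>i. if i = j then {x} else if i = l then {y} else if i = m then {w \<in> W. E z w} else W"
    have "pr (\<lambda>t. t j = x \<and> t l = y \<and> E z (t m)) \<le> pr (\<lambda>t. \<forall>i\<in>pos. t i \<in> ?S i)"
      by (intro pr_mono) (auto simp: PiE_iff)
    also have "\<dots> = (\<Prod>i\<in>pos. mu (?S i))" using xy by (intro pr_box) auto
    also have "\<dots> = (\<Prod>i\<in>insert j (insert l (insert m (pos - {j, l, m}))). mu (?S i))"
      using jl m by (intro prod.cong) auto
    also have "\<dots> = 1 / n * (1 / n * (mu {w \<in> W. E z w} * (\<Prod>i\<in>pos - {j, l, m}. mu (?S i))))"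
      using jl m xy by (simp add: mu_point)
    also have "(\<Prod>i\<in>pos - {j, l, m}. mu (?S i)) = 1"
      by (intro prod.neutral) (auto simp: mu_W)
    also have "mu {w \<in> W. E z w} = mu {w. E z w}" by (rule mu_cong) auto
    finally have "pr (\<lambda>t. t j = x \<and> t l = y \<and> E z (t m)) \<le> mu {w. E z w} / n\<^sup>2"
      by (simp add: power2_eq_square)
    also have "\<dots> \<le> c / n\<^sup>2" using E(2)[OF z] by (intro divide_right_mono) auto
    finally show ?thesis .
  qed
  consider "p \<notin> {j, l}" "q \<notin> {j, l}" | "p \<in> {j, l}" "q \<notin> {j, l}" | "p \<notin> {j, l}" "q \<in> {j, l}"
    using pq(3,4) jl(3) by blast
  then show ?thesis
  proof cases
    case 1
    let ?S = "\<lambda>i. if i = j then {x} else if i = l then {y} else W"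
    have "pr (\<lambda>t. t j = x \<and> t l = y \<and> E (t p) (t q)) \<le> pr (\<lambda>t. E (t p) (t q) \<and> (\<forall>i\<in>pos - {p, q}. t i \<in> ?S i))"
      by (intro pr_mono) (auto simp: PiE_iff)
    also have "\<dots> = dens E * (\<Prod>i\<in>pos - {p, q}. mu (?S i))" using xy pq by (intro pr_pair_box) auto
    also have "(\<Prod>i\<in>pos - {p, q}. mu (?S i)) = (\<Prod>i\<in>insert j (insert l (pos - {p, q, j, l})). mu (?S i))"
      using jl 1 by (intro prod.cong) auto
    also have "\<dots> = 1 / n * (1 / n * (\<Prod>i\<in>pos - {p, q, j, l}. mu (?S i)))"
      using jl xy by (simp add: mu_point)
    also have "(\<Prod>i\<in>pos - {p, q, j, l}. mu (?S i)) = 1"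
      by (intro prod.neutral) (auto simp: mu_W)
    also have "dens E * (1 / n * (1 / n * 1)) \<le> c * (1 / n * (1 / n * 1))"
      using dens_le[OF E(2)] by (intro mult_right_mono) auto
    finally show ?thesis by (simp add: power2_eq_square)
  next
    case 2
    then have "pr (\<lambda>t. t j = x \<and> t l = y \<and> E (t p) (t q))
        \<le> pr (\<lambda>t. t j = x \<and> t l = y \<and> E (if p = j then x else y) (t q))"
      by (intro pr_mono) auto
    also have "\<dots> \<le> c / n\<^sup>2" using 2 pq xy by (intro one) auto
    finally show ?thesis .
  next
    case 3
    then have "pr (\<lambda>t. t j = x \<and> t l = y \<and> E (t p) (t q))
        \<le> pr (\<lambda>t. t j = x \<and> t l = y \<and> E (if q = j then x else y) (t p))"
      using E(1) by (intro pr_mono) auto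
    also have "\<dots> \<le> c / n\<^sup>2" using 3 pq xy by (intro one) auto
    finally show ?thesis .
  qed
qed

definition pairs :: "(nat \<times> nat) set" where "pairs = {(p, q). p \<in> pos \<and> q \<in> pos \<and> p \<noteq> q}"

lemma finite_pairs [simp]: "finite pairs"
  unfolding pairs_def by (rule finite_subset[of _ "pos \<times> pos"]) auto

lemma card_pairs: "card pairs \<le> 30"
proof -
  have "pairs \<subseteq> pos \<times> pos - (\<lambda>p. (p, p)) ` pos" unfolding pairs_def by auto
  then have "card pairs \<le> card (pos \<times> pos - (\<lambda>p. (p, p)) ` pos)" by (intro card_mono) auto
  also have "\<dots> = card (pos \<times> pos) - card ((\<lambda>p. (p, p)) ` pos)" by (intro card_Diff_subset) auto
  also have "card ((\<lambda>p. (p, p)) ` pos) = 6" by (subst card_image) (auto simp: inj_on_def)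
  finally show ?thesis by (simp add: card_cartesian_product)
qed

lemma pr_Ex_pairs:
  assumes "\<And>p q. (p, q) \<in> X \<Longrightarrow> pr (E p q) \<le> c" "X \<subseteq> pairs" "0 \<le> c"
  shows "pr (\<lambda>t. \<exists>(p, q)\<in>X. E p q t) \<le> 30 * c"
proof -
  have "finite X" using assms(2) finite_pairs finite_subset by blast
  then have "pr (\<lambda>t. \<exists>e\<in>X. E (fst e) (snd e) t) \<le> (\<Sum>e\<in>X. pr (E (fst e) (snd e)))" by (rule pr_Ex)
  also have "\<dots> \<le> (\<Sum>e\<in>X. c)" using assms(1) by (intro sum_mono) auto
  also have "\<dots> = real (card X) * c" by simp
  also have "\<dots> \<le> 30 * c"
    using card_mono[OF finite_pairs assms(2)] card_pairs assms(3) by (intro mult_right_mono) auto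
  finally show ?thesis by (simp add: case_prod_beta)
qed

text \<open>The slack \<open>k\<close> leaves room for adding a small multiple of the edit distance to the objective.\<close>

definition optimal :: "real \<Rightarrow> ('a \<Rightarrow> 'a \<Rightarrow> bool) \<Rightarrow> bool" where
  "optimal k adj \<longleftrightarrow> (\<forall>adj'. graph W adj' \<longrightarrow>
     pr (emb6 adj') \<le> pr (emb6 adj) + k * dens (\<lambda>u w. adj u w \<noteq> adj' u w))"

end

context graph begin

lemma wrong_commute: "wrong adj f x y \<longleftrightarrow> wrong adj f y x"
  unfolding wrong_def adj_commute[of x y] by (auto simp: partner_def prod_eq_iff)

text \<open>Correct the wrong pair \<open>x y\<close>. A copy that is lost contains a second wrong pair, so at most \<open>900 * eta / n\<^sup>2\<close>
  are lost. Conversely \<open>x\<close> and \<open>y\<close> can be given positions that suit their parts, and filling the other four positions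
  from the right parts, avoiding wrong pairs and repetitions, gives about \<open>c\<^sup>4 / n\<^sup>2\<close> new copies.\<close>

lemma no_wrong_pairs:
  assumes opt: "optimal k adj" and k: "0 \<le> k"
    and eta: "\<And>z. z \<in> W \<Longrightarrow> mu {w. wrong adj f z w} \<le> eta"
    and shares: "\<And>i. c \<le> mu {w. f w = i}" and c: "0 \<le> c"
    and num: "930 * eta + 30 / n + 2 * k < c ^ 4"
    and xy: "x \<in> W" "y \<in> W"
  shows "\<not> wrong adj f x y"
proof
  assume w: "wrong adj f x y"
  then have "x \<noteq> y" by (simp add: wrong_def)
  have eta0: "0 \<le> eta" using eta[OF xy(1)] mu_nonneg order_trans by blast
  define adj' where "adj' u w = (if {u, w} = {x, y} then \<not> adj u w else adj u w)" for u w
  have g': "graph W adj'"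
    using \<open>x \<noteq> y\<close> irr adj_commute by unfold_locales (auto simp: adj'_def insert_commute)
  have right: "\<not> wrong adj' f x y" using w by (simp add: wrong_def adj'_def)
  have right': "\<not> wrong adj' f y x" using right graph.wrong_commute[OF g'] by blast
  have same: "wrong adj' f u v \<longleftrightarrow> wrong adj f u v" if "{u, v} \<noteq> {x, y}" for u v
    using that by (simp add: wrong_def adj'_def)
  define A where "A = emb6 adj"
  define A' where "A' = emb6 adj'"
  define B where "B t \<longleftrightarrow> A t \<and> (\<exists>(j, l)\<in>pairs. t j = x \<and> t l = y)" for t
  \<comment> \<open>The copies that are lost when the pair is corrected.\<close>
  have prB: "pr B \<le> 30 * (30 * (eta / n\<^sup>2))"
  proof -
    have "pr B \<le> pr (\<lambda>t. \<exists>(j, l)\<in>pairs. \<exists>(p, q)\<in>{(p, q) \<in> pairs. {p, q} \<noteq> {j, l}}.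
        t j = x \<and> t l = y \<and> wrong adj f (t p) (t q))"
    proof (rule pr_mono)
      fix t assume "B t"
      then obtain j l where jl: "(j, l) \<in> pairs" "t j = x" "t l = y" and "emb6 adj t"
        by (auto simp: B_def A_def)
      have "\<exists>p q. p \<in> pos \<and> q \<in> pos \<and> p \<noteq> q \<and> {p, q} \<noteq> {j, l} \<and> wrong adj f (t p) (t q)"
        using emb6_not_one_wrong[OF \<open>emb6 adj t\<close>, of j l f] jl w by (auto simp: pairs_def)
      then show "\<exists>(j, l)\<in>pairs. \<exists>(p, q)\<in>{(p, q) \<in> pairs. {p, q} \<noteq> {j, l}}.
        t j = x \<and> t l = y \<and> wrong adj f (t p) (t q)"
        using jl by (intro bexI[of _ "(j, l)"]) (auto simp: pairs_def)
    qed
    also have "\<dots> \<le> 30 * (30 * (eta / n\<^sup>2))"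
    proof (rule pr_Ex_pairs)
      fix j l assume jl: "(j, l) \<in> pairs"
      show "pr (\<lambda>t. \<exists>(p, q)\<in>{(p, q) \<in> pairs. {p, q} \<noteq> {j, l}}. t j = x \<and> t l = y \<and> wrong adj f (t p) (t q))
        \<le> 30 * (eta / n\<^sup>2)"
      proof (rule pr_Ex_pairs)
        fix p q assume "(p, q) \<in> {(p, q) \<in> pairs. {p, q} \<noteq> {j, l}}"
        then show "pr (\<lambda>t. t j = x \<and> t l = y \<and> wrong adj f (t p) (t q)) \<le> eta / n\<^sup>2"
          using jl xy eta wrong_commute by (intro pr_at_two) (auto simp: pairs_def)
      qed (use eta0 in auto)
    qed (use eta0 in auto)
    finally show ?thesis .
  qed
  \<comment> \<open>Positions for \<open>x\<close> and \<open>y\<close> in an ideal copy, according to the relation between their parts.\<close>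
  obtain i kk j l where roles: "fst kk \<noteq> fst i" "(j, l) \<in> pairs" "role i kk j = f x" "role i kk l = f y"
  proof -
    define kk where "kk = (\<not> fst (f x), True)"
    consider "f y = partner (f x)" | "f y = f x" | "fst (f y) \<noteq> fst (f x)"
      by (auto simp: partner_def prod_eq_iff)
    then show thesis
    proof cases
      case 1 then show ?thesis by (intro that[of kk "f x" 0 2]) (auto simp: kk_def pairs_def role_def)
    next
      case 2 then show ?thesis by (intro that[of kk "f x" 0 1]) (auto simp: kk_def pairs_def role_def)
    next
      case 3 then show ?thesis by (intro that[of "f x" "f y" 4 0]) (auto simp: pairs_def role_def)
    qed
  qed
  have jl: "j \<in> pos" "l \<in> pos" "j \<noteq> l" using roles(2) by (auto simp: pairs_def)
  define C where "C t \<longleftrightarrow> A' t \<and> t j = x \<and> t l = y" for t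
  define bad where "bad u v \<longleftrightarrow> u = v \<or> wrong adj f u v" for u v
  have bad: "bad u v \<Longrightarrow> bad v u" "z \<in> W \<Longrightarrow> mu {w. bad z w} \<le> eta + 1 / n" for u v z
  proof -
    show "bad u v \<Longrightarrow> bad v u" using wrong_commute by (auto simp: bad_def)
    assume z: "z \<in> W"
    have "mu {w. bad z w} \<le> mu ({z} \<union> {w. wrong adj f z w})" by (rule mu_mono) (auto simp: bad_def)
    also have "\<dots> \<le> mu {z} + mu {w. wrong adj f z w}" by (rule mu_Un_le)
    finally show "mu {w. bad z w} \<le> eta + 1 / n" using eta[OF z] z by (simp add: mu_point)
  qed
  \<comment> \<open>The copies that are gained.\<close>
  have prC: "c ^ 4 / n\<^sup>2 - 30 * ((eta + 1 / n) / n\<^sup>2) \<le> pr C"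
  proof -
    let ?S = "\<lambda>m. if m = j then {x} else if m = l then {y} else {w \<in> W. f w = role i kk m}"
    have "c ^ 4 / n\<^sup>2 \<le> (\<Prod>m\<in>pos. mu (?S m))"
    proof -
      have "(\<Prod>m\<in>pos. mu (?S m)) = (\<Prod>m\<in>insert j (insert l (pos - {j, l})). mu (?S m))"
        using jl by (intro prod.cong) auto
      also have "\<dots> = 1 / n * (1 / n * (\<Prod>m\<in>pos - {j, l}. mu (?S m)))"
        using jl xy by (simp add: mu_point)
      also have "(\<Prod>m\<in>pos - {j, l}. mu (?S m)) \<ge> (\<Prod>m\<in>pos - {j, l}. c)"
      proof (intro prod_mono conjI)
        fix m assume "m \<in> pos - {j, l}"
        moreover have "mu {w \<in> W. f w = role i kk m} = mu {w. f w = role i kk m}" by (rule mu_cong) auto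
        ultimately show "c \<le> mu (?S m)" using shares by simp
      qed (rule c)
      moreover have "card (pos - {j, l}) = 4" using jl by (simp add: card_Diff_subset)
      ultimately show ?thesis by (simp add: power2_eq_square divide_right_mono)
    qed
    also have "\<dots> = pr (\<lambda>t. \<forall>m\<in>pos. t m \<in> ?S m)" using xy by (intro pr_box[symmetric]) auto
    also have "\<dots> \<le> pr (\<lambda>t. C t \<or> (\<exists>(p, q)\<in>{(p, q) \<in> pairs. {p, q} \<noteq> {j, l}}.
        t j = x \<and> t l = y \<and> bad (t p) (t q)))"
    proof (rule pr_mono)
      fix t assume t: "\<forall>m\<in>pos. t m \<in> ?S m"
      have tj: "t j = x" "t l = y" using bspec[OF t jl(1)] bspec[OF t jl(2)] jl(3) by auto
      have role: "f (t m) = role i kk m" if "m \<in> pos" for m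
        using bspec[OF t that] roles(3,4) by (auto split: if_splits)
      show "C t \<or> (\<exists>(p, q)\<in>{(p, q) \<in> pairs. {p, q} \<noteq> {j, l}}. t j = x \<and> t l = y \<and> bad (t p) (t q))"
      proof (rule disjCI)
        assume "\<not> (\<exists>(p, q)\<in>{(p, q) \<in> pairs. {p, q} \<noteq> {j, l}}. t j = x \<and> t l = y \<and> bad (t p) (t q))"
        then have nb: "\<not> bad (t p) (t q)" if "p \<in> pos" "q \<in> pos" "p \<noteq> q" "{p, q} \<noteq> {j, l}" for p q
          using that tj by (auto simp: pairs_def)
        have "emb6 adj' t"
        proof (rule emb6_role[where t = t and f = f and i = i and k = kk, OF _ role roles(1)])
          fix p q assume pq: "p \<in> pos" "q \<in> pos" "p \<noteq> q"
          show "t p \<noteq> t q \<and> \<not> wrong adj' f (t p) (t q)"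
          proof (cases "{p, q} = {j, l}")
            case True
            then show ?thesis using tj right right' \<open>x \<noteq> y\<close> by (auto simp: doubleton_eq_iff)
          next
            case False
            note nbpq = nb[OF pq False]
            have "{t p, t q} \<noteq> {x, y}"
            proof
              assume *: "{t p, t q} = {x, y}"
              \<comment> \<open>A repetition of \<open>x\<close> or \<open>y\<close> would be a bad pair.\<close>
              have "p \<in> {j, l}"
              proof (rule ccontr)
                assume "p \<notin> {j, l}"
                then have "\<not> bad (t p) (t j)" "\<not> bad (t p) (t l)"
                  using nb[of p j] nb[of p l] pq jl by (auto simp: doubleton_eq_iff)
                then show False using * tj by (auto simp: bad_def doubleton_eq_iff)
              qed
              moreover have "q \<in> {j, l}"
              proof (rule ccontr)
                assume "q \<notin> {j, l}"
                then have "\<not> bad (t q) (t j)" "\<not> bad (t q) (t l)"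
                  using nb[of q j] nb[of q l] pq jl by (auto simp: doubleton_eq_iff)
                then show False using * tj by (auto simp: bad_def doubleton_eq_iff)
              qed
              ultimately show False using False pq(3) by auto
            qed
            then show ?thesis using nbpq same by (simp add: bad_def)
          qed
        qed
        then show "C t" using tj by (simp add: C_def A'_def)
      qed
    qed
    also have "\<dots> \<le> pr C + pr (\<lambda>t. \<exists>(p, q)\<in>{(p, q) \<in> pairs. {p, q} \<noteq> {j, l}}. t j = x \<and> t l = y \<and> bad (t p) (t q))"
      by (rule pr_union)
    also have "pr (\<lambda>t. \<exists>(p, q)\<in>{(p, q) \<in> pairs. {p, q} \<noteq> {j, l}}. t j = x \<and> t l = y \<and> bad (t p) (t q))
        \<le> 30 * ((eta + 1 / n) / n\<^sup>2)"
    proof (rule pr_Ex_pairs)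
      fix p q assume "(p, q) \<in> {(p, q) \<in> pairs. {p, q} \<noteq> {j, l}}"
      then show "pr (\<lambda>t. t j = x \<and> t l = y \<and> bad (t p) (t q)) \<le> (eta + 1 / n) / n\<^sup>2"
        using jl xy bad by (intro pr_at_two) (auto simp: pairs_def)
    qed (use eta0 in auto)
    finally show ?thesis by simp
  qed
  have "pr A - pr B + pr C \<le> pr A'"
  proof -
    have "pr A = pr B + pr (\<lambda>t. A t \<and> \<not> B t)"
      using pr_split[of A B] pr_cong[of "\<lambda>t. A t \<and> B t" B] by (auto simp: B_def)
    moreover have "pr (\<lambda>t. (A t \<and> \<not> B t) \<or> C t) = pr (\<lambda>t. A t \<and> \<not> B t) + pr C"
      using roles(2) by (intro pr_disjoint) (auto simp: B_def C_def)
    moreover have "pr (\<lambda>t. (A t \<and> \<not> B t) \<or> C t) \<le> pr A'"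
    proof (rule pr_mono)
      fix t assume "(A t \<and> \<not> B t) \<or> C t"
      then show "A' t"
      proof
        assume AB: "A t \<and> \<not> B t"
        then have nxy: "\<not> (t p = x \<and> t q = y)" if "p \<in> pos" "q \<in> pos" for p q
          using that \<open>x \<noteq> y\<close> by (auto simp: B_def pairs_def)
        have "emb6 adj' t = emb6 adj t"
          by (rule emb6_cong) (use nxy in \<open>auto simp: adj'_def doubleton_eq_iff\<close>)
        then show "A' t" using AB by (simp add: A_def A'_def)
      qed (simp add: C_def)
    qed
    ultimately show ?thesis by simp
  qed
  moreover have "pr A' \<le> pr A + k * (2 / n\<^sup>2)"
  proof -
    have pt: "dens (\<lambda>u v. u = a \<and> v = b) = 1 / n\<^sup>2" if "a \<in> W" "b \<in> W" for a b
    proof -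
      have "dens (\<lambda>u v. u = a \<and> v = b) = av (\<lambda>u. av (\<lambda>v. of_bool (u = a) * of_bool (v = b)))"
        unfolding dens_def by (intro av_cong) simp
      then show ?thesis using that by (simp add: av_point power2_eq_square)
    qed
    have "dens (\<lambda>u v. adj u v \<noteq> adj' u v) \<le> dens (\<lambda>u v. (u = x \<and> v = y) \<or> (u = y \<and> v = x))"
      by (rule dens_mono) (auto simp: adj'_def doubleton_eq_iff split: if_splits)
    also have "\<dots> \<le> 2 / n\<^sup>2" using dens_disj[of "\<lambda>u v. u = x \<and> v = y" "\<lambda>u v. u = y \<and> v = x"] pt xy by simp
    finally have "k * dens (\<lambda>u v. adj u v \<noteq> adj' u v) \<le> k * (2 / n\<^sup>2)" using k by (intro mult_left_mono) auto
    then show ?thesis using opt g' unfolding optimal_def A_def A'_def by fastforce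
  qed
  ultimately have le: "c ^ 4 / n\<^sup>2 - 30 * ((eta + 1 / n) / n\<^sup>2) - 30 * (30 * (eta / n\<^sup>2)) - k * (2 / n\<^sup>2) \<le> 0"
    using prB prC by linarith
  have "(c ^ 4 - 30 * (eta + 1 / n) - 900 * eta - 2 * k) / n\<^sup>2
      = c ^ 4 / n\<^sup>2 - 30 * ((eta + 1 / n) / n\<^sup>2) - 30 * (30 * (eta / n\<^sup>2)) - k * (2 / n\<^sup>2)"
    by (simp add: diff_divide_distrib add_divide_distrib)
  with le have "(c ^ 4 - 30 * (eta + 1 / n) - 900 * eta - 2 * k) / n\<^sup>2 \<le> 0" by simp
  then have "c ^ 4 - 30 * (eta + 1 / n) - 900 * eta - 2 * k \<le> 0"
    using n_pos by (simp add: divide_le_0_iff)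
  with num show False by simp
qed

end

section \<open>The vertex landscape\<close>

text \<open>A vertex whose neighbourhood takes a fraction \<open>x, y\<close> of the two classes of one component:
  \<open>avoid\<close> bounds how often it is the isolated vertex, \<open>join\<close> how often it lies in the bipartite part.\<close>

definition avoid :: "real \<Rightarrow> real \<Rightarrow> real" where
  "avoid x y = (1 - x)\<^sup>2 * (1 - y)\<^sup>2 * (1 - (x + y) / 2)"

definition join :: "real \<Rightarrow> real \<Rightarrow> real" where
  "join x y = x\<^sup>2 * (1 - y) + y\<^sup>2 * (1 - x)"

text \<open>Two alternatives for a vertex: seen from one component it can either be isolated or belong to it. The factor
  \<open>101 / 100\<close> absorbs the slight difference between the values of the alternatives in \<open>vertex_poly_le\<close>.\<close>

lemma avoid_join:
  fixes x y :: real
  assumes xy: "0 \<le> x" "x \<le> 1" "0 \<le> y" "y \<le> 1"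
  shows "0 \<le> avoid x y" "0 \<le> join x y" "avoid x y + join x y \<le> 1"
    "join x y < 1 / 2 \<Longrightarrow> avoid x y + 101 / 100 * join x y \<le> 1"
    "join x y < 1 / 2 \<Longrightarrow> avoid x y + 101 / 100 * join x y = 1 \<Longrightarrow> x = 0 \<and> y = 0"
    "join x y = 1 \<Longrightarrow> (x = 1 \<and> y = 0) \<or> (x = 0 \<and> y = 1)"
    "join x y \<le> x + y"
proof -
  define u where "u = (1 - x) * (1 - y)"
  define M where "M = max x y"
  have M: "0 \<le> M" "M \<le> 1" "x \<le> M" "y \<le> M" using xy by (auto simp: M_def)
  have u: "0 \<le> u" "u \<le> 1" "1 - u = x + y - x * y"
  proof -
    show "0 \<le> u" unfolding u_def using xy by simp
    show "u \<le> 1" unfolding u_def using xy by (intro mult_le_one) auto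
    show "1 - u = x + y - x * y" by (simp add: u_def algebra_simps)
  qed
  have xy0: "0 \<le> x * y" using xy by simp
  show a0: "0 \<le> avoid x y" and j0: "0 \<le> join x y" using xy by (simp_all add: avoid_def join_def)
  have av: "avoid x y \<le> u\<^sup>2"
    unfolding avoid_def u_def power_mult_distrib using xy by (intro mult_left_le) auto
  have "join x y \<le> M * (x * (1 - y)) + M * (y * (1 - x))"
    unfolding join_def power2_eq_square using xy M mult_right_mono[OF M(3), of "x * (1 - y)"]
      mult_right_mono[OF M(4), of "y * (1 - x)"] by (simp add: mult.assoc)
  also have "\<dots> = M * ((1 - u) - x * y)" unfolding u(3) by (simp add: algebra_simps)
  finally have jM: "join x y \<le> M * ((1 - u) - x * y)" .
  then have jM': "join x y \<le> M * (1 - u)"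
    using M(1) xy0 mult_left_mono[of "(1 - u) - x * y" "1 - u" M] by linarith
  also have "\<dots> \<le> 1 * (1 - u)" using M u by (intro mult_right_mono) auto
  finally have j1: "join x y \<le> 1 - u" by simp
  define Q where "Q = (1 - u) * (1 + u)"
  have usq: "u\<^sup>2 = 1 - Q" by (simp add: Q_def power2_eq_square algebra_simps)
  have "(1 - u) * 1 \<le> (1 - u) * (1 + u)" using u by (intro mult_left_mono) auto
  then have uQ: "1 - u \<le> Q" by (simp add: Q_def)
  then show "avoid x y + join x y \<le> 1" using av j1 usq by linarith
  show "join x y \<le> x + y" using j1 u(3) xy0 by linarith
  have main: "101 / 100 * join x y \<le> Q \<and> (101 / 100 * join x y = Q \<longrightarrow> u = 1)"
    if j: "join x y < 1 / 2"
  proof (cases "M \<le> 99 / 100")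
    case True
    have "101 / 100 * join x y \<le> 101 / 100 * (99 / 100 * (1 - u))"
      using jM' mult_right_mono[OF True, of "1 - u"] u by simp
    also have "\<dots> = 9999 / 10000 * (1 - u)" by simp
    finally have 1: "101 / 100 * join x y \<le> 9999 / 10000 * (1 - u)" .
    show ?thesis
    proof (intro conjI impI)
      show "101 / 100 * join x y \<le> Q" using 1 uQ u by argo
      assume "101 / 100 * join x y = Q"
      then show "u = 1" using 1 uQ u by argo
    qed
  next
    case False
    have "u \<le> 1 / 100"
    proof -
      have "u \<le> (1 - x) \<and> u \<le> (1 - y)" unfolding u_def using xy by (auto intro: mult_left_le mult_left_le_one_le)
      then show ?thesis using False by (auto simp: M_def split: if_splits)
    qed
    then have "u\<^sup>2 \<le> (1 / 100)\<^sup>2" using u by (intro power_mono) auto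
    then have "u\<^sup>2 \<le> 1 / 100" by (simp add: power2_eq_square)
    then show ?thesis using j usq by linarith
  qed
  show "avoid x y + 101 / 100 * join x y \<le> 1" if "join x y < 1 / 2"
    using main[OF that] av usq by linarith
  show "x = 0 \<and> y = 0" if j: "join x y < 1 / 2" and eq: "avoid x y + 101 / 100 * join x y = 1"
  proof -
    have "u = 1" using main[OF j] av usq eq by linarith
    then have "x + y - x * y = 0" using u(3) by simp
    moreover have "x * y \<le> x * 1" "x * y \<le> 1 * y" using xy by (intro mult_left_mono mult_right_mono; simp)+
    ultimately show ?thesis using xy by linarith
  qed
  show "(x = 1 \<and> y = 0) \<or> (x = 0 \<and> y = 1)" if j: "join x y = 1"
  proof -
    have "1 \<le> M * ((1 - u) - x * y)" using j jM by simp
    moreover have "M * ((1 - u) - x * y) \<le> 1 * ((1 - u) - x * y)" if "0 \<le> (1 - u) - x * y"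
      using M that by (intro mult_right_mono) auto
    moreover have "M * ((1 - u) - x * y) \<le> M * 1" using M u xy0 by (intro mult_left_mono) auto
    moreover have pos: "0 \<le> (1 - u) - x * y"
    proof (rule ccontr)
      assume "\<not> 0 \<le> (1 - u) - x * y"
      then have "M * ((1 - u) - x * y) \<le> 0" using M by (intro mult_nonneg_nonpos) auto
      with calculation(1) show False by simp
    qed
    ultimately have M1: "M = 1" using M by linarith
    then have "1 \<le> (1 - u) - x * y" using j jM by simp
    then have "x * y = 0" "x + y - 2 * (x * y) \<ge> 1" using xy0 u by linarith+
    then show ?thesis using M1 xy by (auto simp: M_def max_def split: if_splits)
  qed
qed

text \<open>At the optimal part sizes the vertices of both components lie in the same number of copies. This is the
  equation of the critical point.\<close>

lemma big_small_balance: "(1 - alpha) ^ 5 + 5 * (1 - alpha) * alpha ^ 4 = 5 * alpha * (1 - alpha) ^ 4 + alpha ^ 5"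
proof -
  have "(1 - alpha) ^ 5 + 5 * (1 - alpha) * alpha ^ 4 - (5 * alpha * (1 - alpha) ^ 4 + alpha ^ 5)
      = (1 - 2 * alpha) * (6 * (alpha * (1 - alpha))\<^sup>2 - 8 * (alpha * (1 - alpha)) + 1)"
    by (simp add: power_def numeral_eq_Suc algebra_simps)
  then show ?thesis unfolding alpha_mult beta0_root by simp
qed

text \<open>The number of copies at a vertex, with \<open>m i\<close> and \<open>z i\<close> the measures of its neighbours and non-neighbours in
  part \<open>i\<close>. The side of size two lies in part \<open>i\<close>, and the three products belong to the isolated vertex, to the
  side of size two and to the side of size three.\<close>

definition vertex_poly :: "(part \<Rightarrow> real) \<Rightarrow> (part \<Rightarrow> real) \<Rightarrow> real" where
  "vertex_poly m z = (\<Sum>i\<in>UNIV. (z i)\<^sup>2 * z (partner i) ^ 3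
     + (2 * z i * m (partner i) ^ 3 + 3 * (m i)\<^sup>2 * (z (partner i))\<^sup>2)
        * (z (\<not> fst i, True) + z (\<not> fst i, False)))"

lemma UNIV_part: "(UNIV :: part set) = {(True, True), (True, False), (False, True), (False, False)}"
  by (auto simp: UNIV_bool)

lemma join_upper:
  fixes x y :: real
  assumes "0 \<le> x" "x \<le> 1" "0 \<le> y" "y \<le> 1"
  shows "2 * ((1 - x) * y ^ 3 + (1 - y) * x ^ 3) + 3 * (x\<^sup>2 * (1 - y)\<^sup>2 + y\<^sup>2 * (1 - x)\<^sup>2) \<le> 5 * join x y"
proof -
  have "(1 - x) * y ^ 3 \<le> (1 - x) * y\<^sup>2" "(1 - y) * x ^ 3 \<le> (1 - y) * x\<^sup>2"
    using assms by (intro mult_left_mono power_decreasing; simp)+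
  moreover have "x\<^sup>2 * (1 - y)\<^sup>2 \<le> x\<^sup>2 * (1 - y)" "y\<^sup>2 * (1 - x)\<^sup>2 \<le> y\<^sup>2 * (1 - x)"
    using assms by (intro mult_left_mono; simp add: power2_eq_square mult_left_le)+
  ultimately show ?thesis by (simp add: join_def algebra_simps)
qed

lemma component_poly_scale:
  fixes h g x y X Y :: real
  shows "16 * ((h * X)\<^sup>2 * (h * Y) ^ 3 + (h * Y)\<^sup>2 * (h * X) ^ 3) = (2 * h) ^ 5 * (X\<^sup>2 * Y\<^sup>2 * ((X + Y) / 2))"
    and "16 * ((2 * (h * X) * (h * y) ^ 3 + 3 * (h * x)\<^sup>2 * (h * Y)\<^sup>2 + (2 * (h * Y) * (h * x) ^ 3 + 3 * (h * y)\<^sup>2 * (h * X)\<^sup>2)) * c)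
      = (2 * h) ^ 4 * (2 * (X * y ^ 3 + Y * x ^ 3) + 3 * (x\<^sup>2 * Y\<^sup>2 + y\<^sup>2 * X\<^sup>2)) * c"
  by (simp_all add: power2_eq_square power3_eq_cube power4_eq_xxxx power_def numeral_eq_Suc algebra_simps)

lemma vertex_poly_eq:
  fixes x y x' y' :: real
  defines "P \<equiv> 1 - alpha"
  defines "m \<equiv> \<lambda>i. share i * (if fst i then (if snd i then x else y) else (if snd i then x' else y'))"
  defines "z \<equiv> \<lambda>i. share i - m i"
  shows "16 * vertex_poly m z = P ^ 5 * avoid x y
      + P ^ 4 * (2 * ((1 - x) * y ^ 3 + (1 - y) * x ^ 3) + 3 * (x\<^sup>2 * (1 - y)\<^sup>2 + y\<^sup>2 * (1 - x)\<^sup>2)) * (alpha * (1 - (x' + y') / 2))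
      + alpha ^ 5 * avoid x' y'
      + alpha ^ 4 * (2 * ((1 - x') * y' ^ 3 + (1 - y') * x' ^ 3) + 3 * (x'\<^sup>2 * (1 - y')\<^sup>2 + y'\<^sup>2 * (1 - x')\<^sup>2)) * (P * (1 - (x + y) / 2))"
proof -
  define h g X Y X' Y' where "h = P / 2" and "g = alpha / 2" and "X = 1 - x" and "Y = 1 - y" and "X' = 1 - x'" and "Y' = 1 - y'"
  note defs = h_def g_def X_def Y_def X'_def Y'_def
  have z: "z (True, True) = h * X" "z (True, False) = h * Y"
    "z (False, True) = g * X'" "z (False, False) = g * Y'"
    by (simp_all add: z_def m_def share_def P_def defs field_simps)
  have m: "m (True, True) = h * x" "m (True, False) = h * y"
    "m (False, True) = g * x'" "m (False, False) = g * y'"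
    by (simp_all add: m_def share_def P_def defs)
  let ?V = "\<lambda>h X Y. (h * X)\<^sup>2 * (h * Y) ^ 3 + (h * Y)\<^sup>2 * (h * X) ^ 3"
  let ?K = "\<lambda>h X Y x y. 2 * (h * X) * (h * y) ^ 3 + 3 * (h * x)\<^sup>2 * (h * Y)\<^sup>2 + (2 * (h * Y) * (h * x) ^ 3 + 3 * (h * y)\<^sup>2 * (h * X)\<^sup>2)"
  have sum4: "(\<Sum>i\<in>UNIV. F i) = F (True, True) + F (True, False) + F (False, True) + F (False, False)"
    for F :: "part \<Rightarrow> real" unfolding UNIV_part by simp
  have "vertex_poly m z = ?V h X Y + ?K h X Y x y * (g * X' + g * Y') + ?V g X' Y' + ?K g X' Y' x' y' * (h * X + h * Y)"
    unfolding vertex_poly_def sum4 by (simp add: partner_def z m distrib_right)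
  then have "16 * vertex_poly m z = 16 * ?V h X Y + 16 * (?K h X Y x y * (g * X' + g * Y'))
      + 16 * ?V g X' Y' + 16 * (?K g X' Y' x' y' * (h * X + h * Y))"
    by (simp only: distrib_left)
  also have "g * X' + g * Y' = alpha * (1 - (x' + y') / 2)" by (simp add: defs field_simps)
  also have "h * X + h * Y = P * (1 - (x + y) / 2)" by (simp add: defs field_simps)
  finally have *: "16 * vertex_poly m z = 16 * ?V h X Y + 16 * (?K h X Y x y * (alpha * (1 - (x' + y') / 2)))
      + 16 * ?V g X' Y' + 16 * (?K g X' Y' x' y' * (P * (1 - (x + y) / 2)))" .
  have e: "2 * h = P" "2 * g = alpha" "(X + Y) / 2 = 1 - (x + y) / 2" "(X' + Y') / 2 = 1 - (x' + y') / 2"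
    by (simp_all add: defs field_simps)
  show ?thesis
    unfolding * component_poly_scale e avoid_def by (simp only: X_def Y_def X'_def Y'_def)
qed

text \<open>With \<open>x, y, x', y'\<close> the relative degrees to the four parts, the polynomial is bounded by
  \<open>A0 * avoid x y + A1 * w * join x y\<close> plus the same for the small component. A vertex that joins the large component is
  isolated for the small one and conversely, and by \<open>big_small_balance\<close> both choices have the value \<open>A0 + B1 = A1 + B0\<close>.
  Joining both does not pay: either \<open>join x y < 1 / 2\<close>, where \<open>avoid_join\<close> has room to spare, or the factor \<open>w\<close>
  punishes neighbours in the small component.\<close>

lemma vertex_poly_le:
  fixes x y x' y' :: real
  defines "m \<equiv> \<lambda>i. share i * (if fst i then (if snd i then x else y) else (if snd i then x' else y'))"
  defines "z \<equiv> \<lambda>i. share i - m i"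
  assumes xy: "0 \<le> x" "x \<le> 1" "0 \<le> y" "y \<le> 1" and xy': "0 \<le> x'" "x' \<le> 1" "0 \<le> y'" "y' \<le> 1"
  shows "16 * vertex_poly m z \<le> (1 - alpha) ^ 5 + 5 * (1 - alpha) * alpha ^ 4"
    and "16 * vertex_poly m z = (1 - alpha) ^ 5 + 5 * (1 - alpha) * alpha ^ 4 \<Longrightarrow>
      (x, y, x', y') \<in> {(1, 0, 0, 0), (0, 1, 0, 0), (0, 0, 1, 0), (0, 0, 0, 1)}"
proof -
  define P where "P = 1 - alpha"
  \<comment> \<open>The values of the four roles: isolated for or member of the large component, then the same for the small one.\<close>
  define A0 A1 B0 B1 where "A0 = P ^ 5" and "A1 = 5 * alpha * P ^ 4" and "B0 = alpha ^ 5" and "B1 = 5 * P * alpha ^ 4"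
  have P: "8322 / 10000 < P" "P < 8323 / 10000" using alpha_bounds by (auto simp: P_def)
  have bal: "A0 + B1 = A1 + B0" using big_small_balance by (simp add: A0_def A1_def B0_def B1_def P_def)
  have P4: "0 < P ^ 4" and a4: "0 < alpha ^ 4" using P alpha_bounds by auto
  have A01: "A0 < A1" "A1 \<le> 101 / 100 * A0"
  proof -
    have "P ^ 4 * P < P ^ 4 * (5 * alpha)" "P ^ 4 * (5 * alpha) \<le> P ^ 4 * (101 / 100 * P)"
      using P alpha_bounds P4 by (intro mult_strict_left_mono mult_left_mono; simp)+
    then show "A0 < A1" "A1 \<le> 101 / 100 * A0"
      by (simp_all add: A0_def A1_def power_def numeral_eq_Suc mult_ac)
  qed
  have B01: "0 < B0" "B0 < B1"
  proof -
    show "0 < B0" using alpha_bounds by (simp add: B0_def)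
    have "alpha ^ 4 * alpha < alpha ^ 4 * (5 * P)" using P alpha_bounds a4 by (intro mult_strict_left_mono) auto
    then show "B0 < B1" by (simp add: B0_def B1_def power_def numeral_eq_Suc mult_ac)
  qed
  have B1A1: "4 * B1 < A1"
  proof -
    have "B1 \<le> 5 * 1 * (1678 / 10000) ^ 4" unfolding B1_def using P alpha_bounds by (intro mult_mono power_mono) auto
    moreover have "5 * (1677 / 10000) * (8322 / 10000) ^ 4 \<le> A1"
      unfolding A1_def using P alpha_bounds by (intro mult_mono power_mono) auto
    ultimately show ?thesis by (simp add: power_divide)
  qed
  define V J V' J' w w' where "V = avoid x y" and "J = join x y" and "V' = avoid x' y'" and "J' = join x' y'"
    and "w = 1 - (x' + y') / 2" and "w' = 1 - (x + y) / 2"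
  note vj = avoid_join[OF xy, folded V_def J_def] and vj' = avoid_join[OF xy', folded V'_def J'_def]
  have w: "0 \<le> w" "w \<le> 1" "J' \<le> 2 * (1 - w)" using xy' vj'(7) by (auto simp: w_def)
  have w': "0 \<le> w'" "w' \<le> 1" using xy by (auto simp: w'_def)
  have poly: "16 * vertex_poly m z \<le> A0 * V + A1 * w * J + B0 * V' + B1 * w' * J'"
  proof -
    have "P ^ 4 * (2 * ((1 - x) * y ^ 3 + (1 - y) * x ^ 3) + 3 * (x\<^sup>2 * (1 - y)\<^sup>2 + y\<^sup>2 * (1 - x)\<^sup>2)) * (alpha * w)
        \<le> P ^ 4 * (5 * J) * (alpha * w)"
      using join_upper[OF xy] w(1) P alpha_bounds unfolding J_def by (intro mult_right_mono mult_left_mono) auto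
    moreover have "alpha ^ 4 * (2 * ((1 - x') * y' ^ 3 + (1 - y') * x' ^ 3) + 3 * (x'\<^sup>2 * (1 - y')\<^sup>2 + y'\<^sup>2 * (1 - x')\<^sup>2)) * (P * w')
        \<le> alpha ^ 4 * (5 * J') * (P * w')"
      using join_upper[OF xy'] w'(1) P alpha_bounds unfolding J'_def by (intro mult_right_mono mult_left_mono) auto
    ultimately show ?thesis
      unfolding m_def z_def vertex_poly_eq
      by (simp add: P_def[symmetric] V_def V'_def w_def w'_def A0_def A1_def B0_def B1_def mult_ac)
  qed
  have "A0 * V + A1 * w * J + B0 * V' + B1 * w' * J' \<le> A0 + B1 \<and>
    (A0 * V + A1 * w * J + B0 * V' + B1 * w' * J' = A0 + B1 \<longrightarrow>
      (x, y, x', y') \<in> {(1, 0, 0, 0), (0, 1, 0, 0), (0, 0, 1, 0), (0, 0, 0, 1)})"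
  proof (cases "J < 1 / 2")
    case True
    have 1: "A0 * V + A1 * w * J \<le> A0 * (V + 101 / 100 * J)"
    proof -
      have "A1 * (w * J) \<le> A1 * (1 * J)" using w vj(2) A01 B01 by (intro mult_left_mono mult_right_mono) (auto simp: A1_def alpha_bounds less_imp_le)
      also have "A1 * (1 * J) \<le> (101 / 100 * A0) * J" using mult_right_mono[OF A01(2) vj(2)] by simp
      finally show ?thesis by (simp add: algebra_simps)
    qed
    have A0: "0 < A0" using P by (simp add: A0_def)
    have 2: "A0 * (V + 101 / 100 * J) \<le> A0 * 1" using vj(4)[OF True] A0 by (intro mult_left_mono) auto
    have 3: "B1 * w' * J' \<le> B1 * J'" using w' vj'(2) B01 by (simp add: mult_right_mono mult_left_le)
    have 4: "B1 * (V' + J') \<le> B1 * 1" using vj'(3) B01 by (intro mult_left_mono) auto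
    have 5: "B0 * V' \<le> B1 * V'" using vj'(1) B01 by (intro mult_right_mono) auto
    have 45: "B1 * V' + B1 * J' \<le> B1" using 4 by (simp add: distrib_left)
    show ?thesis
    proof (intro conjI impI)
      show "A0 * V + A1 * w * J + B0 * V' + B1 * w' * J' \<le> A0 + B1" using 1 2 3 45 5 by linarith
      assume eq: "A0 * V + A1 * w * J + B0 * V' + B1 * w' * J' = A0 + B1"
      then have "A0 * (V + 101 / 100 * J) = A0 * 1" "B0 * V' = B1 * V'" "B1 * V' + B1 * J' = B1"
        using 1 2 3 45 5 by linarith+
      then have "V + 101 / 100 * J = 1" "V' = 0" "J' = 1" using A0 B01 by (auto simp: distrib_left[symmetric])
      then show "(x, y, x', y') \<in> {(1, 0, 0, 0), (0, 1, 0, 0), (0, 0, 1, 0), (0, 0, 0, 1)}"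
        using vj(5)[OF True] vj'(6) by auto
    qed
  next
    case False
    have A1: "0 < A1" using B1A1 B01 by linarith
    have 1: "A1 * (1 - w) * (1 / 2) \<le> A1 * (1 - w) * J"
      using False w A1 by (intro mult_left_mono) auto
    have 2: "B1 * w' * J' \<le> B1 * (2 * (1 - w))"
    proof -
      have "B1 * w' * J' \<le> B1 * J'" using w' vj'(2) B01 by (simp add: mult_right_mono mult_left_le)
      also have "\<dots> \<le> B1 * (2 * (1 - w))" using w B01 by (intro mult_left_mono) auto
      finally show ?thesis .
    qed
    have 3: "B1 * (2 * (1 - w)) \<le> A1 * (1 - w) * (1 / 2)"
      using mult_right_mono[of "4 * B1" A1 "1 - w"] B1A1 w by (simp add: field_simps)
    have 4: "A0 * V \<le> A1 * V" using A01 vj(1) by (intro mult_right_mono) auto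
    have 5: "A1 * (V + J) \<le> A1 * 1" using vj(3) A1 by (intro mult_left_mono) auto
    then have 5: "A1 * V + A1 * J \<le> A1" by (simp add: distrib_left)
    have V'1: "V' \<le> 1" using vj'(2,3) by linarith
    have 6: "B0 * V' \<le> B0" using V'1 vj'(1) B01 by (simp add: mult_left_le)
    have e: "A1 * w * J = A1 * J - A1 * (1 - w) * J" by (simp add: algebra_simps)
    show ?thesis
    proof (intro conjI impI)
      show "A0 * V + A1 * w * J + B0 * V' + B1 * w' * J' \<le> A0 + B1" using 1 2 3 4 5 6 e bal by linarith
      assume eq: "A0 * V + A1 * w * J + B0 * V' + B1 * w' * J' = A0 + B1"
      then have 7: "A0 * V = A1 * V" "A1 * V + A1 * J = A1" "B1 * (2 * (1 - w)) = A1 * (1 - w) * (1 / 2)"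
        using 1 2 3 4 5 6 e bal by linarith+
      then have "V = 0" using A01 by auto
      then have "J = 1" using 7(2) A1 by simp
      have "(4 * B1 - A1) * (1 - w) = 0" using 7(3) by (simp add: algebra_simps)
      then have "w = 1" using B1A1 by auto
      then have "x' = 0" "y' = 0" using xy' by (auto simp: w_def)
      then show "(x, y, x', y') \<in> {(1, 0, 0, 0), (0, 1, 0, 0), (0, 0, 1, 0), (0, 0, 0, 1)}"
        using vj(6) \<open>J = 1\<close> by auto
    qed
  qed
  then show "16 * vertex_poly m z \<le> (1 - alpha) ^ 5 + 5 * (1 - alpha) * alpha ^ 4"
    and "16 * vertex_poly m z = (1 - alpha) ^ 5 + 5 * (1 - alpha) * alpha ^ 4 \<Longrightarrow>
      (x, y, x', y') \<in> {(1, 0, 0, 0), (0, 1, 0, 0), (0, 0, 1, 0), (0, 0, 0, 1)}"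
    using poly by (auto simp: A0_def B1_def P_def)
qed

section \<open>Vertices of optimal graphs\<close>

lemma balance_Lam: "(1 - alpha) ^ 5 + 5 * (1 - alpha) * alpha ^ 4 = 6 * Lam alpha"
proof -
  have "(1 - alpha) ^ 5 + 5 * (1 - alpha) * alpha ^ 4
      = alpha * ((1 - alpha) ^ 5 + 5 * (1 - alpha) * alpha ^ 4)
        + (1 - alpha) * ((1 - alpha) ^ 5 + 5 * (1 - alpha) * alpha ^ 4)"
    by (simp add: algebra_simps)
  also have "\<dots> = alpha * ((1 - alpha) ^ 5 + 5 * (1 - alpha) * alpha ^ 4)
        + (1 - alpha) * (5 * alpha * (1 - alpha) ^ 4 + alpha ^ 5)"
    by (simp only: big_small_balance)
  also have "\<dots> = 6 * Lam alpha"
    by (simp add: Lam_def power_def numeral_eq_Suc algebra_simps)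
  finally show ?thesis .
qed

text \<open>How far a vertex is from being a clone of part \<open>i\<close>.\<close>

definition deviation :: "(part \<Rightarrow> real) \<Rightarrow> (part \<Rightarrow> real) \<Rightarrow> part \<Rightarrow> real" where
  "deviation m z i = z (partner i) + (\<Sum>j\<in>UNIV - {partner i}. m j)"

lemma sum_part: "(\<Sum>i\<in>UNIV. F i) = F (True, True) + F (True, False) + F (False, True) + (F (False, False) :: real)"
  unfolding UNIV_part by simp

lemma maximal_vertex:
  fixes m z :: "part \<Rightarrow> real"
  assumes nn: "\<And>i. 0 \<le> m i" "\<And>i. 0 \<le> z i" and sum: "\<And>i. m i + z i = share i"
    and max: "6 * Lam alpha \<le> 16 * vertex_poly m z"
  shows "\<exists>i. deviation m z i = 0"
proof -
  have s: "0 < share i" for i using alpha_bounds by (simp add: share_def)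
  define q where "q i = m i / share i" for i
  have q: "0 \<le> q i" "q i \<le> 1" for i
  proof -
    show "0 \<le> q i" using nn(1)[of i] s[of i] by (simp add: q_def)
    have "m i \<le> share i" using sum[of i] nn(2)[of i] by linarith
    then show "q i \<le> 1" using s[of i] by (simp add: q_def)
  qed
  have mq: "m i = share i * q i" for i using s[of i] by (simp add: q_def)
  have m: "m = (\<lambda>i. share i * (if fst i then (if snd i then q (True, True) else q (True, False))
      else (if snd i then q (False, True) else q (False, False))))"
    unfolding fun_eq_iff by (auto simp: mq split_paired_all)
  have z: "z = (\<lambda>i. share i - m i)" using sum by (auto simp: fun_eq_iff algebra_simps)
  have "(q (True, True), q (True, False), q (False, True), q (False, False))
     \<in> {(1, 0, 0, 0), (0, 1, 0, 0), (0, 0, 1, 0), (0, 0, 0, 1)}"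
  proof (rule vertex_poly_le(2)[OF q q q q])
    have "16 * vertex_poly m z \<le> (1 - alpha) ^ 5 + 5 * (1 - alpha) * alpha ^ 4"
      unfolding z by (subst (1 2) m, rule vertex_poly_le(1)[OF q q q q])
    then have "16 * vertex_poly m z = (1 - alpha) ^ 5 + 5 * (1 - alpha) * alpha ^ 4"
      using max balance_Lam by linarith
    then show "16 * vertex_poly
      (\<lambda>i. share i * (if fst i then (if snd i then q (True, True) else q (True, False))
        else (if snd i then q (False, True) else q (False, False))))
      (\<lambda>i. share i - share i * (if fst i then (if snd i then q (True, True) else q (True, False))
        else (if snd i then q (False, True) else q (False, False)))) =
      (1 - alpha) ^ 5 + 5 * (1 - alpha) * alpha ^ 4"
      unfolding z by (subst (asm) (1 2) m)
  qed
  then have "\<exists>j\<in>{(True, True), (True, False), (False, True), (False, False)}. q j = 1 \<and> (\<forall>k. k \<noteq> j \<longrightarrow> q k = 0)"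
    by (elim insertE emptyE) (simp_all add: split_paired_All all_bool_eq)
  then obtain j where j: "q j = 1" "\<And>k. k \<noteq> j \<Longrightarrow> q k = 0" by blast
  have "deviation m z (partner j) = 0"
    unfolding deviation_def using j sum[of j] by (simp add: mq)
  then show ?thesis by blast
qed

lemma near_maximal_vertex:
  fixes e :: real
  assumes "0 < e"
  obtains k where "0 < k"
    "\<And>m z :: part \<Rightarrow> real. \<lbrakk>\<And>i. 0 \<le> m i; \<And>i. 0 \<le> z i; \<And>i. \<bar>m i + z i - share i\<bar> \<le> k;
       6 * Lam alpha - k \<le> 16 * vertex_poly m z\<rbrakk> \<Longrightarrow> \<exists>i. deviation m z i < e"
proof -
  define K :: "((real ^ part) \<times> (real ^ part)) set" where "K = cbox 0 (vec 2) \<times> cbox 0 (vec 2)"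
  define D :: "part \<Rightarrow> (real ^ part) \<times> (real ^ part) \<Rightarrow> real" where
    "D i = (\<lambda>(m, z). deviation (\<lambda>i. m $ i) (\<lambda>i. z $ i) i)" for i
  define h :: "(real ^ part) \<times> (real ^ part) \<Rightarrow> real" where
    "h = (\<lambda>(m, z). min (- (\<Sum>i\<in>UNIV. \<bar>m $ i + z $ i - share i\<bar>))
        (16 * vertex_poly (\<lambda>i. m $ i) (\<lambda>i. z $ i) - 6 * Lam alpha))"
  define g where "g x = min (min (D (True, True) x) (D (True, False) x)) (min (D (False, True) x) (D (False, False) x))" for x
  have "compact K" unfolding K_def by (intro compact_Times compact_cbox)
  moreover have "continuous_on K h"
    unfolding h_def case_prod_beta vertex_poly_def by (intro continuous_intros)
  moreover have "continuous_on K g"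
    unfolding g_def D_def case_prod_beta deviation_def by (intro continuous_intros)
  moreover have "g x < e" if x: "x \<in> K" "0 \<le> h x" for x
  proof -
    obtain m z where xe: "x = (m, z)" by (cases x)
    have hh: "0 \<le> - (\<Sum>i\<in>UNIV. \<bar>m $ i + z $ i - share i\<bar>) \<and>
        0 \<le> 16 * vertex_poly (\<lambda>i. m $ i) (\<lambda>i. z $ i) - 6 * Lam alpha"
      using x(2) unfolding xe h_def prod.case min.bounded_iff .
    have nn: "0 \<le> m $ i" "0 \<le> z $ i" for i
      using x(1) unfolding xe K_def by (cases i; auto simp: mem_box_cart)+
    have "(\<Sum>i\<in>UNIV. \<bar>m $ i + z $ i - share i\<bar>) = 0"
      using hh sum_nonneg[of UNIV "\<lambda>i. \<bar>m $ i + z $ i - share i\<bar>"] by linarith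
    then have dev: "\<bar>m $ i + z $ i - share i\<bar> \<le> 0" for i
      using member_le_sum[of i UNIV "\<lambda>i. \<bar>m $ i + z $ i - share i\<bar>"] by simp
    have eq: "m $ i + z $ i = share i" for i using dev[of i] by linarith
    have "\<exists>i. deviation (\<lambda>i. m $ i) (\<lambda>i. z $ i) i = 0"
      by (rule maximal_vertex[OF nn eq]) (use hh in linarith)
    then obtain i where "D i x = 0" by (auto simp: D_def xe)
    moreover have "g x \<le> D i x" by (cases i; cases "fst i"; cases "snd i") (auto simp: g_def)
    ultimately show ?thesis using assms by simp
  qed
  ultimately have "\<exists>k>0. \<forall>x\<in>K. - k \<le> h x \<longrightarrow> g x < e" by (rule compact_slack)
  then obtain k where k: "0 < k" "\<And>x. x \<in> K \<Longrightarrow> - k \<le> h x \<Longrightarrow> g x < e" by blast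
  define k' where "k' = min (k / 4) 1"
  show ?thesis
  proof (rule that[of k'])
    show "0 < k'" using k(1) by (simp add: k'_def)
    fix m z :: "part \<Rightarrow> real"
    assume nn: "\<And>i. 0 \<le> m i" "\<And>i. 0 \<le> z i" and dev: "\<And>i. \<bar>m i + z i - share i\<bar> \<le> k'"
      and poly: "6 * Lam alpha - k' \<le> 16 * vertex_poly m z"
    have share: "share i \<le> 1" for i using alpha_bounds by (simp add: share_def)
    have k'k: "k' \<le> 1" "4 * k' \<le> k" by (simp_all add: k'_def)
    have le2: "m i \<le> 2" "z i \<le> 2" for i using dev[of i] nn(1)[of i] nn(2)[of i] share[of i] k'k(1) by linarith+
    let ?x = "(\<chi> i. m i, \<chi> i. z i)"
    have "?x \<in> K" unfolding K_def using nn le2 by (auto simp: mem_box_cart)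
    moreover have "- k \<le> h ?x"
    proof -
      have "(\<Sum>i\<in>UNIV. \<bar>m i + z i - share i\<bar>) \<le> (\<Sum>i\<in>(UNIV :: part set). k')" using dev by (intro sum_mono)
      also have "\<dots> = 4 * k'" unfolding sum_part by simp
      finally have "(\<Sum>i\<in>UNIV. \<bar>m i + z i - share i\<bar>) \<le> k" using k'k by linarith
      moreover have "k' \<le> k" using k'k \<open>0 < k'\<close> by linarith
      ultimately show ?thesis
        unfolding h_def prod.case min.bounded_iff vec_lambda_beta using poly
        by (simp add: vec_lambda_inverse)
    qed
    ultimately have "g ?x < e" by (rule k(2))
    then show "\<exists>i. deviation m z i < e"
      unfolding g_def D_def prod.case min_less_iff_disj by (auto simp: vec_lambda_inverse)
  qed
qed

context graph begin

lemma emb6_transport: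
  assumes "\<And>p q. p \<in> pos \<Longrightarrow> q \<in> pos \<Longrightarrow> adj' (s p) (s q) \<longleftrightarrow> adj (t p) (t q)"
    and "\<And>p q. p \<in> pos \<Longrightarrow> q \<in> pos \<Longrightarrow> s p = s q \<longleftrightarrow> t p = t q"
  shows "emb6 adj' s \<longleftrightarrow> emb6 adj t"
  unfolding emb6_def emb_def by (simp add: assms)

text \<open>Double counting: every copy has six vertices.\<close>

lemma exists_average_vertex:
  "\<exists>y\<in>W. 6 * pr (emb6 adj) \<le> n * pr (\<lambda>t. emb6 adj t \<and> y \<in> t ` pos)"
proof (rule ccontr)
  assume "\<not> ?thesis"
  then have less: "n * pr (\<lambda>t. emb6 adj t \<and> y \<in> t ` pos) < 6 * pr (emb6 adj)" if "y \<in> W" for y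
    using that by (auto simp: not_le)
  let ?A = "{t \<in> tuples. emb6 adj t}"
  have finA: "finite ?A" by simp
  have "(\<Sum>y\<in>W. card {t \<in> tuples. emb6 adj t \<and> y \<in> t ` pos}) = (\<Sum>y\<in>W. \<Sum>t\<in>?A. if y \<in> t ` pos then 1 else 0)"
  proof (rule sum.cong[OF refl])
    fix y
    have "{t \<in> tuples. emb6 adj t \<and> y \<in> t ` pos} = {t \<in> ?A. y \<in> t ` pos}" by auto
    then show "card {t \<in> tuples. emb6 adj t \<and> y \<in> t ` pos} = (\<Sum>t\<in>?A. if y \<in> t ` pos then 1 else 0)"
      using finA by (simp add: sum.If_cases Int_def)
  qed
  also have "\<dots> = (\<Sum>t\<in>?A. \<Sum>y\<in>W. if y \<in> t ` pos then 1 else 0)" by (rule sum.swap)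
  also have "\<dots> = (\<Sum>t\<in>?A. 6)"
  proof (rule sum.cong[OF refl])
    fix t assume t: "t \<in> ?A"
    have "t ` pos \<subseteq> W" using t by auto
    then have "(\<Sum>y\<in>W. if y \<in> t ` pos then 1 else 0) = card (t ` pos)"
      using fin by (simp add: sum.If_cases Int_absorb1)
    also have "inj_on t pos" using t emb6_distinct by (auto simp: inj_on_def)
    then have "card (t ` pos) = 6" by (simp add: card_image)
    finally show "(\<Sum>y\<in>W. if y \<in> t ` pos then 1 else 0) = (6 :: nat)" .
  qed
  finally have c: "(\<Sum>y\<in>W. card {t \<in> tuples. emb6 adj t \<and> y \<in> t ` pos}) = 6 * card ?A" by simp
  have "(\<Sum>y\<in>W. pr (\<lambda>t. emb6 adj t \<and> y \<in> t ` pos)) = real (\<Sum>y\<in>W. card {t \<in> tuples. emb6 adj t \<and> y \<in> t ` pos}) / n ^ 6"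
    unfolding pr_def by (simp add: sum_divide_distrib)
  also have "\<dots> = 6 * pr (emb6 adj)" unfolding c by (simp add: pr_def)
  finally have eq: "(\<Sum>y\<in>W. pr (\<lambda>t. emb6 adj t \<and> y \<in> t ` pos)) = 6 * pr (emb6 adj)" .
  have "n * (\<Sum>y\<in>W. pr (\<lambda>t. emb6 adj t \<and> y \<in> t ` pos)) < (\<Sum>y\<in>W. 6 * pr (emb6 adj))"
    unfolding sum_distrib_left using less fin ne by (intro sum_strict_mono) auto
  also have "\<dots> = n * (6 * pr (emb6 adj))" by simp
  finally show False unfolding eq by simp
qed

lemma pr_two_points:
  assumes "x \<in> W" "y \<in> W" "x \<noteq> y"
  shows "pr (\<lambda>t. x \<in> t ` pos \<and> y \<in> t ` pos) \<le> 30 * (1 / n\<^sup>2)"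
proof -
  have "pr (\<lambda>t. x \<in> t ` pos \<and> y \<in> t ` pos) \<le> pr (\<lambda>t. \<exists>(j, l)\<in>pairs. t j = x \<and> t l = y)"
    using assms(3) by (intro pr_mono) (fastforce simp: pairs_def)
  also have "\<dots> \<le> 30 * (1 / n\<^sup>2)"
  proof (rule pr_Ex_pairs)
    fix j l assume jl: "(j, l) \<in> pairs"
    then have "pr (\<lambda>t. t j = x \<and> t l = y) \<le> pr (\<lambda>t. t j = x \<and> t l \<in> {y})" by (intro pr_mono) auto
    let ?S = "\<lambda>i. if i = j then {x} else if i = l then {y} else W"
    have "pr (\<lambda>t. t j = x \<and> t l = y) \<le> pr (\<lambda>t. \<forall>i\<in>pos. t i \<in> ?S i)"
      using jl by (intro pr_mono) (auto simp: PiE_iff)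
    also have "\<dots> = (\<Prod>i\<in>pos. mu (?S i))" using assms by (intro pr_box) auto
    also have "\<dots> = (\<Prod>i\<in>insert j (insert l (pos - {j, l})). mu (?S i))"
      using jl by (intro prod.cong) (auto simp: pairs_def)
    also have "\<dots> = 1 / n * (1 / n * (\<Prod>i\<in>pos - {j, l}. mu (?S i)))"
      using jl assms by (simp add: mu_point pairs_def)
    also have "(\<Prod>i\<in>pos - {j, l}. mu (?S i)) = 1" by (intro prod.neutral) (auto simp: mu_W)
    finally show "pr (\<lambda>t. t j = x \<and> t l = y) \<le> 1 / n\<^sup>2" by (simp add: power2_eq_square)
  qed auto
  finally show ?thesis .
qed

text \<open>In an optimal graph every vertex lies in about as many copies as the average vertex, since it could be turned
  into a clone of an above-average vertex \<open>y\<close>. The copies at the clone correspond to those at \<open>y\<close>, except for the copies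
  that contain both vertices: these are the \<open>30 / n\<close>. The change affects at most \<open>2 n\<close> ordered pairs.\<close>

lemma vertex_above_average:
  assumes opt: "optimal k adj" and k: "0 \<le> k" and x: "x \<in> W"
  shows "6 * pr (emb6 adj) - 30 / n - 2 * k \<le> n * pr (\<lambda>t. emb6 adj t \<and> x \<in> t ` pos)"
proof -
  obtain y where y: "y \<in> W" "6 * pr (emb6 adj) \<le> n * pr (\<lambda>t. emb6 adj t \<and> y \<in> t ` pos)"
    using exists_average_vertex by blast
  show ?thesis
  proof (cases "y = x")
    case True
    have "0 \<le> 30 / n" by simp
    then show ?thesis using y(2) k unfolding True by linarith
  next
    case False
    define adj' where "adj' u w = (if u = x then w \<noteq> x \<and> adj y w else if w = x then adj y u else adj u w)" for u w
    have g': "graph W adj'"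
      using irr sym by unfold_locales (auto simp: adj'_def)
    let ?c = "\<lambda>a z t. emb6 a t \<and> z \<in> t ` pos"
    have "pr (\<lambda>t. (emb6 adj t \<and> y \<in> t ` pos) \<and> x \<notin> t ` pos) \<le> pr (?c adj' x)"
    proof -
      define F where "F t = (\<lambda>p\<in>pos. if t p = y then x else t p)" for t :: "nat \<Rightarrow> 'a"
      let ?X = "{t \<in> tuples. (emb6 adj t \<and> y \<in> t ` pos) \<and> x \<notin> t ` pos}"
      have inj: "inj_on F ?X"
      proof (rule inj_onI)
        fix s t assume st: "s \<in> ?X" "t \<in> ?X" and eq: "F s = F t"
        show "s = t"
        proof (rule PiE_ext)
          show "s \<in> PiE pos (\<lambda>_. W)" "t \<in> PiE pos (\<lambda>_. W)" using st by auto
          fix p assume p: "p \<in> pos"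
          have "F s p = F t p" using eq by simp
          moreover have "s p \<noteq> x" "t p \<noteq> x" using st p by auto
          ultimately show "s p = t p" using p by (auto simp: F_def split: if_splits)
        qed
      qed
      have "F ` ?X \<subseteq> {t \<in> tuples. ?c adj' x t}"
      proof
        fix s assume "s \<in> F ` ?X"
        then obtain t where t: "t \<in> tuples" "emb6 adj t" "y \<in> t ` pos" "x \<notin> t ` pos" and s: "s = F t" by auto
        have sp: "s p = (if t p = y then x else t p)" if "p \<in> pos" for p using that by (simp add: s F_def)
        have tx: "t p \<noteq> x" if "p \<in> pos" for p using t(4) that by auto
        have "s \<in> tuples" using t(1) x by (auto simp: s F_def PiE_iff)
        moreover have "x \<in> s ` pos"
        proof -
          obtain p where "p \<in> pos" "t p = y" using t(3) by auto
          then show ?thesis using sp[of p] by (intro image_eqI[of _ _ p]) auto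
        qed
        moreover have "emb6 adj' s"
          by (rule emb6_transport[THEN iffD2, OF _ _ t(2)])
            (use sp tx False irr adj_commute in \<open>auto simp: adj'_def\<close>)
        ultimately show "s \<in> {t \<in> tuples. ?c adj' x t}" by simp
      qed
      then have "card ?X \<le> card {t \<in> tuples. ?c adj' x t}"
        by (intro card_inj_on_le[OF inj]) auto
      then show ?thesis unfolding pr_def by (intro divide_right_mono) auto
    qed
    moreover have "pr (?c adj y) = pr (\<lambda>t. ?c adj y t \<and> x \<in> t ` pos) + pr (\<lambda>t. ?c adj y t \<and> x \<notin> t ` pos)"
      by (rule pr_split)
    moreover have "pr (\<lambda>t. ?c adj y t \<and> x \<in> t ` pos) \<le> 30 * (1 / n\<^sup>2)"
      by (rule order.trans[OF pr_mono pr_two_points[OF x y(1)]]) (use False in auto)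
    moreover have "pr (emb6 adj') = pr (?c adj' x) + pr (\<lambda>t. emb6 adj' t \<and> x \<notin> t ` pos)"
      and "pr (emb6 adj) = pr (?c adj x) + pr (\<lambda>t. emb6 adj t \<and> x \<notin> t ` pos)" by (rule pr_split)+
    moreover have "pr (\<lambda>t. emb6 adj' t \<and> x \<notin> t ` pos) = pr (\<lambda>t. emb6 adj t \<and> x \<notin> t ` pos)"
    proof (rule pr_cong)
      fix t
      have "emb6 adj' t \<longleftrightarrow> emb6 adj t" if "x \<notin> t ` pos"
        using that by (intro emb6_cong) (auto simp: adj'_def)
      then show "(emb6 adj' t \<and> x \<notin> t ` pos) \<longleftrightarrow> (emb6 adj t \<and> x \<notin> t ` pos)" by blast
    qed
    moreover have "pr (emb6 adj') \<le> pr (emb6 adj) + k * (2 / n)"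
    proof -
      have "dens (\<lambda>u w. adj u w \<noteq> adj' u w) \<le> dens (\<lambda>u w. u \<in> {x} \<or> w \<in> {x})"
        by (rule dens_mono) (auto simp: adj'_def split: if_splits)
      also have "\<dots> \<le> 2 / n" using dens_disj[of "\<lambda>u w. u \<in> {x}" "\<lambda>u w. w \<in> {x}"] x
        by (simp only: dens_fst dens_snd mu_point)
      finally have "k * dens (\<lambda>u w. adj u w \<noteq> adj' u w) \<le> k * (2 / n)" using k by (rule mult_left_mono)
      then show ?thesis using opt g' unfolding optimal_def by fastforce
    qed
    ultimately have "pr (?c adj y) - 30 * (1 / n\<^sup>2) - k * (2 / n) \<le> pr (?c adj x)" by linarith
    then have "n * (pr (?c adj y) - 30 * (1 / n\<^sup>2) - k * (2 / n)) \<le> n * pr (?c adj x)"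
      by (intro mult_left_mono) auto
    moreover have "n * (pr (?c adj y) - 30 * (1 / n\<^sup>2) - k * (2 / n)) = n * pr (?c adj y) - 30 / n - 2 * k"
      using n_pos by (simp add: field_simps power2_eq_square)
    ultimately show ?thesis using y(2) by linarith
  qed
qed

end

section \<open>Copies at a vertex of a nearly ideal graph\<close>

text \<open>The adjacency relation of \<open>F36\<close>.\<close>

definition linked :: "nat \<Rightarrow> nat \<Rightarrow> bool" where
  "linked p q \<longleftrightarrow> (p \<in> {0, 1} \<and> q \<in> {2, 3, 5}) \<or> (q \<in> {0, 1} \<and> p \<in> {2, 3, 5})"

context graph begin

lemma emb6_linked:
  assumes "emb6 adj t" "p \<in> pos" "q \<in> pos"
  shows "adj (t p) (t q) \<longleftrightarrow> linked p q"
proof -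
  have a: "adj (t 0) (t 2)" "adj (t 0) (t 3)" "adj (t 0) (t 5)" "adj (t 1) (t 2)" "adj (t 1) (t 3)" "adj (t 1) (t 5)"
    "\<not> adj (t 0) (t 1)" "\<not> adj (t 2) (t 3)" "\<not> adj (t 2) (t 5)" "\<not> adj (t 3) (t 5)"
    "\<not> adj (t 4) (t 0)" "\<not> adj (t 4) (t 1)" "\<not> adj (t 4) (t 2)" "\<not> adj (t 4) (t 3)" "\<not> adj (t 4) (t 5)"
    using assms(1) unfolding emb6_def emb_def by blast+
  have a': "adj (t 2) (t 0)" "adj (t 3) (t 0)" "adj (t 5) (t 0)" "adj (t 2) (t 1)" "adj (t 3) (t 1)" "adj (t 5) (t 1)"
    "\<not> adj (t 1) (t 0)" "\<not> adj (t 3) (t 2)" "\<not> adj (t 5) (t 2)" "\<not> adj (t 5) (t 3)"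
    "\<not> adj (t 0) (t 4)" "\<not> adj (t 1) (t 4)" "\<not> adj (t 2) (t 4)" "\<not> adj (t 3) (t 4)" "\<not> adj (t 5) (t 4)"
    using a sym by blast+
  have "p \<in> {0,1,2,3,4,5}" "q \<in> {0,1,2,3,4,5}" using assms by auto
  then show ?thesis using a a' irr by (elim insertE emptyE) (simp_all add: linked_def)
qed

text \<open>The vertices that may take position \<open>p\<close> in a copy whose side of size two lies in part \<open>i\<close>, if their adjacency
  to \<open>x\<close> is prescribed.\<close>

definition seats :: "('a \<Rightarrow> part) \<Rightarrow> 'a \<Rightarrow> part \<Rightarrow> nat \<Rightarrow> bool \<Rightarrow> 'a set" where
  "seats f x i p b = {w \<in> W. (if p = 4 then fst (f w) \<noteq> fst i else f w = (if p \<in> {0, 1} then i else partner i))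
     \<and> (adj x w \<longleftrightarrow> b)}"

text \<open>In a copy, any five positions determine the parts of their vertices up to the choice of the part that hosts
  the side of size two, provided that none of their pairs is wrong.\<close>

lemma emb6_seats:
  assumes e: "emb6 adj t" and t: "t \<in> tuples" and j: "j \<in> pos"
    and ok: "\<And>p q. p \<in> pos - {j} \<Longrightarrow> q \<in> pos - {j} \<Longrightarrow> p \<noteq> q \<Longrightarrow> \<not> wrong adj f (t p) (t q)"
  shows "\<exists>i. \<forall>p\<in>pos - {j}. t p \<in> seats f (t j) i p (linked j p)"
proof -
  define g where "g m = f (t m)" for m
  have r: "linked p q \<longleftrightarrow> g q = partner (g p)" if "p \<in> pos - {j}" "q \<in> pos - {j}" "p \<noteq> q" for p q
    using ok[OF that] emb6_distinct[OF e, of p q] emb6_linked[OF e, of p q] that by (auto simp: wrong_def g_def)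
  have rs: "0 = j \<or> 2 = j \<or> g 2 = partner (g 0)" "0 = j \<or> 3 = j \<or> g 3 = partner (g 0)"
    "0 = j \<or> 5 = j \<or> g 5 = partner (g 0)" "1 = j \<or> 2 = j \<or> g 2 = partner (g 1)"
    "1 = j \<or> 3 = j \<or> g 3 = partner (g 1)" "1 = j \<or> 5 = j \<or> g 5 = partner (g 1)"
    "4 = j \<or> 0 = j \<or> g 0 \<noteq> partner (g 4)" "4 = j \<or> 1 = j \<or> g 1 \<noteq> partner (g 4)"
    "4 = j \<or> 2 = j \<or> g 2 \<noteq> partner (g 4)" "4 = j \<or> 3 = j \<or> g 3 \<noteq> partner (g 4)"
    using r[of 0 2] r[of 0 3] r[of 0 5] r[of 1 2] r[of 1 3] r[of 1 5] r[of 4 0] r[of 4 1] r[of 4 2] r[of 4 3]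
    by (auto simp: linked_def)
  have other: "fst a \<noteq> fst b" if "b \<noteq> partner a" "partner b \<noteq> partner a" for a b :: part
    using that by (auto simp: partner_def prod_eq_iff)
  define i where "i = (if j = 0 then g 1 else g 0)"
  have sides: "g p = (if p \<in> {0, 1} then i else partner i)" if "p \<in> {0, 1, 2, 3, 5}" "p \<noteq> j" for p
  proof -
    have "j \<in> {0,1,2,3,4,5}" using j by auto
    then show ?thesis using that rs(1-6) by (elim insertE emptyE) (simp_all add: i_def)
  qed
  have isolated: "fst (g 4) \<noteq> fst i" if "j \<noteq> 4"
  proof -
    have "i \<noteq> partner (g 4)" using rs(7,8) that by (auto simp: i_def)
    moreover have "partner i \<noteq> partner (g 4)"
      using rs(9,10) sides[of 2] sides[of 3] that by (cases "j = 2") auto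
    ultimately show ?thesis using other[of i "g 4"] by metis
  qed
  have "\<forall>p\<in>pos - {j}. if p = 4 then fst (g p) \<noteq> fst i else g p = (if p \<in> {0, 1} then i else partner i)"
  proof
    fix p assume "p \<in> pos - {j}"
    then have "p = 4 \<or> p \<in> {0, 1, 2, 3, 5}" "p \<noteq> j" by auto
    then show "if p = 4 then fst (g p) \<noteq> fst i else g p = (if p \<in> {0, 1} then i else partner i)"
      using sides[of p] isolated by (cases "p = 4") simp_all
  qed
  then have "\<forall>p\<in>pos - {j}. t p \<in> seats f (t j) i p (linked j p)"
    using emb6_linked[OF e j] PiE_mem[OF t] unfolding seats_def g_def by blast
  then show ?thesis by blast
qed

text \<open>The sum over the position of \<open>x\<close> and the part that hosts the side of size two yields the terms of
  \<open>vertex_poly\<close>. Copies with a wrong pair among the other five positions are few.\<close>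

lemma copies_at_vertex:
  assumes x: "x \<in> W"
  shows "n * pr (\<lambda>t. emb6 adj t \<and> x \<in> t ` pos)
    \<le> vertex_poly (\<lambda>i. mu {w. f w = i \<and> adj x w}) (\<lambda>i. mu {w. f w = i \<and> \<not> adj x w}) + 180 * wrong_density adj f"
proof -
  define m where "m i = mu {w. f w = i \<and> adj x w}" for i
  define z where "z i = mu {w. f w = i \<and> \<not> adj x w}" for i
  define s where "s i p b = mu (seats f x i p b)" for i p b
  have s4: "s i 4 False = z (\<not> fst i, True) + z (\<not> fst i, False)" for i
  proof -
    have "s i 4 False = mu ({w. f w = (\<not> fst i, True) \<and> \<not> adj x w} \<union> {w. f w = (\<not> fst i, False) \<and> \<not> adj x w})"
      unfolding s_def by (intro mu_cong) (auto simp: seats_def prod_eq_iff)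
    also have "\<dots> = z (\<not> fst i, True) + z (\<not> fst i, False)"
      unfolding z_def by (intro mu_Un_disjoint) auto
    finally show ?thesis .
  qed
  have s01: "s i p True = m i" "s i p False = z i" if "p \<in> {0, 1}" for i p
    using that unfolding s_def m_def z_def by (auto intro!: mu_cong simp: seats_def)
  have s235: "s i p True = m (partner i)" "s i p False = z (partner i)" if "p \<in> {2, 3, 5}" for i p
    using that unfolding s_def m_def z_def by (auto intro!: mu_cong simp: seats_def)
  have one: "n * pr (\<lambda>t. emb6 adj t \<and> t j = x) \<le> (\<Sum>i\<in>UNIV. \<Prod>p\<in>pos - {j}. s i p (linked j p)) + 30 * wrong_density adj f"
    if j: "j \<in> pos" for j
  proof -
    let ?P = "{(p, q) \<in> pairs. p \<noteq> j \<and> q \<noteq> j}"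
    let ?S = "\<lambda>i p. if p = j then {x} else seats f x i p (linked j p)"
    have "pr (\<lambda>t. emb6 adj t \<and> t j = x) \<le> pr (\<lambda>t. (\<exists>i\<in>UNIV. \<forall>p\<in>pos. t p \<in> ?S i p)
        \<or> (\<exists>(p, q)\<in>?P. t j = x \<and> wrong adj f (t p) (t q)))"
    proof (intro pr_mono disjCI)
      fix t assume t: "t \<in> tuples" "emb6 adj t \<and> t j = x"
        and "\<not> (\<exists>(p, q)\<in>?P. t j = x \<and> wrong adj f (t p) (t q))"
      then have "\<exists>i. \<forall>p\<in>pos - {j}. t p \<in> seats f (t j) i p (linked j p)"
        using j by (intro emb6_seats) (auto simp: pairs_def)
      then show "\<exists>i\<in>UNIV. \<forall>p\<in>pos. t p \<in> ?S i p" using t by auto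
    qed
    also have "\<dots> \<le> pr (\<lambda>t. \<exists>i\<in>UNIV. \<forall>p\<in>pos. t p \<in> ?S i p) + pr (\<lambda>t. \<exists>(p, q)\<in>?P. t j = x \<and> wrong adj f (t p) (t q))"
      by (rule pr_union)
    also have "pr (\<lambda>t. \<exists>i\<in>UNIV. \<forall>p\<in>pos. t p \<in> ?S i p) \<le> (\<Sum>i\<in>UNIV. pr (\<lambda>t. \<forall>p\<in>pos. t p \<in> ?S i p))"
      by (rule pr_Ex) simp
    also have "\<dots> = (\<Sum>i\<in>UNIV. 1 / n * (\<Prod>p\<in>pos - {j}. s i p (linked j p)))"
    proof (rule sum.cong[OF refl])
      fix i
      have "pr (\<lambda>t. \<forall>p\<in>pos. t p \<in> ?S i p) = (\<Prod>p\<in>pos. mu (?S i p))"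
        using x by (intro pr_box) (auto simp: seats_def)
      also have "\<dots> = mu (?S i j) * (\<Prod>p\<in>pos - {j}. mu (?S i p))" using j by (intro prod.remove) auto
      also have "(\<Prod>p\<in>pos - {j}. mu (?S i p)) = (\<Prod>p\<in>pos - {j}. s i p (linked j p))"
        by (intro prod.cong) (auto simp: s_def)
      finally show "pr (\<lambda>t. \<forall>p\<in>pos. t p \<in> ?S i p) = 1 / n * (\<Prod>p\<in>pos - {j}. s i p (linked j p))"
        using x by (simp add: mu_point)
    qed
    also have "pr (\<lambda>t. \<exists>(p, q)\<in>?P. t j = x \<and> wrong adj f (t p) (t q)) \<le> 30 * (wrong_density adj f / n)"
    proof (rule pr_Ex_pairs)
      fix p q assume "(p, q) \<in> ?P"
      then show "pr (\<lambda>t. t j = x \<and> wrong adj f (t p) (t q)) \<le> wrong_density adj f / n"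
        unfolding wrong_density_def using x j by (subst pr_at_pair) (auto simp: pairs_def)
    qed (auto simp: wrong_density_def)
    finally have "n * pr (\<lambda>t. emb6 adj t \<and> t j = x)
      \<le> n * ((\<Sum>i\<in>UNIV. 1 / n * (\<Prod>p\<in>pos - {j}. s i p (linked j p))) + 30 * (wrong_density adj f / n))"
      by (intro mult_left_mono) auto
    also have "\<dots> = (\<Sum>i\<in>UNIV. \<Prod>p\<in>pos - {j}. s i p (linked j p)) + 30 * wrong_density adj f"
      using n_pos unfolding sum_distrib_left[symmetric] by (simp add: field_simps)
    finally show ?thesis .
  qed
  have "n * pr (\<lambda>t. emb6 adj t \<and> x \<in> t ` pos) \<le> n * pr (\<lambda>t. \<exists>j\<in>pos. emb6 adj t \<and> t j = x)"
    by (intro mult_left_mono pr_mono) auto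
  also have "\<dots> \<le> n * (\<Sum>j\<in>pos. pr (\<lambda>t. emb6 adj t \<and> t j = x))"
    by (intro mult_left_mono pr_Ex) auto
  also have "\<dots> \<le> (\<Sum>j\<in>pos. (\<Sum>i\<in>UNIV. \<Prod>p\<in>pos - {j}. s i p (linked j p)) + 30 * wrong_density adj f)"
    unfolding sum_distrib_left by (intro sum_mono one)
  also have "\<dots> = (\<Sum>i\<in>UNIV. \<Sum>j\<in>pos. \<Prod>p\<in>pos - {j}. s i p (linked j p)) + 180 * wrong_density adj f"
    by (subst sum.swap) (simp add: sum.distrib)
  also have "(\<Sum>i\<in>UNIV. \<Sum>j\<in>pos. \<Prod>p\<in>pos - {j}. s i p (linked j p)) = vertex_poly m z"
    unfolding vertex_poly_def
  proof (rule sum.cong[OF refl])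
    fix i
    have d: "pos - {0} = {1, 2, 3, 4, 5}" "pos - {1} = {0, 2, 3, 4, 5}" "pos - {2} = {0, 1, 3, 4, 5}"
      "pos - {3} = {0, 1, 2, 4, 5}" "pos - {4} = {0, 1, 2, 3, 5}" "pos - {5} = {0, 1, 2, 3, 4}" by auto
    have "(\<Sum>j\<in>pos. \<Prod>p\<in>pos - {j}. s i p (linked j p)) = (\<Sum>j\<in>{0,1,2,3,4,5}. \<Prod>p\<in>pos - {j}. s i p (linked j p))"
      by (simp only: pos_eq)
    also have "\<dots> = (\<Prod>p\<in>pos - {0}. s i p (linked 0 p)) + (\<Prod>p\<in>pos - {1}. s i p (linked 1 p))
       + (\<Prod>p\<in>pos - {2}. s i p (linked 2 p)) + (\<Prod>p\<in>pos - {3}. s i p (linked 3 p))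
       + (\<Prod>p\<in>pos - {4}. s i p (linked 4 p)) + (\<Prod>p\<in>pos - {5}. s i p (linked 5 p))" by simp
    also have "\<dots> = (z i)\<^sup>2 * z (partner i) ^ 3 + (2 * z i * m (partner i) ^ 3 + 3 * (m i)\<^sup>2 * (z (partner i))\<^sup>2)
        * (z (\<not> fst i, True) + z (\<not> fst i, False))"
      unfolding d by (simp add: linked_def s01 s235 s4 s01[of 0, simplified] s01[of 1, simplified] power2_eq_square power3_eq_cube) (simp add: algebra_simps)
    finally show "(\<Sum>j\<in>pos. \<Prod>p\<in>pos - {j}. s i p (linked j p)) = \<dots>" .
  qed
  finally show ?thesis unfolding m_def z_def .
qed

end

section \<open>Optimal graphs are ideal\<close>

context vertices begin

lemma mu_UN_le: "finite J \<Longrightarrow> mu (\<Union>j\<in>J. A j) \<le> (\<Sum>j\<in>J. mu (A j))"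
proof (induction J rule: finite_induct)
  case empty
  then show ?case by (simp add: mu_def)
next
  case (insert i J)
  have "mu (\<Union>j\<in>insert i J. A j) \<le> mu (A i) + mu (\<Union>j\<in>J. A j)" by (simp add: mu_Un_le)
  then show ?case using insert by simp
qed

lemma dens_ge:
  assumes "\<And>x. x \<in> X \<Longrightarrow> x \<in> W \<Longrightarrow> c \<le> mu {w. E x w}"
  shows "c * mu X \<le> dens E"
proof -
  have "c * mu X = av (\<lambda>x. c * of_bool (x \<in> X))" by (simp add: mu_def)
  also have "\<dots> \<le> av (\<lambda>x. mu {w. E x w})"
    by (rule av_mono) (use assms in \<open>auto simp: of_bool_def\<close>)
  finally show ?thesis by (simp add: dens_def mu_def)
qed

lemma deviation_mu:
  assumes "deviation (\<lambda>i. mu {w. f w = i \<and> adj x w}) (\<lambda>i. mu {w. f w = i \<and> \<not> adj x w}) i < e"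
  shows "mu {w. x \<noteq> w \<and> (adj x w \<longleftrightarrow> f w \<noteq> partner i)} < e"
    and "j \<noteq> partner i \<Longrightarrow> mu {w. f w = j \<and> adj x w} < e"
proof -
  let ?m = "\<lambda>i. mu {w. f w = i \<and> adj x w}" and ?z = "mu {w. f w = partner i \<and> \<not> adj x w}"
  have e: "?z + (\<Sum>j\<in>UNIV - {partner i}. ?m j) < e" using assms by (simp add: deviation_def)
  have "mu {w. x \<noteq> w \<and> (adj x w \<longleftrightarrow> f w \<noteq> partner i)} \<le> mu ({w. f w = partner i \<and> \<not> adj x w} \<union>
      (\<Union>j\<in>UNIV - {partner i}. {w. f w = j \<and> adj x w}))"
    by (rule mu_mono) auto
  also have "\<dots> \<le> ?z + mu (\<Union>j\<in>UNIV - {partner i}. {w. f w = j \<and> adj x w})" by (rule mu_Un_le)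
  also have "\<dots> \<le> ?z + (\<Sum>j\<in>UNIV - {partner i}. ?m j)" by (intro add_left_mono mu_UN_le) simp
  finally show "mu {w. x \<noteq> w \<and> (adj x w \<longleftrightarrow> f w \<noteq> partner i)} < e" using e by linarith
  assume "j \<noteq> partner i"
  then have "?m j \<le> (\<Sum>j\<in>UNIV - {partner i}. ?m j)" by (intro member_le_sum) auto
  moreover have "0 \<le> ?z" by simp
  ultimately show "?m j < e" using e by linarith
qed

end

context graph begin

text \<open>Move every vertex to the part of which it is nearly a clone. A vertex that moves was in a positive proportion of
  wrong pairs: it has few neighbours in the former partner part. Hence few vertices move, and afterwards all vertices
  are in few wrong pairs.\<close>

lemma reassignment:
  assumes wd: "wrong_density adj f \<le> eps" and sh: "\<And>i. \<bar>mu {x. f x = i} - share i\<bar> \<le> eps"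
    and small: "eps \<le> 1 / 10 ^ 10" "eta \<le> 1 / 10 ^ 9"
    and dev: "\<And>x. x \<in> W \<Longrightarrow>
      deviation (\<lambda>i. mu {w. f w = i \<and> adj x w}) (\<lambda>i. mu {w. f w = i \<and> \<not> adj x w}) (g x) < eta"
  shows "z \<in> W \<Longrightarrow> mu {w. wrong adj g z w} \<le> 3 / 10 ^ 9" and "1 / 20 \<le> mu {w. g w = i}"
proof -
  define X where "X = {x \<in> W. g x \<noteq> f x}"
  have share: "8 / 100 \<le> share i" for i using alpha_bounds by (simp add: share_def diff_divide_distrib)
  have "1 / 20 \<le> mu {w. wrong adj f x w}" if x: "x \<in> X" for x
  proof -
    let ?j = "partner (f x)"
    have xW: "x \<in> W" and ne: "?j \<noteq> partner (g x)" using x by (auto simp: X_def)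
    have "{w. f w = ?j} \<inter> W \<subseteq> {w. f w = ?j \<and> adj x w} \<union> {w. wrong adj f x w}" by (auto simp: wrong_def)
    then have "mu {w. f w = ?j} \<le> mu ({w. f w = ?j \<and> adj x w} \<union> {w. wrong adj f x w})" by (rule mu_mono)
    also have "\<dots> \<le> mu {w. f w = ?j \<and> adj x w} + mu {w. wrong adj f x w}" by (rule mu_Un_le)
    finally have "mu {w. f w = ?j} \<le> mu {w. f w = ?j \<and> adj x w} + mu {w. wrong adj f x w}" .
    moreover have "share ?j - eps \<le> mu {w. f w = ?j}" using sh[of ?j] by linarith
    moreover have "mu {w. f w = ?j \<and> adj x w} < eta" 
      by (rule deviation_mu(2)[where adj = adj and f = f and x = x and i = "g x", OF dev[OF xW] ne])
    ultimately show ?thesis using share[of ?j] small by simp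
  qed
  then have "1 / 20 * mu X \<le> wrong_density adj f" unfolding wrong_density_def by (rule dens_ge)
  then have X: "mu X \<le> 2 / 10 ^ 9" using wd small by simp
  show "mu {w. wrong adj g z w} \<le> 3 / 10 ^ 9" if z: "z \<in> W"
  proof -
    have "mu {w. wrong adj g z w} \<le> mu ({w. z \<noteq> w \<and> (adj z w \<longleftrightarrow> f w \<noteq> partner (g z))} \<union> X)"
      by (rule mu_mono) (auto simp: wrong_def X_def)
    also have "\<dots> \<le> mu {w. z \<noteq> w \<and> (adj z w \<longleftrightarrow> f w \<noteq> partner (g z))} + mu X" by (rule mu_Un_le)
    finally show ?thesis 
      using deviation_mu(1)[where adj = adj and f = f and x = z and i = "g z", OF dev[OF z]] X small by simp
  qed
  have "mu {w. f w = i} \<le> mu ({w. g w = i} \<union> X)" by (rule mu_mono) (auto simp: X_def)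
  also have "\<dots> \<le> mu {w. g w = i} + mu X" by (rule mu_Un_le)
  finally show "1 / 20 \<le> mu {w. g w = i}" using sh[of i] share[of i] small X by simp
qed

end

text \<open>The numbers satisfy \<open>930 * eta + 30 / n + 2 * k < c\<^sup>4\<close> as required by \<open>no_wrong_pairs\<close>, with \<open>c = 1 / 20\<close> below all
  part sizes.\<close>

theorem optimal_structure:
  "\<exists>k>0. \<exists>n0 :: real. \<forall>(W :: 'a set) adj. graph W adj \<longrightarrow> n0 \<le> real (card W) \<longrightarrow> vertices.optimal W k adj \<longrightarrow>
    Lam alpha - k \<le> 16 * vertices.emb_density W adj \<longrightarrow> (\<exists>f. \<forall>x\<in>W. \<forall>y\<in>W. \<not> wrong adj f x y)"
proof -
  define eta :: real where "eta = 1 / 10 ^ 9"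
  have "0 < eta" by (simp add: eta_def)
  then obtain k1 where k1: "0 < k1"
    "\<And>m z :: part \<Rightarrow> real. \<lbrakk>\<And>i. 0 \<le> m i; \<And>i. 0 \<le> z i; \<And>i. \<bar>m i + z i - share i\<bar> \<le> k1;
       6 * Lam alpha - k1 \<le> 16 * vertex_poly m z\<rbrakk> \<Longrightarrow> \<exists>i. deviation m z i < eta"
    by (rule near_maximal_vertex) blast
  \<comment> \<open>The error in the number of copies at a vertex will be \<open>38 * k + 480 / n + 2880 * eps\<close>, to be kept below \<open>k1\<close>.\<close>
  define eps where "eps = min (1 / 10 ^ 10) (k1 / 12000)"
  have eps: "0 < eps" "eps \<le> 1 / 10 ^ 10" "12000 * eps \<le> k1" using k1(1) by (auto simp: eps_def)
  obtain k2 where k2: "0 < k2"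
    "\<And>(W :: 'a set) adj. graph W adj \<Longrightarrow> Lam alpha - k2 \<le> 16 * vertices.emb_density W adj \<Longrightarrow>
    (\<exists>f. vertices.wrong_density W adj f \<le> eps \<and> (\<forall>i. \<bar>vertices.mu W {x. f x = i} - share i\<bar> \<le> eps))"
    using stability[OF eps(1), where ?'a = 'a] by blast
  define k where "k = min (1 / 10 ^ 6) (min k2 (k1 / 100))"
  have k: "0 < k" "k \<le> 1 / 10 ^ 6" "k \<le> k2" "100 * k \<le> k1" using k1(1) k2(1) by (auto simp: k_def)
  define n0 where "n0 = max (10 ^ 8) (1920 / k1)"
  show ?thesis
  proof (rule exI[of _ k], intro conjI k(1), rule exI[of _ n0], intro allI impI)
    fix W :: "'a set" and adj
    assume g: "graph W adj" and n0: "n0 \<le> real (card W)" and opt: "vertices.optimal W k adj"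
      and large: "Lam alpha - k \<le> 16 * vertices.emb_density W adj"
    interpret graph W adj by (rule g)
    have n: "10 ^ 8 \<le> n" "1920 / k1 \<le> n" using n0 by (simp_all add: n0_def)
    have inv_n: "30 / n \<le> 1 / 10 ^ 6" "30 / n \<le> k1 / 64"
    proof -
      show "30 / n \<le> 1 / 10 ^ 6" using n(1) n_pos by (simp add: divide_simps)
      have "1920 \<le> n * k1" using n(2) k1(1) by (simp add: divide_simps)
      then show "30 / n \<le> k1 / 64" using n_pos by (simp add: divide_simps mult.commute)
    qed
    obtain f where f: "wrong_density adj f \<le> eps" "\<And>i. \<bar>mu {x. f x = i} - share i\<bar> \<le> eps"
      using k2(2)[OF g] large k(3) by force
    have ex: "\<exists>i. deviation (\<lambda>i. mu {w. f w = i \<and> adj x w}) (\<lambda>i. mu {w. f w = i \<and> \<not> adj x w}) i < eta"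
      if x: "x \<in> W" for x
    proof (rule k1(2))
      fix i
      have "mu {w. f w = i \<and> adj x w} + mu {w. f w = i \<and> \<not> adj x w} = mu {w. f w = i}"
        unfolding mu_def av_add[symmetric] by (rule av_cong) auto
      then show "\<bar>mu {w. f w = i \<and> adj x w} + mu {w. f w = i \<and> \<not> adj x w} - share i\<bar> \<le> k1"
        using f(2)[of i] eps(3) eps(1) by simp
    next
      have "6 * emb_density adj - 30 / n - 2 * k \<le> n * pr (\<lambda>t. emb6 adj t \<and> x \<in> t ` pos)"
        unfolding emb_density_pr using opt k(1) x by (intro vertex_above_average) auto
      also have "\<dots> \<le> vertex_poly (\<lambda>i. mu {w. f w = i \<and> adj x w}) (\<lambda>i. mu {w. f w = i \<and> \<not> adj x w})
          + 180 * wrong_density adj f"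
        by (rule copies_at_vertex[OF x])
      finally show "6 * Lam alpha - k1
          \<le> 16 * vertex_poly (\<lambda>i. mu {w. f w = i \<and> adj x w}) (\<lambda>i. mu {w. f w = i \<and> \<not> adj x w})"
        using f(1) large inv_n k eps by linarith
    qed auto
    define g where "g x = (SOME i. deviation (\<lambda>i. mu {w. f w = i \<and> adj x w})
      (\<lambda>i. mu {w. f w = i \<and> \<not> adj x w}) i < eta)" for x
    have g: "deviation (\<lambda>i. mu {w. f w = i \<and> adj x w}) (\<lambda>i. mu {w. f w = i \<and> \<not> adj x w}) (g x) < eta"
      if "x \<in> W" for x
      unfolding g_def by (rule someI_ex[OF ex[OF that]])
    note re = reassignment[OF f eps(2) _ g, unfolded eta_def, OF order_refl, folded eta_def]
    have nw: "\<not> wrong adj g x y" if "x \<in> W" "y \<in> W" for x y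
    proof (rule no_wrong_pairs[OF opt _ re(1) re(2) _ _ that])
      show "930 * (3 / 10 ^ 9) + 30 / n + 2 * k < (1 / 20 :: real) ^ 4"
        using inv_n(1) k(2) by (simp add: power_divide)
    qed (use k in auto)
    show "\<exists>f. \<forall>x\<in>W. \<forall>y\<in>W. \<not> wrong adj f x y"
      by (intro exI[of _ g] ballI nw)
  qed
qed

section \<open>Densities of ideal graphs\<close>

definition ideal :: "('a \<Rightarrow> part) \<Rightarrow> 'a \<Rightarrow> 'a \<Rightarrow> bool" where
  "ideal f x y \<longleftrightarrow> f y = partner (f x)"

text \<open>The density of copies in a blowup with part sizes \<open>s\<close>, up to repeated vertices: the sum is over the part that
  hosts the side of size two.\<close>

definition ideal_density :: "(part \<Rightarrow> real) \<Rightarrow> real" where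
  "ideal_density s = (\<Sum>i\<in>UNIV. (s i)\<^sup>2 * (s (partner i)) ^ 3 * (s (\<not> fst i, True) + s (\<not> fst i, False)))"

lemma partner_sym: "j = partner i \<longleftrightarrow> i = partner j"
  by (auto simp: partner_def prod_eq_iff)

lemma not_wrong_ideal: "\<not> wrong (ideal f) f x y"
  by (simp add: wrong_def ideal_def)

context vertices begin

lemma graph_ideal: "graph W (ideal f)"
  by unfold_locales (auto simp: ideal_def partner_sym)

text \<open>The copies are exactly the tuples in a disjoint union of boxes, apart from those with repeated vertices.\<close>

lemma emb_density_ideal:
  "\<bar>emb_density (ideal f) - ideal_density (\<lambda>i. mu {w. f w = i})\<bar> \<le> 30 / n"
proof -
  interpret graph W "ideal f" by (rule graph_ideal)
  define s where "s i = mu {w. f w = i}" for i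
  let ?S = "\<lambda>i (p :: nat). {w \<in> W. if p = 4 then fst (f w) \<noteq> fst i else f w = (if p \<in> {0, 1} then i else partner i)}"
  have s4: "mu (?S i 4) = s (\<not> fst i, True) + s (\<not> fst i, False)" for i
  proof -
    have "mu (?S i 4) = mu ({w. f w = (\<not> fst i, True)} \<union> {w. f w = (\<not> fst i, False)})"
      by (intro mu_cong) (auto simp: prod_eq_iff)
    also have "\<dots> = s (\<not> fst i, True) + s (\<not> fst i, False)"
      unfolding s_def by (intro mu_Un_disjoint) auto
    finally show ?thesis .
  qed
  have s01: "mu (?S i p) = s i" if "p \<in> {0, 1}" for i p
    using that unfolding s_def by (auto intro!: mu_cong)
  have s235: "mu (?S i p) = s (partner i)" if "p \<in> {2, 3, 5}" for i p
    using that unfolding s_def by (auto intro!: mu_cong)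
  have box: "pr (\<lambda>t. \<exists>i\<in>UNIV. \<forall>p\<in>pos. t p \<in> ?S i p) = ideal_density s"
  proof -
    have "pr (\<lambda>t. \<exists>i\<in>UNIV. \<forall>p\<in>pos. t p \<in> ?S i p) = (\<Sum>i\<in>UNIV. pr (\<lambda>t. \<forall>p\<in>pos. t p \<in> ?S i p))"
    proof (rule pr_Ex_disjoint)
      fix i j :: part and t
      assume ij: "i \<noteq> j" and t: "\<forall>p\<in>pos. t p \<in> ?S i p" "\<forall>p\<in>pos. t p \<in> ?S j p"
      have "f (t 0) = i" "f (t 0) = j" using bspec[OF t(1), of 0] bspec[OF t(2), of 0] by auto
      then show False using ij by simp
    qed simp
    also have "\<dots> = (\<Sum>i\<in>UNIV. \<Prod>p\<in>pos. mu (?S i p))"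
      by (intro sum.cong refl pr_box) auto
    also have "\<dots> = ideal_density s"
      unfolding ideal_density_def
    proof (rule sum.cong[OF refl])
      fix i
      have "(\<Prod>p\<in>pos. mu (?S i p)) = (\<Prod>p\<in>{0,1,2,3,4,5}. mu (?S i p))" by (simp only: pos_eq)
      also have "\<dots> = mu (?S i 0) * mu (?S i 1) * mu (?S i 2) * mu (?S i 3) * mu (?S i 4) * mu (?S i 5)"
        by (simp add: mult.assoc)
      also have "\<dots> = (s i)\<^sup>2 * (s (partner i)) ^ 3 * (s (\<not> fst i, True) + s (\<not> fst i, False))"
        by (subst s01 s235 s4, simp)+ (simp add: power2_eq_square power3_eq_cube algebra_simps)
      finally show "(\<Prod>p\<in>pos. mu (?S i p)) = (s i)\<^sup>2 * (s (partner i)) ^ 3 * (s (\<not> fst i, True) + s (\<not> fst i, False))" .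
    qed
    finally show ?thesis .
  qed
  have "pr (emb6 (ideal f)) \<le> pr (\<lambda>t. \<exists>i\<in>UNIV. \<forall>p\<in>pos. t p \<in> ?S i p)"
  proof (rule pr_mono)
    fix t assume t: "t \<in> tuples" and e: "emb6 (ideal f) t"
    have r: "linked p q \<longleftrightarrow> f (t q) = partner (f (t p))" if "p \<in> pos" "q \<in> pos" for p q
      using emb6_linked[OF e that] by (simp add: ideal_def)
    have 1: "f (t p) = f (t 0)" if "p \<in> {0, 1}" for p
      using r[of 0 2] r[of 1 2] that by (auto simp: linked_def)
    have 2: "f (t p) = partner (f (t 0))" if "p \<in> {2, 3, 5}" for p
      using r[of 0 p] that by (auto simp: linked_def)
    have 3: "fst (f (t 4)) \<noteq> fst (f (t 0))"
      using r[of 4 0] r[of 4 2] r[of 0 2] by (auto simp: linked_def partner_def prod_eq_iff)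
    have "t p \<in> ?S (f (t 0)) p" if "p \<in> {0,1,2,3,4,5}" for p
      using that 1[of p] 2[of p] 3 PiE_mem[OF t, of p] by (elim insertE emptyE) simp_all
    then have "\<forall>p\<in>pos. t p \<in> ?S (f (t 0)) p" unfolding pos_eq by blast
    then show "\<exists>i\<in>UNIV. \<forall>p\<in>pos. t p \<in> ?S i p"
      by blast
  qed
  moreover have "pr (\<lambda>t. \<exists>i\<in>UNIV. \<forall>p\<in>pos. t p \<in> ?S i p) \<le> pr (emb6 (ideal f)) + 30 / n"
  proof -
    have "pr (\<lambda>t. \<exists>i\<in>UNIV. \<forall>p\<in>pos. t p \<in> ?S i p) \<le> pr (\<lambda>t. emb6 (ideal f) t \<or> (\<exists>(p, q)\<in>pairs. t p = t q))"
    proof (intro pr_mono disjCI)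
      fix t assume ex: "\<exists>i\<in>UNIV. \<forall>p\<in>pos. t p \<in> ?S i p" and ne: "\<not> (\<exists>(p, q)\<in>pairs. t p = t q)"
      obtain i where i: "\<forall>p\<in>pos. t p \<in> ?S i p" using ex by blast
      have k: "fst (f (t 4)) \<noteq> fst i" using bspec[OF i, of 4] by simp
      show "emb6 (ideal f) t"
      proof (rule emb6_role[OF _ _ k])
        fix p assume "p \<in> pos"
        then show "f (t p) = role i (f (t 4)) p" using bspec[OF i, of p] by (auto simp: role_def split: if_splits)
      qed (use ne in \<open>auto simp: pairs_def not_wrong_ideal\<close>)
    qed
    also have "\<dots> \<le> pr (emb6 (ideal f)) + pr (\<lambda>t. \<exists>(p, q)\<in>pairs. t p = t q)" by (rule pr_union)
    also have "pr (\<lambda>t. \<exists>(p, q)\<in>pairs. t p = t q) \<le> 30 * (1 / n)"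
    proof (rule pr_Ex_pairs)
      fix p q assume pq: "(p, q) \<in> pairs"
      have "dens (\<lambda>u w. u = w) \<le> 1 / n"
        by (rule dens_le) (simp add: mu_point)
      then show "pr (\<lambda>t. t p = t q) \<le> 1 / n" using pq by (subst pr_pair) (auto simp: pairs_def)
    qed auto
    finally show ?thesis by simp
  qed
  ultimately show ?thesis unfolding emb_density_pr box s_def by linarith
qed

end

text \<open>Round the part sizes down and give the rest, which is at most four, to one part.\<close>

lemma exists_partition:
  fixes s :: "part \<Rightarrow> real" and W :: "'a set"
  assumes s: "\<And>i. 0 \<le> s i" "(\<Sum>i\<in>UNIV. s i) = 1" and fin: "finite W"
  shows "\<exists>f. \<forall>i. \<bar>real (card {w \<in> W. f w = i}) - s i * real (card W)\<bar> \<le> 4"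
proof -
  define N where "N = card W"
  define l where "l i = nat \<lfloor>s i * real N\<rfloor>" for i
  have l: "real (l i) \<le> s i * real N" "s i * real N - 1 \<le> real (l i)" for i
    using s(1)[of i] by (simp_all add: l_def)
  have sumN: "(\<Sum>i\<in>UNIV. s i * real N) = real N" using s(2) by (simp add: sum_distrib_right[symmetric])
  have "real (\<Sum>i\<in>UNIV. l i) \<le> (\<Sum>i\<in>UNIV. s i * real N)" unfolding of_nat_sum by (intro sum_mono l)
  then have L1: "(\<Sum>i\<in>UNIV. l i) \<le> N"
    unfolding sumN of_nat_le_iff .
  have "(\<Sum>i\<in>UNIV. s i * real N - 1) \<le> real (\<Sum>i\<in>UNIV. l i)" unfolding of_nat_sum by (intro sum_mono l)
  then have L2: "real N - 4 \<le> real (\<Sum>i\<in>UNIV. l i)" 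
    unfolding sum_subtractf sumN by (simp add: UNIV_part)
  define T where "T = (\<Sum>i\<in>UNIV. l i)"
  note L = L1[folded T_def] L1[folded T_def of_nat_le_iff[where ?'a = real]] L2[folded T_def]
  define k where "k i = l i + (if i = (True, True) then N - T else 0)" for i
  have ksum: "(\<Sum>i\<in>UNIV. k i) = N" using L(1) by (simp add: k_def sum.distrib T_def)
  have kdev: "\<bar>real (k i) - s i * real N\<bar> \<le> 4" for i
    using l[of i] L by (cases "i = (True, True)") (simp_all add: k_def of_nat_diff)
  define D where "D = Sigma UNIV (\<lambda>i. {..<k i})"
  have "card D = N" unfolding D_def using ksum by simp
  then obtain h where h: "bij_betw h W D"
    using finite_same_card_bij[OF fin, of D] by (auto simp: N_def D_def)
  have "card {w \<in> W. fst (h w) = i} = k i" for i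
  proof -
    have "bij_betw h {w \<in> W. fst (h w) = i} {d \<in> D. fst d = i}"
      using h unfolding bij_betw_def inj_on_def by auto
    then have "card {w \<in> W. fst (h w) = i} = card {d \<in> D. fst d = i}" by (rule bij_betw_same_card)
    also have "{d \<in> D. fst d = i} = Pair i ` {..<k i}" by (auto simp: D_def)
    also have "card (Pair i ` {..<k i}) = k i" by (subst card_image) (auto simp: inj_on_def)
    finally show ?thesis .
  qed
  then show ?thesis using kdev by (intro exI[of _ "\<lambda>w. fst (h w)"]) (simp add: N_def)
qed

lemma ideal_density_share: "16 * ideal_density share = Lam alpha"
  unfolding ideal_density_def UNIV_part
  by (simp add: partner_def share_def Lam_def power_divide power2_eq_square power3_eq_cube)
    (simp add: power_def numeral_eq_Suc field_simps)

lemma ideal_density_mono: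
  assumes "\<And>i. 0 \<le> s i" "\<And>i. s i \<le> s' i"
  shows "ideal_density s \<le> ideal_density s'"
  unfolding ideal_density_def using assms order_trans[OF assms]
  by (intro sum_mono mult_mono add_mono power_mono mult_nonneg_nonneg add_nonneg_nonneg zero_le_power) auto

lemma ideal_density_scale: "ideal_density (\<lambda>i. c * s i) = c ^ 6 * ideal_density s"
  unfolding ideal_density_def sum_distrib_left
  by (intro sum.cong refl) (simp add: power_mult_distrib power_def numeral_eq_Suc algebra_simps)

definition lower_bound :: "real \<Rightarrow> real" where
  "lower_bound n = (1 - 50 / n) ^ 6 * (Lam alpha / 16) - 30 / n"

text \<open>All shares are at least \<open>8 / 100\<close>, so rounding by four vertices decreases them by a factor of at most
  \<open>1 - 50 / n\<close>; the density is homogeneous of degree six and monotone.\<close>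

lemma exists_good_ideal:
  assumes v: "vertices (W :: 'a set)" and n: "50 \<le> real (card W)"
  shows "\<exists>f. lower_bound (card W) \<le> vertices.emb_density W (ideal f)"
proof -
  interpret vertices W by (rule v)
  have "0 \<le> share i" for i using alpha_bounds by (simp add: share_def)
  moreover have "(\<Sum>i\<in>UNIV. share i) = 1" unfolding UNIV_part by (simp add: share_def diff_divide_distrib)
  ultimately obtain f where f: "\<And>i. \<bar>real (card {w \<in> W. f w = i}) - share i * n\<bar> \<le> 4"
    using exists_partition[of share W] fin by blast
  define s where "s i = mu {w. f w = i}" for i
  have s: "s i = real (card {w \<in> W. f w = i}) / n" for i
    using mu_card[of "{w \<in> W. f w = i}"] mu_cong[of "{w. f w = i}" "{w \<in> W. f w = i}"] by (auto simp: s_def)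
  have "(1 - 50 / n) * share i \<le> s i" for i
  proof -
    have "8 / 100 \<le> share i" using alpha_bounds by (simp add: share_def diff_divide_distrib)
    then have "(n - 50) * share i \<le> share i * n - 4" by (simp add: algebra_simps)
    also have "\<dots> \<le> real (card {w \<in> W. f w = i})" using f[of i] by linarith
    finally have "(n - 50) * share i / n \<le> s i" unfolding s by (intro divide_right_mono) auto
    moreover have "(n - 50) * share i / n = (1 - 50 / n) * share i" using n_pos by (simp add: field_simps)
    ultimately show ?thesis by simp
  qed
  moreover have "0 \<le> (1 - 50 / n) * share i" for i
    using n alpha_bounds by (intro mult_nonneg_nonneg) (auto simp: share_def divide_simps)
  ultimately have "ideal_density (\<lambda>i. (1 - 50 / n) * share i) \<le> ideal_density s"
    by (intro ideal_density_mono)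
  then have "(1 - 50 / n) ^ 6 * (Lam alpha / 16) \<le> ideal_density s"
    unfolding ideal_density_scale ideal_density_share[symmetric] by simp
  then have "lower_bound n \<le> emb_density (ideal f)"
    using emb_density_ideal[of f] unfolding lower_bound_def s_def by linarith
  then show ?thesis by blast
qed

lemma lower_bound_limit: "(\<lambda>n. lower_bound (real n)) \<longlonglongrightarrow> Lam alpha / 16"
proof -
  have "(\<lambda>n. (1 - 50 / real n) ^ 6 * (Lam alpha / 16) - 30 / real n) \<longlonglongrightarrow> (1 - 0) ^ 6 * (Lam alpha / 16) - 0"
    by (intro tendsto_intros lim_const_over_n)
  then show ?thesis by (simp add: lower_bound_def)
qed

section \<open>Induced copies and tuples\<close>

abbreviation adj_of :: "'a pattern \<Rightarrow> 'a \<Rightarrow> 'a \<Rightarrow> bool" where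
  "adj_of G x y \<equiv> {x, y} \<in> edges G"

definition graph_of :: "'a set \<Rightarrow> ('a \<Rightarrow> 'a \<Rightarrow> bool) \<Rightarrow> 'a pattern" where
  "graph_of W adj = (W, {{x, y} | x y. x \<in> W \<and> y \<in> W \<and> adj x y})"

lemma graph_adj_of:
  assumes "simple_graph G" "verts G \<noteq> {}" shows "graph (verts G) (adj_of G)"
proof
  show "finite (verts G)" "verts G \<noteq> {}" using assms by (auto simp: simple_graph_def)
  show "\<not> adj_of G x x" for x using assms(1) by (force simp: simple_graph_def)
  show "adj_of G x y \<Longrightarrow> adj_of G y x" for x y by (simp add: insert_commute)
qed

lemma F36_edges: "{p, q} \<in> edges F36 \<longleftrightarrow> linked p q"
  unfolding F36_def linked_def by (auto simp: doubleton_eq_iff)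

lemma emb6_linked_iff:
  assumes g: "graph W adj" and inj: "inj_on t pos"
  shows "emb6 adj t \<longleftrightarrow> (\<forall>p\<in>pos. \<forall>q\<in>pos. adj (t p) (t q) \<longleftrightarrow> linked p q)"
proof
  show "emb6 adj t \<Longrightarrow> \<forall>p\<in>pos. \<forall>q\<in>pos. adj (t p) (t q) \<longleftrightarrow> linked p q"
    using graph.emb6_linked[OF g] by blast
next
  assume l: "\<forall>p\<in>pos. \<forall>q\<in>pos. adj (t p) (t q) \<longleftrightarrow> linked p q"
  have "t p \<noteq> t q" if "p \<in> pos" "q \<in> pos" "p \<noteq> q" for p q using inj that by (auto simp: inj_on_def)
  then show "emb6 adj t" unfolding emb6_def emb_def using l by (simp add: linked_def)
qed

text \<open>The automorphisms of \<open>F36\<close>. The positions themselves, with \<open>linked\<close>, are treated as a graph.\<close>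

definition symmetries :: "(nat \<Rightarrow> nat) set" where
  "symmetries = {s \<in> PiE pos (\<lambda>_. pos). emb6 linked s}"

lemma pos_nonempty: "pos \<noteq> {}"
  unfolding pos_eq by simp

lemma graph_linked: "graph pos linked"
  by unfold_locales (use pos_nonempty in \<open>auto simp: linked_def\<close>)

lemma linked_sides:
  "linked p q \<Longrightarrow> p \<in> {0, 1} \<Longrightarrow> q \<in> {2, 3, 5}" "linked p q \<Longrightarrow> p \<notin> {0, 1} \<Longrightarrow> q \<in> {0, 1}"
  "linked p q \<Longrightarrow> q \<in> {2, 3, 5} \<Longrightarrow> p \<in> {0, 1}"
  by (auto simp: linked_def)

lemma symmetries_inj: "s \<in> symmetries \<Longrightarrow> inj_on s pos"
  using graph.emb6_distinct[OF graph_linked] by (auto simp: symmetries_def inj_on_def)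

lemma symmetries_image: "s \<in> symmetries \<Longrightarrow> s ` pos = pos"
  using symmetries_inj[of s] by (intro endo_inj_surj) (auto simp: symmetries_def)

text \<open>The isolated vertex is fixed and the two sides, being of different size, are permuted separately.\<close>

lemma card_symmetries: "card symmetries = 12"
proof -
  let ?T = "{(2, 3, 5), (2, 5, 3), (3, 2, 5), (3, 5, 2), (5, 2, 3), (5, 3, 2)} :: (nat \<times> nat \<times> nat) set"
  let ?P = "{(0, 1), (1, 0)} :: (nat \<times> nat) set"
  define h where "h s = ((s 0, s 1), (s 2, s 3, s (5 :: nat)))" for s :: "nat \<Rightarrow> nat"
  have shape: "s 4 = 4 \<and> (s 0, s 1) \<in> ?P \<and> (s 2, s 3, s 5) \<in> ?T" if s: "s \<in> symmetries" for s
  proof -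
    have l: "linked (s p) (s q) \<longleftrightarrow> linked p q" if "p \<in> pos" "q \<in> pos" for p q
      using graph.emb6_linked[OF graph_linked, of s p q] s that by (auto simp: symmetries_def)
    have ne: "s p \<noteq> s q" if "p \<in> pos" "q \<in> pos" "p \<noteq> q" for p q
      using symmetries_inj[OF s] that by (auto simp: inj_on_def)
    have d: "s 0 \<noteq> s 1" "s 2 \<noteq> s 3" "s 2 \<noteq> s 5" "s 3 \<noteq> s 5" by (intro ne; simp)+
    have a: "linked (s 0) (s 2)" "linked (s 0) (s 3)" "linked (s 0) (s 5)" "linked (s 1) (s 2)"
      by (subst l; simp add: linked_def)+
    have s0: "s 0 \<in> {0, 1}"
    proof (rule ccontr)
      assume "s 0 \<notin> {0, 1}"
      then have "s 2 \<in> {0, 1}" "s 3 \<in> {0, 1}" "s 5 \<in> {0, 1}" using a linked_sides(2) by blast+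
      then show False using d by auto
    qed
    then have big: "s 2 \<in> {2, 3, 5}" "s 3 \<in> {2, 3, 5}" "s 5 \<in> {2, 3, 5}" using a linked_sides(1) by blast+
    then have s1: "s 1 \<in> {0, 1}" using a(4) linked_sides(3) by blast
    have T: "(s 2, s 3, s 5) \<in> ?T" using big d(2-) by (elim insertE emptyE) simp_all
    moreover have P: "(s 0, s 1) \<in> ?P" using s0 s1 d(1) by (elim insertE emptyE) simp_all
    moreover have "s 4 = 4"
    proof -
      have "s 4 \<in> pos" using s by (auto simp: symmetries_def PiE_iff)
      moreover have "s 4 \<noteq> s 0" "s 4 \<noteq> s 1" "s 4 \<noteq> s 2" "s 4 \<noteq> s 3" "s 4 \<noteq> s 5" by (intro ne; simp)+
      moreover have "s 0 = 0 \<and> s 1 = 1 \<or> s 0 = 1 \<and> s 1 = 0" using P by simp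
      moreover have "{s 2, s 3, s 5} = {2, 3, 5}" using T by (elim insertE emptyE) (simp_all add: insert_commute)
      ultimately have "s 4 \<notin> {0, 1}" "s 4 \<notin> {2, 3, 5}" "s 4 \<in> pos" by (metis insertE singletonD)+
      then show ?thesis unfolding pos_eq by simp
    qed
    ultimately show ?thesis by blast
  qed
  have "inj_on h symmetries"
  proof (rule inj_onI)
    fix s u assume su: "s \<in> symmetries" "u \<in> symmetries" and eq: "h s = h u"
    show "s = u"
    proof (rule PiE_ext)
      show "s \<in> PiE pos (\<lambda>_. pos)" "u \<in> PiE pos (\<lambda>_. pos)" using su by (auto simp: symmetries_def)
      fix p assume "p \<in> pos"
      then have "p \<in> {0,1,2,3,4,5}" by auto
      then show "s p = u p" using eq shape[OF su(1)] shape[OF su(2)] unfolding h_def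
        by (elim insertE emptyE) simp_all
    qed
  qed
  moreover have "h ` symmetries = ?P \<times> ?T"
  proof
    show "h ` symmetries \<subseteq> ?P \<times> ?T" using shape unfolding h_def by blast
    show "?P \<times> ?T \<subseteq> h ` symmetries"
    proof
      fix e assume e: "e \<in> ?P \<times> ?T"
      then obtain a b c d f where abc: "e = ((a, b), (c, d, f))" "(a, b) \<in> ?P" "(c, d, f) \<in> ?T" by auto
      define s where "s = (\<lambda>p\<in>pos. if p = 0 then a else if p = 1 then b else if p = 2 then c
        else if p = 3 then d else if p = 4 then 4 else f)"
      have sv: "s 0 = a" "s 1 = b" "s 2 = c" "s 3 = d" "s 4 = 4" "s 5 = f" by (simp_all add: s_def)
      have ab: "a \<in> {0, 1}" "b \<in> {0, 1}" "a \<noteq> b" using abc(2) by auto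
      have cdf: "c \<in> {2, 3, 5}" "d \<in> {2, 3, 5}" "f \<in> {2, 3, 5}" "c \<noteq> d" "c \<noteq> f" "d \<noteq> f" using abc(3) by auto
      have "s \<in> PiE pos (\<lambda>_. pos)" unfolding s_def using ab(1,2) cdf(1-3) by (intro restrict_PiE_iff[THEN iffD2]) auto
      moreover have "emb6 linked s" unfolding emb6_def emb_def sv linked_def using ab cdf by auto
      ultimately have "s \<in> symmetries" by (simp add: symmetries_def)
      moreover have "h s = e" unfolding h_def sv abc(1) ..
      ultimately show "e \<in> h ` symmetries" by blast
    qed
  qed
  ultimately have "card symmetries = card (?P \<times> ?T)" using card_image by metis
  then show ?thesis unfolding card_cartesian_product by simp
qed

lemma isomorphic_F36_iff:
  assumes g: "simple_graph G" and S: "S \<subseteq> verts G" "S \<noteq> {}"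
  shows "isomorphic F36 (induced G S) \<longleftrightarrow>
    (\<exists>t. t \<in> PiE pos (\<lambda>_. verts G) \<and> emb6 (adj_of G) t \<and> t ` pos = S)"
proof -
  have gr: "graph (verts G) (adj_of G)" using S by (intro graph_adj_of[OF g]) auto
  have v: "verts F36 = pos" by (simp add: F36_def)
  have ind: "{x, y} \<in> edges (induced G S) \<longleftrightarrow> {x, y} \<in> edges G" if "x \<in> S" "y \<in> S" for x y
    using that by (simp add: induced_def)
  show ?thesis
  proof
    assume "isomorphic F36 (induced G S)"
    then obtain h where h: "bij_betw h pos S"
      "\<forall>p\<in>pos. \<forall>q\<in>pos. {p, q} \<in> edges F36 \<longleftrightarrow> {h p, h q} \<in> edges (induced G S)"
      unfolding isomorphic_def isomorphism_def v by (auto simp: induced_def)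
    have hS: "h p \<in> S" if "p \<in> pos" for p using h(1) that by (auto simp: bij_betw_def)
    define t where "t = restrict h pos"
    have tp: "t p = h p" if "p \<in> pos" for p using that by (simp add: t_def)
    have im: "t ` pos = S" using h(1) tp by (auto simp: bij_betw_def)
    moreover have "t \<in> PiE pos (\<lambda>_. verts G)" unfolding t_def using hS S(1) by auto
    moreover have "inj_on t pos" using h(1) tp by (auto simp: bij_betw_def inj_on_def)
    then have "emb6 (adj_of G) t"
      unfolding emb6_linked_iff[OF gr \<open>inj_on t pos\<close>] using h(2) hS tp F36_edges ind by simp
    ultimately show "\<exists>t. t \<in> PiE pos (\<lambda>_. verts G) \<and> emb6 (adj_of G) t \<and> t ` pos = S" by blast
  next
    assume "\<exists>t. t \<in> PiE pos (\<lambda>_. verts G) \<and> emb6 (adj_of G) t \<and> t ` pos = S"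
    then obtain t where t: "emb6 (adj_of G) t" "t ` pos = S" by blast
    have inj: "inj_on t pos" using graph.emb6_distinct[OF gr t(1)] by (auto simp: inj_on_def)
    have "isomorphism t F36 (induced G S)"
      unfolding isomorphism_def v
    proof (intro conjI ballI)
      show "bij_betw t pos (verts (induced G S))" using inj t(2) by (simp add: bij_betw_def induced_def)
      fix p q assume pq: "p \<in> pos" "q \<in> pos"
      then show "{p, q} \<in> edges F36 \<longleftrightarrow> {t p, t q} \<in> edges (induced G S)"
        using graph.emb6_linked[OF gr t(1) pq] t(2) ind[of "t p" "t q"] by (auto simp: F36_edges)
    qed
    then show "isomorphic F36 (induced G S)" by (auto simp: isomorphic_def)
  qed
qed

text \<open>Two tuples with the same image differ by an automorphism of \<open>F36\<close>.\<close>

lemma card_same_image: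
  assumes g: "graph W adj" and t0: "t0 \<in> PiE pos (\<lambda>_. W)" "emb6 adj t0"
  shows "card {t \<in> PiE pos (\<lambda>_. W). emb6 adj t \<and> t ` pos = t0 ` pos} = 12"
proof -
  have inj0: "inj_on t0 pos" using graph.emb6_distinct[OF g t0(2)] by (auto simp: inj_on_def)
  have l0: "adj (t0 p) (t0 q) \<longleftrightarrow> linked p q" if "p \<in> pos" "q \<in> pos" for p q
    using graph.emb6_linked[OF g t0(2) that] .
  define F where "F s = (\<lambda>p\<in>pos. t0 (s p))" for s :: "nat \<Rightarrow> nat"
  have "bij_betw F symmetries {t \<in> PiE pos (\<lambda>_. W). emb6 adj t \<and> t ` pos = t0 ` pos}"
  proof (rule bij_betw_imageI)
    show "inj_on F symmetries"
    proof (rule inj_onI)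
      fix s u assume su: "s \<in> symmetries" "u \<in> symmetries" and eq: "F s = F u"
      show "s = u"
      proof (rule PiE_ext)
        show su': "s \<in> PiE pos (\<lambda>_. pos)" "u \<in> PiE pos (\<lambda>_. pos)" using su by (auto simp: symmetries_def)
        fix p assume p: "p \<in> pos"
        have "F s p = F u p" by (simp only: eq)
        then have "t0 (s p) = t0 (u p)" using p by (simp add: F_def)
        then show "s p = u p" using inj0 PiE_mem[OF su'(1) p] PiE_mem[OF su'(2) p] by (auto dest: inj_onD)
      qed
    qed
    show "F ` symmetries = {t \<in> PiE pos (\<lambda>_. W). emb6 adj t \<and> t ` pos = t0 ` pos}"
    proof (intro equalityI subsetI)
      fix t assume "t \<in> F ` symmetries"
      then obtain s where s: "s \<in> symmetries" "t = F s" by blast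
      have sP: "s \<in> PiE pos (\<lambda>_. pos)" "emb6 linked s" using s(1) by (auto simp: symmetries_def)
      have tp: "t p = t0 (s p)" if "p \<in> pos" for p using that by (simp add: s(2) F_def)
      have "t \<in> PiE pos (\<lambda>_. W)"
        unfolding s(2) F_def using PiE_mem[OF sP(1)] PiE_mem[OF t0(1)] by (intro restrict_PiE_iff[THEN iffD2]) blast
      moreover have "emb6 adj t \<longleftrightarrow> emb6 linked s"
        unfolding emb6_def emb_def
        using PiE_mem[OF sP(1)] inj_on_eq_iff[OF inj0] by (simp add: tp l0)
      moreover have "t ` pos = t0 ` pos"
      proof -
        have "t ` pos = t0 ` s ` pos" using tp by (auto simp: image_image)
        then show ?thesis using symmetries_image[OF s(1)] by simp
      qed
      ultimately show "t \<in> {t \<in> PiE pos (\<lambda>_. W). emb6 adj t \<and> t ` pos = t0 ` pos}" using sP by simp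
    next
      fix t assume "t \<in> {t \<in> PiE pos (\<lambda>_. W). emb6 adj t \<and> t ` pos = t0 ` pos}"
      then have t: "t \<in> PiE pos (\<lambda>_. W)" "emb6 adj t" "t ` pos = t0 ` pos" by auto
      define s where "s = (\<lambda>p\<in>pos. inv_into pos t0 (t p))"
      have s: "s p \<in> pos" "t0 (s p) = t p" if "p \<in> pos" for p
      proof -
        have "t p \<in> t0 ` pos" using t(3) that by blast
        then show "s p \<in> pos" "t0 (s p) = t p" using that inv_into_into[of "t p" t0 pos]
          by (simp_all add: s_def f_inv_into_f)
      qed
      have "emb6 adj t \<longleftrightarrow> emb6 linked s"
        unfolding emb6_def emb_def using s(1) inj_on_eq_iff[OF inj0] by (simp add: s(2)[symmetric] l0)
      moreover have "s \<in> PiE pos (\<lambda>_. pos)" using s(1) by (auto simp: s_def)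
      ultimately have "s \<in> symmetries" using t(2) by (simp add: symmetries_def)
      moreover have "F s = t"
        by (rule PiE_ext[OF _ t(1)]) (use s PiE_mem[OF t(1)] in \<open>auto simp: F_def\<close>)
      ultimately show "t \<in> F ` symmetries" by blast
    qed
  qed
  from bij_betw_same_card[OF this] show ?thesis by (simp add: card_symmetries)
qed

lemma density_F36:
  assumes g: "simple_graph G" and ne: "verts G \<noteq> {}"
  shows "Defs.density F36 G = real (card (verts G)) ^ 6 * vertices.emb_density (verts G) (adj_of G)
    / (12 * real (card (verts G) choose 6))"
proof -
  interpret graph "verts G" "adj_of G" by (rule graph_adj_of[OF g ne])
  let ?T = "{t \<in> tuples. emb6 (adj_of G) t}"
  let ?S = "{S. S \<subseteq> verts G \<and> card S = card (verts F36) \<and> isomorphic F36 (induced G S)}"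
  have S: "?S = (\<lambda>t. t ` pos) ` ?T"
  proof (intro equalityI subsetI)
    fix S assume "S \<in> ?S"
    then have S: "S \<subseteq> verts G" "card S = 6" "isomorphic F36 (induced G S)" by (auto simp: F36_def)
    then have "S \<noteq> {}" by auto
    then show "S \<in> (\<lambda>t. t ` pos) ` ?T" using S isomorphic_F36_iff[OF g S(1)] by blast
  next
    fix S assume "S \<in> (\<lambda>t. t ` pos) ` ?T"
    then obtain t where t: "t \<in> tuples" "emb6 (adj_of G) t" "S = t ` pos" by blast
    have "inj_on t pos" using emb6_distinct[OF t(2)] by (auto simp: inj_on_def)
    then have "card S = 6" unfolding t(3) by (simp add: card_image)
    moreover have "S \<subseteq> verts G" using t(1,3) by auto
    moreover have "S \<noteq> {}" using t(3) pos_nonempty by simp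
    ultimately show "S \<in> ?S" using t isomorphic_F36_iff[OF g \<open>S \<subseteq> verts G\<close>] by (auto simp: F36_def)
  qed
  have "card ?T = (\<Sum>S\<in>?S. card {t \<in> ?T. t ` pos = S})"
    using sum.image_gen[of ?T "\<lambda>_. 1 :: nat" "\<lambda>t. t ` pos"] unfolding S by simp
  also have "\<dots> = (\<Sum>S\<in>?S. 12)"
  proof (rule sum.cong[OF refl])
    fix S assume "S \<in> ?S"
    then obtain t where t: "t \<in> tuples" "emb6 (adj_of G) t" "S = t ` pos" unfolding S by blast
    have "{t \<in> ?T. t ` pos = S} = {t' \<in> tuples. emb6 (adj_of G) t' \<and> t' ` pos = t ` pos}" using t(3) by auto
    then show "card {t \<in> ?T. t ` pos = S} = 12" using card_same_image[OF graph_axioms t(1,2)] by simp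
  qed
  finally have "real (card ?T) = 12 * real (card ?S)" by simp
  moreover have "n ^ 6 * emb_density (adj_of G) = real (card ?T)"
    unfolding emb_density_pr pr_def using n_pos by simp
  ultimately show ?thesis unfolding Defs.density_def by (simp add: F36_def)
qed

lemma simple_graph_of: "graph W adj \<Longrightarrow> simple_graph (graph_of W adj)"
proof -
  assume "graph W adj"
  then interpret graph W adj .
  show ?thesis
    unfolding simple_graph_def graph_of_def using fin irr by (auto simp: card_insert_if)
qed

lemma verts_graph_of [simp]: "verts (graph_of W adj) = W"
  by (simp add: graph_of_def)

lemma adj_of_graph_of:
  assumes "graph W adj" "x \<in> W" "y \<in> W" shows "adj_of (graph_of W adj) x y \<longleftrightarrow> adj x y"
  using assms graph.adj_commute[OF assms(1)] by (auto simp: graph_of_def doubleton_eq_iff)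

lemma graph_of_adj_of:
  assumes "simple_graph G" shows "graph_of (verts G) (adj_of G) = G"
proof -
  have "{{x, y} | x y. x \<in> verts G \<and> y \<in> verts G \<and> adj_of G x y} = edges G"
  proof (intro equalityI subsetI)
    fix e assume e: "e \<in> edges G"
    then have "e \<subseteq> verts G" "card e = 2" using assms by (auto simp: simple_graph_def)
    then show "e \<in> {{x, y} | x y. x \<in> verts G \<and> y \<in> verts G \<and> adj_of G x y}"
      using e by (auto simp: card_2_iff)
  qed auto
  then show ?thesis by (simp add: graph_of_def prod_eq_iff)
qed

lemma emb_density_graph_of:
  assumes g: "graph W adj"
  shows "vertices.emb_density W (adj_of (graph_of W adj)) = vertices.emb_density W adj"
proof -
  interpret graph W adj by (rule g)
  show ?thesis unfolding emb_density_pr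
    by (intro pr_cong emb6_cong adj_of_graph_of[OF g]) (auto simp: PiE_iff)
qed

section \<open>The limit density\<close>

text \<open>The maximum in \<open>max_density\<close> is over a finite set, hence attained.\<close>

lemma finite_densities:
  "finite {Defs.density F G | G :: nat pattern. simple_graph G \<and> card (verts G) = N}"
proof (rule finite_subset)
  show "finite ((\<lambda>k. real k / real (N choose card (verts F))) ` {..2 ^ N})" by simp
  show "{Defs.density F G | G :: nat pattern. simple_graph G \<and> card (verts G) = N}
    \<subseteq> (\<lambda>k. real k / real (N choose card (verts F))) ` {..2 ^ N}"
  proof clarify
    fix G :: "nat pattern"
    assume G: "simple_graph G" "N = card (verts G)"
    have "card {S. S \<subseteq> verts G \<and> card S = card (verts F) \<and> isomorphic F (induced G S)} \<le> card (Pow (verts G))"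
      using G(1) by (intro card_mono) (auto simp: simple_graph_def)
    also have "\<dots> = 2 ^ card (verts G)" using G(1) by (intro card_Pow) (auto simp: simple_graph_def)
    finally show "Defs.density F G \<in> (\<lambda>k. real k / real (card (verts G) choose card (verts F))) ` {..2 ^ card (verts G)}"
      unfolding Defs.density_def by auto
  qed
qed

lemma density_le_max:
  fixes G :: "nat pattern"
  shows "simple_graph G \<Longrightarrow> Defs.density F G \<le> max_density F (card (verts G))"
  unfolding max_density_def by (rule Max_ge[OF finite_densities], rule CollectI, rule exI[of _ G]) simp

lemma max_density_attained:
  "\<exists>G :: nat pattern. simple_graph G \<and> card (verts G) = N \<and> Defs.density F G = max_density F N"
proof -
  have "simple_graph ({..<N}, {})" by (simp add: simple_graph_def)
  then have "{Defs.density F G | G :: nat pattern. simple_graph G \<and> card (verts G) = N} \<noteq> {}"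
    by (auto intro!: exI[of _ "({..<N}, {})"])
  from Max_in[OF finite_densities this] show ?thesis unfolding max_density_def mem_Collect_eq by metis
qed

text \<open>The factor between densities of induced copies and of tuples. It tends to \<open>6! / 12 = 60\<close>.\<close>

definition scale :: "nat \<Rightarrow> real" where
  "scale N = real N ^ 6 / (12 * real (N choose 6))"

lemma density_scale:
  assumes "simple_graph G" "verts G \<noteq> {}"
  shows "Defs.density F36 G = scale (card (verts G)) * vertices.emb_density (verts G) (adj_of G)"
  using density_F36[OF assms] by (simp add: scale_def)

lemma scale_ge_1: assumes "6 \<le> N" shows "1 \<le> scale N"
proof -
  have "(N choose 6) * fact 6 \<le> N ^ 6" by (rule binomial_fact_pow)
  then have "12 * (N choose 6) \<le> N ^ 6" by (simp add: fact_numeral)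
  then have "real (12 * (N choose 6)) \<le> real (N ^ 6)" by (rule of_nat_mono)
  moreover have "0 < N choose 6" using assms by simp
  ultimately show ?thesis unfolding scale_def by (simp add: divide_simps)
qed

lemma scale_limit: "scale \<longlonglongrightarrow> 60"
proof -
  have eq: "scale N = 60 / (\<Prod>i<6. 1 - real i / real N)" if N: "0 < N" for N
  proof -
    have "(\<Prod>i<6. real N - real i) = (\<Prod>i<(6::nat). real N * (1 - real i / real N))"
      using N by (intro prod.cong) (auto simp: field_simps)
    also have "\<dots> = real N ^ 6 * (\<Prod>i<6. 1 - real i / real N)" by (simp add: prod.distrib)
    finally have C: "real (N choose 6) = real N ^ 6 * (\<Prod>i<6. 1 - real i / real N) / fact 6"
      unfolding binomial_gbinomial gbinomial_prod_rev atLeast0LessThan by simp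
    show ?thesis using N unfolding scale_def C by (simp add: fact_numeral)
  qed
  have "(\<lambda>N. 60 / (\<Prod>i<(6::nat). 1 - real i / real N)) \<longlonglongrightarrow> 60 / (\<Prod>i<(6::nat). 1 - 0)"
    by (intro tendsto_intros lim_const_over_n) simp
  then have "(\<lambda>N. 60 / (\<Prod>i<(6::nat). 1 - real i / real N)) \<longlonglongrightarrow> 60" by simp
  moreover have "eventually (\<lambda>N. 60 / (\<Prod>i<(6::nat). 1 - real i / real N) = scale N) sequentially"
    using eventually_gt_at_top[of 0] by eventually_elim (simp add: eq)
  ultimately show ?thesis by (rule Lim_transform_eventually)
qed

lemma max_density_limit: "max_density F36 \<longlonglongrightarrow> 15 / 4 * Lam alpha"
proof (rule tendsto_sandwich)
  have scale0: "0 \<le> scale N" for N by (simp add: scale_def)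
  show "eventually (\<lambda>N. scale N * lower_bound (real N) \<le> max_density F36 N) sequentially"
    using eventually_ge_at_top[of 50]
  proof eventually_elim
    case (elim N)
    let ?W = "{..<N}"
    have "0 \<in> ?W" using elim by simp
    then have v: "vertices ?W" by unfold_locales (simp, blast)
    then obtain f where f: "lower_bound (real N) \<le> vertices.emb_density ?W (ideal f)"
      using exists_good_ideal[OF v] elim by auto
    have g: "graph ?W (ideal f)" by (rule vertices.graph_ideal[OF v])
    let ?G = "graph_of ?W (ideal f)"
    have "scale N * lower_bound (real N) \<le> scale N * vertices.emb_density ?W (ideal f)"
      using f scale0 by (rule mult_left_mono)
    also have "\<dots> = Defs.density F36 ?G"
      using density_scale[OF simple_graph_of[OF g]] vertices.ne[OF v] by (simp add: emb_density_graph_of[OF g])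
    also have "\<dots> \<le> max_density F36 N" using density_le_max[OF simple_graph_of[OF g], of F36] by simp
    finally show ?case .
  qed
  show "eventually (\<lambda>N. max_density F36 N \<le> scale N * (Lam alpha / 16)) sequentially"
    using eventually_ge_at_top[of 1]
  proof eventually_elim
    case (elim N)
    obtain G :: "nat pattern" where G: "simple_graph G" "card (verts G) = N" "Defs.density F36 G = max_density F36 N"
      using max_density_attained by blast
    have ne: "verts G \<noteq> {}" using G(2) elim by auto
    have "vertices.emb_density (verts G) (adj_of G) \<le> Lam alpha / 16"
      using graph.emb_density_le[OF graph_adj_of[OF G(1) ne]] by simp
    then have "scale N * vertices.emb_density (verts G) (adj_of G) \<le> scale N * (Lam alpha / 16)"
      using scale0 by (rule mult_left_mono)
    then show ?case using density_scale[OF G(1) ne] unfolding G(2,3) by simp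
  qed
  have "(\<lambda>N. scale N * lower_bound (real N)) \<longlonglongrightarrow> 60 * (Lam alpha / 16)"
    by (intro tendsto_mult scale_limit lower_bound_limit)
  then show "(\<lambda>N. scale N * lower_bound (real N)) \<longlonglongrightarrow> 15 / 4 * Lam alpha" by simp
  have "(\<lambda>N. scale N * (Lam alpha / 16)) \<longlonglongrightarrow> 60 * (Lam alpha / 16)"
    by (intro tendsto_mult scale_limit tendsto_const)
  then show "(\<lambda>N. scale N * (Lam alpha / 16)) \<longlonglongrightarrow> 15 / 4 * Lam alpha" by simp
qed

section \<open>Edit distance\<close>

text \<open>The bijection between parts and the vertices of \<open>B36\<close>; the small component is \<open>01\<close>.\<close>

definition label :: "part \<Rightarrow> nat" where
  "label i = (if fst i then 2 else 0) + (if snd i then 0 else 1)"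

lemma label_inj: "label i = label j \<longleftrightarrow> i = j"
  by (cases i; cases j) (auto simp: label_def)

lemma label_edge: "{label i, label j} \<in> edges B36 \<longleftrightarrow> j = partner i"
  by (cases i; cases j) (auto simp: label_def B36_def partner_def doubleton_eq_iff)

lemma label_vertex: "label i \<in> verts B36"
  by (auto simp: label_def B36_def)

lemma label_surj: "k \<in> verts B36 \<Longrightarrow> \<exists>i. label i = k"
proof -
  assume "k \<in> verts B36"
  then have "k \<in> {0, 1, 2, 3}" by (auto simp: B36_def)
  moreover have "label (False, True) = 0" "label (False, False) = 1" "label (True, True) = 2" "label (True, False) = 3"
    by (simp_all add: label_def)
  ultimately show ?thesis by (metis insertE singletonD)
qed

lemma blowup_ideal:
  "blowup B36 (\<lambda>k. {w \<in> W. label (f w) = k}) = graph_of W (ideal f)" (is "?B = _")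
proof -
  have "verts ?B = W" by (auto simp: blowup_def label_vertex)
  moreover have "edges ?B = {{x, y} | x y. x \<in> W \<and> y \<in> W \<and> ideal f x y}"
  proof -
    have "(x \<noteq> y \<and> (\<exists>i\<in>verts B36. \<exists>j\<in>verts B36. x \<in> {w \<in> W. label (f w) = i} \<and> y \<in> {w \<in> W. label (f w) = j} \<and> {i, j} \<in> edges B36))
      \<longleftrightarrow> x \<in> W \<and> y \<in> W \<and> ideal f x y" for x y
    proof -
      have "f y = partner (f x) \<Longrightarrow> x \<noteq> y" by auto
      then show ?thesis using label_vertex by (auto simp: label_edge ideal_def)
    qed
    then show ?thesis by (simp add: blowup_def)
  qed
  ultimately show ?thesis by (simp add: graph_of_def prod_eq_iff)
qed

lemma ideal_in_blowups: "finite W \<Longrightarrow> graph_of W (ideal f) \<in> blowups B36"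
  unfolding blowups_def mem_Collect_eq
  by (rule exI[of _ "\<lambda>k. {w \<in> W. label (f w) = k}"])
    (auto simp: blowup_ideal parts_of_def disjoint_family_on_def)

lemma isomorphic_refl: "isomorphic G G"
  unfolding isomorphic_def isomorphism_def by (rule exI[of _ id]) auto

abbreviation sym_diff_edges :: "'a pattern \<Rightarrow> 'a pattern \<Rightarrow> 'a set set" where
  "sym_diff_edges G H \<equiv> (edges G - edges H) \<union> (edges H - edges G)"

lemma edit_distance_ideal:
  fixes G :: "'a pattern"
  assumes "simple_graph G" "verts G \<noteq> {}"
  shows "edit_distance G B36 \<le> card (sym_diff_edges G (graph_of (verts G) (ideal f)))"
  unfolding edit_distance_def
proof (rule Least_le, rule exI[of _ "graph_of (verts G) (ideal f)"], intro conjI)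
  have fin: "finite (verts G)" using assms by (simp add: simple_graph_def)
  then have "vertices (verts G)" using assms by unfold_locales
  then show "simple_graph (graph_of (verts G) (ideal f))" by (intro simple_graph_of vertices.graph_ideal)
  show "\<exists>K\<in>blowups B36 :: 'a pattern set. isomorphic (graph_of (verts G) (ideal f)) K"
    using ideal_in_blowups[OF fin] isomorphic_refl by blast
qed simp_all

text \<open>A nearest blowup for \<open>H\<close> is a candidate for \<open>G\<close>. The minimum is attained because the edgeless graph is a blowup.\<close>

lemma edit_distance_lipschitz:
  fixes G H :: "'a pattern"
  assumes G: "simple_graph G" and H: "simple_graph H" "verts H = verts G" and ne: "verts G \<noteq> {}"
  shows "edit_distance G B36 \<le> edit_distance H B36 + card (sym_diff_edges G H)"
proof -
  let ?P = "\<lambda>G k. \<exists>H :: 'a pattern. simple_graph H \<and> verts H = verts G \<and>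
     (\<exists>K \<in> (blowups B36 :: 'a pattern set). isomorphic H K) \<and> k = card (sym_diff_edges G H)"
  have finE: "finite (edges K)" if "simple_graph K" for K :: "'a pattern"
    using that by (intro finite_subset[of "edges K" "Pow (verts K)"]) (auto simp: simple_graph_def)
  have fin: "finite (verts H)" using H by (simp add: simple_graph_def)
  then have "vertices (verts H)" using ne H(2) by unfold_locales auto
  then have "simple_graph (graph_of (verts H) (ideal (\<lambda>_. (True, True))))"
    by (intro simple_graph_of vertices.graph_ideal)
  then have "?P H (card (sym_diff_edges H (graph_of (verts H) (ideal (\<lambda>_. (True, True))))))"
    by (intro exI[of _ "graph_of (verts H) (ideal (\<lambda>_. (True, True)))"] conjI
        bexI[OF isomorphic_refl ideal_in_blowups[OF fin]]) simp_all
  then have "\<exists>k. ?P H k" by (rule exI)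
  then have "?P H (edit_distance H B36)" unfolding edit_distance_def by (rule LeastI_ex)
  then obtain K where K: "simple_graph K" "verts K = verts H" "\<exists>L \<in> (blowups B36 :: 'a pattern set). isomorphic K L"
    "edit_distance H B36 = card (sym_diff_edges H K)" by blast
  have "edit_distance G B36 \<le> card (sym_diff_edges G K)"
    unfolding edit_distance_def
    by (rule Least_le, rule exI[of _ K], intro conjI K(1,3) refl) (simp add: K(2) H(2))
  also have "\<dots> \<le> card (sym_diff_edges H K \<union> sym_diff_edges G H)"
    using finE[OF G] finE[OF H(1)] finE[OF K(1)] by (intro card_mono) auto
  also have "\<dots> \<le> card (sym_diff_edges H K) + card (sym_diff_edges G H)" by (rule card_Un_le)
  finally show ?thesis using K(4) by simp
qed

lemma card_sym_diff_edges:
  fixes G H :: "'a pattern"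
  assumes G: "simple_graph G" and H: "simple_graph H" "verts H = verts G" and ne: "verts G \<noteq> {}"
  shows "real (card (sym_diff_edges G H))
    \<le> (real (card (verts G)))\<^sup>2 * vertices.dens (verts G) (\<lambda>u w. adj_of G u w \<noteq> adj_of H u w)"
proof -
  let ?W = "verts G"
  have fin: "finite ?W" using G by (simp add: simple_graph_def)
  interpret vertices ?W using fin ne by unfold_locales
  let ?X = "{(u, w) \<in> ?W \<times> ?W. adj_of G u w \<noteq> adj_of H u w}"
  have "sym_diff_edges G H \<subseteq> (\<lambda>(u, w). {u, w}) ` ?X"
  proof
    fix e assume e: "e \<in> sym_diff_edges G H"
    then have "e \<subseteq> ?W" "card e = 2" using G H by (auto simp: simple_graph_def)
    then obtain u w where "e = {u, w}" "u \<in> ?W" "w \<in> ?W" by (auto simp: card_2_iff)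
    then show "e \<in> (\<lambda>(u, w). {u, w}) ` ?X" using e by (intro image_eqI[of _ _ "(u, w)"]) auto
  qed
  moreover have "finite ?X" using fin by (auto intro: finite_subset[of _ "?W \<times> ?W"])
  ultimately have "card (sym_diff_edges G H) \<le> card ?X"
    using surj_card_le by blast
  moreover have "real (card ?X) = (\<Sum>u\<in>?W. \<Sum>w\<in>?W. of_bool (adj_of G u w \<noteq> adj_of H u w))"
  proof -
    have "(\<Sum>u\<in>?W. \<Sum>w\<in>?W. of_bool (adj_of G u w \<noteq> adj_of H u w))
        = (\<Sum>e\<in>?W \<times> ?W. of_bool (adj_of G (fst e) (snd e) \<noteq> adj_of H (fst e) (snd e)) :: real)"
      unfolding sum.cartesian_product case_prod_beta ..
    also have "\<dots> = real (card (?W \<times> ?W \<inter> {e. adj_of G (fst e) (snd e) \<noteq> adj_of H (fst e) (snd e)}))"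
      using fin by (intro sum_of_bool_eq) auto
    also have "?W \<times> ?W \<inter> {e. adj_of G (fst e) (snd e) \<noteq> adj_of H (fst e) (snd e)} = ?X" by auto
    finally show ?thesis ..
  qed
  moreover have "(\<Sum>u\<in>?W. \<Sum>w\<in>?W. of_bool (adj_of G u w \<noteq> adj_of H u w))
      = n\<^sup>2 * dens (\<lambda>u w. adj_of G u w \<noteq> adj_of H u w)"
    using n_pos by (simp add: dens_def av_def sum_divide_distrib[symmetric] power2_eq_square)
  ultimately show ?thesis by simp
qed

section \<open>Perfect stability\<close>

text \<open>On the vertex set \<open>W\<close> of \<open>G\<close>, let \<open>H\<close> maximise the density of tuples plus \<open>c\<close> times the normalised edit distance.
  It satisfies the hypotheses of \<open>optimal_structure\<close>: it is optimal since the edit distance is Lipschitz, and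
  \<open>c\<close> is so small that the additional term does not spoil the density. So \<open>H\<close> is a blowup and its edit distance
  vanishes, and comparing the values of \<open>G\<close> and \<open>H\<close> gives the claim with a constant of about \<open>1 / c\<close>.\<close>

theorem perfectly_stable_F36: "perfectly_stable F36 B36"
proof -
  obtain k n0 where k: "0 < k" and rigid: "\<And>(W :: nat set) adj. \<lbrakk>graph W adj; n0 \<le> real (card W);
      vertices.optimal W k adj; Lam alpha - k \<le> 16 * vertices.emb_density W adj\<rbrakk>
      \<Longrightarrow> \<exists>f. \<forall>x\<in>W. \<forall>y\<in>W. \<not> wrong adj f x y"
    using optimal_structure[where ?'a = nat] by blast
  have "eventually (\<lambda>N. Lam alpha / 16 - k / 32 < lower_bound (real N)) sequentially"
    using k by (intro order_tendstoD(1)[OF lower_bound_limit]) simp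
  then obtain n1 where n1: "\<And>N. n1 \<le> N \<Longrightarrow> Lam alpha / 16 - k / 32 < lower_bound (real N)"
    unfolding eventually_sequentially by blast
  define c where "c = k / 32"
  define C where "C = max (max (1 / c) n0) (max (real n1) 50)"
  have c: "0 < c" "c \<le> k" "32 * c = k" using k by (simp_all add: c_def)
  have C: "1 / c \<le> C" "n0 \<le> C" "real n1 \<le> C" "50 \<le> C" by (simp_all add: C_def)
  show ?thesis
    unfolding perfectly_stable_def
  proof (rule exI[of _ C], intro conjI allI impI)
    show "0 < C" using C by simp
    fix G :: "nat pattern"
    assume "simple_graph G \<and> C \<le> real (card (verts G))"
    then have G: "simple_graph G" and large: "C \<le> real (card (verts G))" by blast+
    define W where "W = verts G"
    have ne: "W \<noteq> {}" using large C by (auto simp: W_def)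
    interpret graph W "adj_of G" using graph_adj_of[OF G] ne by (simp add: W_def)
    have nC: "C \<le> n" using large by (simp add: W_def)
    define S where "S = {H. simple_graph H \<and> verts H = W}"
    \<comment> \<open>Dividing by \<open>n\<^sup>2\<close> makes the edit distance comparable with \<open>dens\<close>.\<close>
    define value' where "value' H = emb_density (adj_of H) + c * (real (edit_distance H B36) / n\<^sup>2)" for H
    have gS: "graph W (adj_of H)" if "H \<in> S" for H using that graph_adj_of[of H] ne by (auto simp: S_def)
    have finS: "finite S"
    proof (rule finite_subset)
      show "S \<subseteq> {W} \<times> Pow (Pow W)" unfolding S_def simple_graph_def by auto
    qed (use fin in auto)
    have GS: "G \<in> S" using G by (simp add: S_def W_def)
    then have "Max (value' ` S) \<in> value' ` S" using finS by (intro Max_in) auto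
    then obtain H where H: "H \<in> S" "value' H = Max (value' ` S)" by auto
    have max: "value' H' \<le> value' H" if "H' \<in> S" for H' using finS that H(2) by simp
    have close: "real (edit_distance H1 B36) / n\<^sup>2 \<le> real (edit_distance H2 B36) / n\<^sup>2
        + dens (\<lambda>u w. adj_of H1 u w \<noteq> adj_of H2 u w)" if "H1 \<in> S" "H2 \<in> S" for H1 H2
    proof -
      have "real (edit_distance H1 B36) \<le> real (edit_distance H2 B36) + real (card (sym_diff_edges H1 H2))"
        using edit_distance_lipschitz[of H1 H2] that ne by (simp add: S_def)
      also have "\<dots> \<le> real (edit_distance H2 B36) + n\<^sup>2 * dens (\<lambda>u w. adj_of H1 u w \<noteq> adj_of H2 u w)"
        using card_sym_diff_edges[of H1 H2] that ne by (simp add: S_def)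
      finally have "real (edit_distance H1 B36) / n\<^sup>2 \<le> (real (edit_distance H2 B36)
          + n\<^sup>2 * dens (\<lambda>u w. adj_of H1 u w \<noteq> adj_of H2 u w)) / n\<^sup>2"
        by (intro divide_right_mono) auto
      also have "\<dots> = real (edit_distance H2 B36) / n\<^sup>2 + dens (\<lambda>u w. adj_of H1 u w \<noteq> adj_of H2 u w)"
        using n_pos by (simp add: add_divide_distrib)
      finally show ?thesis .
    qed
    have of_adj: "graph_of W adj' \<in> S" if "graph W adj'" for adj'
      using simple_graph_of[OF that] by (simp add: S_def)
    have zero: "edit_distance (graph_of W (ideal f)) B36 = 0" for f
      using edit_distance_ideal[OF simple_graph_of[OF graph_ideal], of f f] ne by simp
    have "optimal c (adj_of H)"
      unfolding optimal_def emb_density_pr[symmetric]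
    proof (intro allI impI)
      fix adj' assume g': "graph W adj'"
      let ?d = "dens (\<lambda>u w. adj_of H u w \<noteq> adj' u w)"
      have "dens (\<lambda>u w. adj_of H u w \<noteq> adj_of (graph_of W adj') u w) \<le> ?d"
        by (rule dens_mono) (simp add: adj_of_graph_of[OF g'])
      then have "real (edit_distance H B36) / n\<^sup>2 \<le> real (edit_distance (graph_of W adj') B36) / n\<^sup>2 + ?d"
        using close[OF H(1) of_adj[OF g']] by linarith
      then have "c * (real (edit_distance H B36) / n\<^sup>2) \<le> c * (real (edit_distance (graph_of W adj') B36) / n\<^sup>2 + ?d)"
        using c(1) by (intro mult_left_mono) auto
      then show "emb_density adj' \<le> emb_density (adj_of H) + c * ?d"
        using max[OF of_adj[OF g']] unfolding value'_def emb_density_graph_of[OF g'] distrib_left by linarith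
    qed
    moreover have "c * d \<le> k * d" if "0 \<le> d" for d :: real using c(2) that by (rule mult_right_mono)
    ultimately have "optimal k (adj_of H)"
      unfolding optimal_def by (meson add_left_mono dens_nonneg order_trans)
    moreover have "Lam alpha - k \<le> 16 * emb_density (adj_of H)"
    proof -
      have "50 \<le> real (card W)" using nC C(4) by linarith
      then obtain f where f: "lower_bound n \<le> emb_density (ideal f)"
        using exists_good_ideal[OF vertices_axioms] by blast
      have "dens (\<lambda>u w. adj_of H u w \<noteq> adj_of (graph_of W (ideal f)) u w) \<le> 1"
        unfolding dens_def by (intro av_le_const) simp
      then have "real (edit_distance H B36) / n\<^sup>2 \<le> 1"
        using close[OF H(1) of_adj[OF graph_ideal], of f] by (simp add: zero)
      then have "c * (real (edit_distance H B36) / n\<^sup>2) \<le> c * 1" using c(1) by (intro mult_left_mono) auto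
      moreover have "emb_density (ideal f) \<le> value' H"
        using max[OF of_adj[OF graph_ideal], of f] by (simp add: value'_def zero emb_density_graph_of[OF graph_ideal])
      moreover have "Lam alpha / 16 - k / 32 < lower_bound n"
        using nC C(3) by (intro n1) linarith
      ultimately show ?thesis using f c(3) unfolding value'_def by linarith
    qed
    ultimately obtain f where f: "\<forall>x\<in>W. \<forall>y\<in>W. \<not> wrong (adj_of H) f x y"
      using rigid[OF gS[OF H(1)]] nC C(2) by force
    have "adj_of H x y \<longleftrightarrow> ideal f x y" if "x \<in> W" "y \<in> W" for x y
      using f that graph.irr[OF gS[OF H(1)], of x] unfolding wrong_def ideal_def by (cases "x = y") auto
    then have "graph_of W (adj_of H) = graph_of W (ideal f)"
      unfolding graph_of_def by auto
    then have "H = graph_of W (ideal f)" using H(1) graph_of_adj_of[of H] by (auto simp: S_def)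
    then have "value' H = emb_density (adj_of H)" by (simp add: value'_def zero)
    then have "value' G \<le> emb_density (adj_of H)" using max[OF GS] by simp
    then have le: "emb_density (adj_of G) + c * (real (edit_distance G B36) / n\<^sup>2) \<le> emb_density (adj_of H)"
      unfolding value'_def .
    have nn: "0 \<le> c * (real (edit_distance G B36) / n\<^sup>2)" using c(1) by simp
    have "6 \<le> card W" using nC C(4) by linarith
    then have sc: "1 \<le> scale (card W)" by (rule scale_ge_1)
    have "c * (real (edit_distance G B36) / n\<^sup>2) \<le> 1 * (emb_density (adj_of H) - emb_density (adj_of G))"
      using le by simp
    also have "\<dots> \<le> scale (card W) * (emb_density (adj_of H) - emb_density (adj_of G))"
      using sc le nn by (intro mult_right_mono) auto
    also have "\<dots> = Defs.density F36 H - Defs.density F36 G"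
      using density_scale[of G] density_scale[of H] G H(1) ne by (simp add: W_def S_def right_diff_distrib)
    also have "\<dots> \<le> max_density F36 (card W) - Defs.density F36 G"
      using density_le_max[of H F36] H(1) by (simp add: S_def)
    finally have main: "c * (real (edit_distance G B36) / n\<^sup>2) \<le> max_density F36 (card W) - Defs.density F36 G" .
    have "real (edit_distance G B36) = 1 / c * (c * (real (edit_distance G B36) / n\<^sup>2)) * n\<^sup>2"
      using c(1) n_pos by simp
    also have "\<dots> \<le> C * (max_density F36 (card W) - Defs.density F36 G) * n\<^sup>2"
      using main nn C c(1) by (intro mult_right_mono mult_mono) auto
    finally show "real (edit_distance G B36)
        \<le> C * (max_density F36 (card (verts G)) - Defs.density F36 G) * (real (card (verts G)))\<^sup>2"
      by (simp only: W_def)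
  qed
qed

section \<open>The density of blowups\<close>

lemma blowup_cong: "(\<And>k. k \<in> verts B \<Longrightarrow> V k = V' k) \<Longrightarrow> blowup B V = blowup B V'"
  unfolding blowup_def by auto

lemma blowup_as_ideal:
  fixes V :: "nat \<Rightarrow> 'a set"
  assumes V: "parts_of B36 V"
  defines "W \<equiv> \<Union>k\<in>verts B36. V k"
  obtains f where "blowup B36 V = graph_of W (ideal f)" "\<And>i. {w \<in> W. f w = i} = V (label i)"
proof -
  define f where "f w = (SOME i. w \<in> V (label i))" for w
  have disj: "k = l" if "w \<in> V k" "w \<in> V l" "k \<in> verts B36" "l \<in> verts B36" for w k l
    using V that unfolding parts_of_def disjoint_family_on_def by blast
  have f: "w \<in> V (label (f w))" if "w \<in> W" for w
  proof -
    have "\<exists>i. w \<in> V (label i)" using that label_surj unfolding W_def by blast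
    then show ?thesis unfolding f_def by (rule someI_ex)
  qed
  have parts: "{w \<in> W. label (f w) = k} = V k" if k: "k \<in> verts B36" for k
  proof (intro equalityI subsetI)
    fix w assume "w \<in> V k"
    then have "w \<in> W" using k by (auto simp: W_def)
    then show "w \<in> {w \<in> W. label (f w) = k}" using disj[OF f \<open>w \<in> V k\<close> label_vertex k] by simp
  qed (use f in auto)
  then have "blowup B36 V = blowup B36 (\<lambda>k. {w \<in> W. label (f w) = k})"
    by (intro blowup_cong) simp
  moreover have "{w \<in> W. f w = i} = V (label i)" for i
    using parts[OF label_vertex[of i]] by (simp add: label_inj)
  ultimately show ?thesis using that blowup_ideal by metis
qed

definition ideal_limit :: "real list \<Rightarrow> real" where
  "ideal_limit x = 60 * ideal_density (\<lambda>i. x ! label i)"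

lemma ideal_density_tendsto:
  assumes "\<And>i. (\<lambda>n. s n i) \<longlonglongrightarrow> s' i"
  shows "(\<lambda>n. ideal_density (s n)) \<longlonglongrightarrow> ideal_density s'"
  unfolding ideal_density_def by (intro tendsto_intros assms)

lemma verts_B36: "verts B36 = label ` UNIV"
  using label_surj label_vertex by fast

lemma sum_verts_B36: "(\<Sum>k\<in>verts B36. g k) = (\<Sum>i\<in>UNIV. g (label i))"
  unfolding verts_B36 by (subst sum.reindex) (auto simp: inj_on_def label_inj)

lemma simplex_sum: "x \<in> Defs.simplex 4 \<Longrightarrow> (\<Sum>i\<in>UNIV. x ! label i) = 1"
proof -
  assume "x \<in> Defs.simplex 4"
  then have "length x = 4" "sum_list x = 1" by (auto simp: Defs.simplex_def)
  then have "(\<Sum>k<4. x ! k) = 1" by (simp add: sum_list_sum_nth atLeast0LessThan)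
  then show ?thesis using sum_verts_B36[of "\<lambda>k. x ! k"] by (simp add: B36_def)
qed

lemma blowup_sequence_limit:
  fixes V :: "nat \<Rightarrow> nat \<Rightarrow> nat set"
  assumes V: "\<And>n. parts_of B36 (V n)" and x: "x \<in> Defs.simplex 4"
    and lim: "\<And>k. k \<in> verts B36 \<Longrightarrow> (\<lambda>n. real (card (V n k)) / real n) \<longlonglongrightarrow> x ! k"
  shows "(\<lambda>n. Defs.density F36 (blowup B36 (V n))) \<longlonglongrightarrow> ideal_limit x"
proof -
  define W where "W n = (\<Union>k\<in>verts B36. V n k)" for n
  have finV: "finite (V n k)" if "k \<in> verts B36" for n k using V[of n] that by (simp add: parts_of_def)
  have finB: "finite (verts B36)" by (simp add: B36_def)
  have finW: "finite (W n)" for n unfolding W_def using finB finV by blast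
  have cardW: "real (card (W n)) = (\<Sum>k\<in>verts B36. real (card (V n k)))" for n
    unfolding W_def using V[of n] finV finB
    by (subst card_UN_disjoint) (auto simp: parts_of_def disjoint_family_on_def)
  have Wn: "(\<lambda>n. real (card (W n)) / real n) \<longlonglongrightarrow> 1"
  proof -
    have "(\<lambda>n. \<Sum>k\<in>verts B36. real (card (V n k)) / real n) \<longlonglongrightarrow> (\<Sum>k\<in>verts B36. x ! k)"
      by (intro tendsto_sum lim)
    then show ?thesis unfolding cardW sum_divide_distrib using simplex_sum[OF x] by (simp add: sum_verts_B36)
  qed
  \<comment> \<open>The parts need not add up to exactly \<open>n\<close> vertices, so the total has to be shown to grow.\<close>
  have ev: "eventually (\<lambda>n. n / 2 \<le> real (card (W n))) sequentially"
  proof -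
    have "eventually (\<lambda>n. 1 / 2 < real (card (W n)) / real n) sequentially"
      by (rule order_tendstoD(1)[OF Wn]) simp
    then show ?thesis using eventually_gt_at_top[of 0]
      by eventually_elim (simp add: divide_simps)
  qed
  have top: "filterlim (\<lambda>n. card (W n)) at_top sequentially"
  proof -
    have "filterlim (\<lambda>n. real n / 2) at_top sequentially"
      by (intro filterlim_at_top_mult_tendsto_pos[of "\<lambda>_. 1 / 2" "1 / 2", simplified] filterlim_real_sequentially) 
    then have "filterlim (\<lambda>n. real (card (W n))) at_top sequentially"
      by (rule filterlim_at_top_mono) (use ev in auto)
    then show ?thesis by (simp add: filterlim_sequentially_iff_filterlim_real)
  qed
  have "eventually (\<lambda>n. 0 < card (W n)) sequentially"
    using eventually_compose_filterlim[OF eventually_gt_at_top[of 0] top] by simp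
  then have bound: "eventually (\<lambda>n. \<bar>Defs.density F36 (blowup B36 (V n))
     - scale (card (W n)) * ideal_density (\<lambda>i. real (card (V n (label i))) / real (card (W n)))\<bar>
     \<le> scale (card (W n)) * (30 / real (card (W n)))) sequentially"
  proof eventually_elim
    case (elim n)
    obtain f where f: "blowup B36 (V n) = graph_of (W n) (ideal f)" "\<And>i. {w \<in> W n. f w = i} = V n (label i)"
      using blowup_as_ideal[OF V[of n]] unfolding W_def by blast
    have v: "vertices (W n)" using elim finW by unfold_locales auto
    interpret vertices "W n" by (rule v)
    have mu: "mu {w. f w = i} = real (card (V n (label i))) / real (card (W n))" for i
    proof -
      have "mu {w. f w = i} = mu {w \<in> W n. f w = i}" by (rule mu_cong) auto
      also have "\<dots> = real (card {w \<in> W n. f w = i}) / real (card (W n))" by (rule mu_card) auto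
      finally show ?thesis by (simp only: f(2))
    qed
    have "Defs.density F36 (blowup B36 (V n)) = scale (card (W n)) * emb_density (ideal f)"
      unfolding f(1) using density_scale[OF simple_graph_of[OF graph_ideal[of f]]] ne
      by (simp add: emb_density_graph_of[OF graph_ideal])
    then have "Defs.density F36 (blowup B36 (V n))
        - scale (card (W n)) * ideal_density (\<lambda>i. real (card (V n (label i))) / real (card (W n)))
        = scale (card (W n)) * (emb_density (ideal f) - ideal_density (\<lambda>i. mu {w. f w = i}))"
      by (simp add: mu right_diff_distrib)
    moreover have sc0: "0 \<le> scale (card (W n))" by (simp add: scale_def)
    moreover note mult_left_mono[OF emb_density_ideal[of f] sc0]
    ultimately show ?case by (simp only: abs_mult abs_of_nonneg[OF sc0])
  qed
  have sc: "(\<lambda>n. scale (card (W n))) \<longlonglongrightarrow> 60" by (rule filterlim_compose[OF scale_limit top])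
  have "(\<lambda>n. ideal_density (\<lambda>i. real (card (V n (label i))) / real (card (W n)))) \<longlonglongrightarrow> ideal_density (\<lambda>i. x ! label i)"
  proof (rule ideal_density_tendsto)
    fix i
    have "(\<lambda>n. (real (card (V n (label i))) / real n) / (real (card (W n)) / real n)) \<longlonglongrightarrow> x ! label i / 1"
      by (intro tendsto_divide lim label_vertex Wn) simp
    moreover have "eventually (\<lambda>n. (real (card (V n (label i))) / real n) / (real (card (W n)) / real n)
        = real (card (V n (label i))) / real (card (W n))) sequentially"
      using eventually_gt_at_top[of 0] by eventually_elim simp
    ultimately show "(\<lambda>n. real (card (V n (label i))) / real (card (W n))) \<longlonglongrightarrow> x ! label i"
      using Lim_transform_eventually by fastforce
  qed
  then have main: "(\<lambda>n. scale (card (W n)) * ideal_density (\<lambda>i. real (card (V n (label i))) / real (card (W n))))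
      \<longlonglongrightarrow> ideal_limit x"
    unfolding ideal_limit_def by (intro tendsto_mult sc)
  have "(\<lambda>n. scale (card (W n)) * (30 / real (card (W n)))) \<longlonglongrightarrow> 60 * 0"
    by (intro tendsto_mult sc filterlim_compose[OF lim_const_over_n top])
  then have "(\<lambda>n. Defs.density F36 (blowup B36 (V n))
     - scale (card (W n)) * ideal_density (\<lambda>i. real (card (V n (label i))) / real (card (W n)))) \<longlonglongrightarrow> 0"
    by (intro Lim_null_comparison[OF bound[folded real_norm_def]]) simp
  from tendsto_add[OF this main] show ?thesis by simp
qed

text \<open>A limit along one sequence of parts exists by rounding, so it determines the common limit.\<close>

lemma blowup_density_eq:
  assumes x: "x \<in> Defs.simplex 4"
  shows "blowup_density F36 B36 x = ideal_limit x"
  unfolding blowup_density_def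
proof (rule the_equality, intro allI impI)
  fix V :: "nat \<Rightarrow> nat \<Rightarrow> nat set"
  assume "(\<forall>n. parts_of B36 (V n)) \<and> (\<forall>i\<in>verts B36. (\<lambda>n. real (card (V n i)) / real n) \<longlonglongrightarrow> x ! i)"
  then show "(\<lambda>n. Defs.density F36 (blowup B36 (V n))) \<longlonglongrightarrow> ideal_limit x"
    using blowup_sequence_limit[OF _ x] by blast
next
  fix L assume L: "\<forall>V :: nat \<Rightarrow> nat \<Rightarrow> nat set. (\<forall>n. parts_of B36 (V n)) \<and>
      (\<forall>i\<in>verts B36. (\<lambda>n. real (card (V n i)) / real n) \<longlonglongrightarrow> x ! i) \<longrightarrow>
      (\<lambda>n. Defs.density F36 (blowup B36 (V n))) \<longlonglongrightarrow> L"
  have nn: "0 \<le> x ! label i" for i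
    using x label_vertex[of i] by (auto simp: Defs.simplex_def B36_def)
  have "\<exists>f. \<forall>i. \<bar>real (card {w \<in> {..<n}. f w = i}) - x ! label i * real n\<bar> \<le> 4" for n :: nat
    using exists_partition[OF nn simplex_sum[OF x], of "{..<n}"] by simp
  then obtain f where f: "\<And>n i. \<bar>real (card {w \<in> {..<n :: nat}. f n w = i}) - x ! label i * real n\<bar> \<le> 4"
    by metis
  define V where "V n k = {w \<in> {..<n}. label (f n w) = k}" for n k :: nat
  have parts: "parts_of B36 (V n)" for n by (auto simp: V_def parts_of_def disjoint_family_on_def)
  have lim: "(\<lambda>n. real (card (V n k)) / real n) \<longlonglongrightarrow> x ! k" if k: "k \<in> verts B36" for k
  proof -
    obtain i where i: "k = label i" using label_surj[OF k] by blast
    have V: "V n k = {w \<in> {..<n}. f n w = i}" for n by (simp add: V_def i label_inj)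
    have "(\<lambda>n. real (card (V n k)) / real n - x ! k) \<longlonglongrightarrow> 0"
    proof (rule Lim_null_comparison)
      show "eventually (\<lambda>n. norm (real (card (V n k)) / real n - x ! k) \<le> 4 / real n) sequentially"
        using eventually_gt_at_top[of 0]
      proof eventually_elim
        case (elim n)
        have "real (card (V n k)) / real n - x ! k = (real (card (V n k)) - x ! k * real n) / real n"
          using elim by (simp add: field_simps)
        moreover have "\<bar>real (card (V n k)) - x ! k * real n\<bar> \<le> 4" using f[of n i] by (simp only: V i[symmetric])
        ultimately show ?case by (simp add: divide_right_mono)
      qed
      show "(\<lambda>n. 4 / real n) \<longlonglongrightarrow> 0" by (rule lim_const_over_n)
    qed
    then show ?thesis by (simp add: LIM_zero_iff)
  qed
  have "(\<lambda>n. Defs.density F36 (blowup B36 (V n))) \<longlonglongrightarrow> L" using L parts lim by blast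
  moreover have "(\<lambda>n. Defs.density F36 (blowup B36 (V n))) \<longlonglongrightarrow> ideal_limit x"
    by (rule blowup_sequence_limit[OF parts x lim])
  ultimately show "L = ideal_limit x" by (rule LIMSEQ_unique)
qed

section \<open>The optimal part sizes\<close>

lemma ideal_limit_eq:
  fixes a b c d :: real
  shows "4 * ideal_limit [a, b, c, d] = 15 * (16 * a\<^sup>2 * b\<^sup>2 * ((a + b) * (c + d)) + 16 * c\<^sup>2 * d\<^sup>2 * ((a + b) * (c + d)))"
  unfolding ideal_limit_def ideal_density_def UNIV_part
  by (simp add: partner_def label_def power2_eq_square power3_eq_cube) (simp add: algebra_simps)

lemma square_mult_le:
  fixes a b :: real
  assumes "0 \<le> a" "0 \<le> b"
  shows "16 * a\<^sup>2 * b\<^sup>2 \<le> (a + b) ^ 4" "16 * a\<^sup>2 * b\<^sup>2 = (a + b) ^ 4 \<Longrightarrow> a = b"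
proof -
  have eq: "(a + b) ^ 4 - 16 * a\<^sup>2 * b\<^sup>2 = (a - b)\<^sup>2 * ((a + b)\<^sup>2 + 4 * (a * b))"
    by (simp add: power2_eq_square power4_eq_xxxx algebra_simps)
  have "0 \<le> (a - b)\<^sup>2 * ((a + b)\<^sup>2 + 4 * (a * b))" using assms by simp
  then show "16 * a\<^sup>2 * b\<^sup>2 \<le> (a + b) ^ 4" using eq by linarith
  assume "16 * a\<^sup>2 * b\<^sup>2 = (a + b) ^ 4"
  then have "(a - b)\<^sup>2 * ((a + b)\<^sup>2 + 4 * (a * b)) = 0" using eq by linarith
  then show "a = b"
  proof (cases "a = b")
    case False
    then have "(a + b)\<^sup>2 + 4 * (a * b) = 0" using \<open>(a - b)\<^sup>2 * _ = 0\<close> by simp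
    moreover have "0 \<le> (a + b)\<^sup>2" "0 \<le> a * b" using assms by simp_all
    ultimately have "(a + b)\<^sup>2 = 0" by linarith
    then show ?thesis using assms by simp
  qed
qed

lemma simplex_four:
  assumes "x \<in> Defs.simplex 4"
  obtains a b c d where "x = [a, b, c, d]" "0 \<le> a" "0 \<le> b" "0 \<le> c" "0 \<le> d" "c + d = 1 - (a + b)"
proof -
  have len: "length x = 4" and nn: "\<And>i. i < 4 \<Longrightarrow> 0 \<le> x ! i" and sum: "sum_list x = 1"
    using assms by (auto simp: Defs.simplex_def)
  obtain a b c d where x: "x = [a, b, c, d]"
    using len by (auto simp: length_Suc_conv numeral_eq_Suc)
  show ?thesis
    by (rule that[OF x]) (use nn[of 0] nn[of 1] nn[of 2] nn[of 3] sum in \<open>simp_all add: x\<close>)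
qed

text \<open>Each component contributes most if it is balanced, and the balanced case is \<open>Lam_le\<close>.\<close>

lemma ideal_limit_le:
  fixes a b c d :: real
  assumes nn: "0 \<le> a" "0 \<le> b" "0 \<le> c" "0 \<le> d" and cd: "c + d = 1 - (a + b)"
  shows "4 * ideal_limit [a, b, c, d] \<le> 15 * Lam alpha"
    and "4 * ideal_limit [a, b, c, d] = 15 * Lam alpha \<Longrightarrow> a = b \<and> c = d \<and> (a + b = alpha \<or> a + b = 1 - alpha)"
proof -
  define q where "q = a + b"
  have cdq: "c + d = 1 - q" using cd by (simp add: q_def)
  have w: "0 \<le> q * (1 - q)" using nn unfolding cdq[symmetric] by (simp add: q_def)
  have 1: "16 * a\<^sup>2 * b\<^sup>2 * (q * (1 - q)) \<le> q ^ 4 * (q * (1 - q))"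
    using square_mult_le(1)[OF nn(1,2)] w unfolding q_def by (intro mult_right_mono)
  have 2: "16 * c\<^sup>2 * d\<^sup>2 * (q * (1 - q)) \<le> (1 - q) ^ 4 * (q * (1 - q))"
    using square_mult_le(1)[OF nn(3,4)] w unfolding cdq by (intro mult_right_mono)
  have L: "q ^ 4 * (q * (1 - q)) + (1 - q) ^ 4 * (q * (1 - q)) = Lam q"
    by (simp add: Lam_def power_def numeral_eq_Suc algebra_simps)
  define X Y where "X = 16 * a\<^sup>2 * b\<^sup>2 * (q * (1 - q))" and "Y = 16 * c\<^sup>2 * d\<^sup>2 * (q * (1 - q))"
  have I: "4 * ideal_limit [a, b, c, d] = 15 * (X + Y)"
    unfolding ideal_limit_eq X_def Y_def q_def cd ..
  define X' Y' where "X' = q ^ 4 * (q * (1 - q))" and "Y' = (1 - q) ^ 4 * (q * (1 - q))"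
  note 1 = 1[folded X_def X'_def] and 2 = 2[folded Y_def Y'_def] and L = L[folded X'_def Y'_def]
  show "4 * ideal_limit [a, b, c, d] \<le> 15 * Lam alpha"
    using 1 2 L Lam_le[of q] unfolding I distrib_left by linarith
  assume eq: "4 * ideal_limit [a, b, c, d] = 15 * Lam alpha"
  then have "Lam q = Lam alpha" using 1 2 L Lam_le[of q] unfolding I distrib_left by linarith
  then have q: "q = alpha \<or> q = 1 - alpha" by (simp only: Lam_eq_iff)
  then have w0: "q * (1 - q) \<noteq> 0" using alpha_bounds by auto
  have "X = X'" "Y = Y'"
    using eq 1 2 L Lam_le[of q] unfolding I distrib_left by linarith+
  then have "16 * a\<^sup>2 * b\<^sup>2 = (a + b) ^ 4" "16 * c\<^sup>2 * d\<^sup>2 = (c + d) ^ 4"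
    using w0 unfolding X_def Y_def X'_def Y'_def cdq mult_cancel_right unfolding q_def by auto
  then show "a = b \<and> c = d \<and> (a + b = alpha \<or> a + b = 1 - alpha)"
    using square_mult_le(2) nn q unfolding q_def by blast
qed

lemma ideal_limit_optimum:
  "4 * ideal_limit [1/2 * alpha, 1/2 * alpha, 1/2 - 1/2 * alpha, 1/2 - 1/2 * alpha] = 15 * Lam alpha"
  unfolding ideal_limit_eq Lam_def by (simp add: power2_eq_square power_def numeral_eq_Suc field_simps)

lemma swap_automorphism: "automorphism (\<lambda>k. (k + 2) mod 4) B36"
proof -
  have v: "verts B36 = {0, 1, 2, 3}" by (auto simp: B36_def)
  have e: "edges B36 = {{0, 1}, {2, 3}}" by (simp add: B36_def)
  have "bij_betw (\<lambda>k. (k + 2) mod 4) {0, 1, 2, 3 :: nat} {0, 1, 2, 3}"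
    by (auto simp: bij_betw_def inj_on_def)
  moreover have "\<forall>x\<in>{0, 1, 2, 3 :: nat}. \<forall>y\<in>{0, 1, 2, 3}. {x, y} \<in> {{0, 1}, {2, 3}} \<longleftrightarrow>
      {(x + 2) mod 4, (y + 2) mod 4} \<in> {{0, 1}, {2, 3}}"
    by (simp add: doubleton_eq_iff)
  ultimately show ?thesis unfolding automorphism_def isomorphism_def v e by blast
qed

lemma unique_maximiser:
  "unique_maximiser_up_to_automorphism F36 B36 [1/2 * alpha, 1/2 * alpha, 1/2 - 1/2 * alpha, 1/2 - 1/2 * alpha]"
    (is "unique_maximiser_up_to_automorphism F36 B36 ?x")
proof -
  have card: "card (verts B36) = 4" by (simp add: B36_def)
  have x: "?x \<in> Defs.simplex 4"
    using alpha_bounds by (auto simp: Defs.simplex_def less_Suc_eq numeral_eq_Suc)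
  have le: "4 * blowup_density F36 B36 y \<le> 15 * Lam alpha" if y: "y \<in> Defs.simplex 4" for y
    using simplex_four[OF y] blowup_density_eq[OF y] ideal_limit_le(1) by metis
  have opt: "4 * blowup_density F36 B36 ?x = 15 * Lam alpha"
    using blowup_density_eq[OF x] ideal_limit_optimum by simp
  have "blowup_density F36 B36 y \<le> blowup_density F36 B36 ?x" if "y \<in> Defs.simplex 4" for y
    using le[OF that] opt by linarith
  then have max: "blowup_maximiser F36 B36 ?x" using x by (simp add: blowup_maximiser_def card)
  moreover have "\<exists>f. automorphism f B36 \<and> (\<forall>i\<in>verts B36. y ! i = ?x ! f i)" if "blowup_maximiser F36 B36 y" for y
  proof -
    have y: "y \<in> Defs.simplex 4" and ge: "blowup_density F36 B36 ?x \<le> blowup_density F36 B36 y"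
      using that x by (auto simp: blowup_maximiser_def card)
    have eq: "4 * ideal_limit y = 15 * Lam alpha"
      using le[OF y] opt ge unfolding blowup_density_eq[OF y] by linarith
    obtain a b c d where y4: "y = [a, b, c, d]" "0 \<le> a" "0 \<le> b" "0 \<le> c" "0 \<le> d" "c + d = 1 - (a + b)"
      by (rule simplex_four[OF y])
    have "a = b" "c = d" "a + b = alpha \<or> a + b = 1 - alpha"
      using ideal_limit_le(2)[OF y4(2-6)] eq unfolding y4(1) by blast+
    then consider "y = ?x" | "y = [1/2 - 1/2 * alpha, 1/2 - 1/2 * alpha, 1/2 * alpha, 1/2 * alpha]"
      using y4(1,6) by fastforce
    then show ?thesis
    proof cases
      case 1
      have "automorphism id B36" by (simp add: automorphism_def isomorphism_def)
      then show ?thesis using 1 by (intro exI[of _ id]) simp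
    next
      case 2
      have "verts B36 = {0, 1, 2, 3}" by (auto simp: B36_def)
      then show ?thesis using swap_automorphism 2 by (intro exI[of _ "\<lambda>k. (k + 2) mod 4"]) simp
    qed
  qed
  ultimately show ?thesis unfolding unique_maximiser_up_to_automorphism_def by blast
qed

text \<open>\<open>Lam alpha\<close> is a cubic in \<open>beta0 = alpha (1 - alpha)\<close>, which the quadratic equation for \<open>beta0\<close> reduces to a
  linear expression.\<close>

lemma inducibility_F36: "inducibility F36 = 25/6 * alpha\<^sup>2 - 25/6 * alpha + 5/6"
proof -
  have "inducibility F36 = 15 / 4 * Lam alpha"
    unfolding inducibility_def by (rule limI[OF max_density_limit])
  also have "\<dots> = 15 / 4 * (beta0 - 4 * beta0\<^sup>2 + 2 * (beta0 * beta0\<^sup>2))"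
    unfolding Lam_eq alpha_mult by (simp add: power2_eq_square power3_eq_cube)
  also have "\<dots> = 5 / 6 - 25 / 6 * beta0"
  proof -
    have sq: "6 * beta0\<^sup>2 = 8 * beta0 - 1" using beta0_root by linarith
    have "6 * (beta0 * beta0\<^sup>2) = beta0 * (6 * beta0\<^sup>2)" by simp
    also have "\<dots> = 8 * beta0\<^sup>2 - beta0" unfolding sq by (simp add: power2_eq_square algebra_simps)
    finally show ?thesis using sq unfolding distrib_left right_diff_distrib by linarith
  qed
  also have "\<dots> = 25/6 * alpha\<^sup>2 - 25/6 * alpha + 5/6"
  proof -
    have b: "beta0 = alpha - alpha\<^sup>2"
      unfolding alpha_mult[symmetric] by (simp add: power2_eq_square algebra_simps)
    show ?thesis unfolding b right_diff_distrib by linarith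
  qed
  finally show ?thesis .
qed

text \<open>The quartic arises from the quadratic for \<open>beta0\<close> by substituting \<open>alpha (1 - alpha)\<close>.\<close>

lemma alpha_root: "poly [:1/6, - 4/3, 7/3, - 2, 1:] alpha = 0"
proof -
  have "poly [:1/6, - 4/3, 7/3, - 2, 1:] alpha = (6 * (alpha * (1 - alpha))\<^sup>2 - 8 * (alpha * (1 - alpha)) + 1) / 6"
    by (simp add: power2_eq_square algebra_simps)
  then show ?thesis unfolding alpha_mult beta0_root by simp
qed

theorem theorem3p16:
  "\<exists>\<alpha>\<^sub>0::real. poly [:1/6, - 4/3, 7/3, - 2, 1:] \<alpha>\<^sub>0 = 0 \<and> 0.1677 \<le> \<alpha>\<^sub>0 \<and> \<alpha>\<^sub>0 < 0.1678 \<and>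
     inducibility F36 = 25/6 * \<alpha>\<^sub>0\<^sup>2 - 25/6 * \<alpha>\<^sub>0 + 5/6 \<and>
     perfectly_stable F36 B36 \<and>
     unique_maximiser_up_to_automorphism F36 B36
       [1/2 * \<alpha>\<^sub>0, 1/2 * \<alpha>\<^sub>0, 1/2 - 1/2 * \<alpha>\<^sub>0, 1/2 - 1/2 * \<alpha>\<^sub>0]"
  by (rule exI[of _ alpha], intro conjI alpha_root inducibility_F36 perfectly_stable_F36 unique_maximiser)
    (use alpha_bounds in simp_all)

end
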